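(* Let $(M,J,g)$ be an almost Hermitian manifold with fundamental form $F=g(J\cdot,\cdot)$. Let $T$ be the torsion of its Chern connection, $\theta$ its torsion $1$-form, $t$ the anti-symmetrization of $T$, $s^H$ its Hermitian scalar curvature and $s^g$ its Riemannian scalar curvature. Then $$s^H - s^g = -\delta^g\theta - \tfrac{27}{2}|t|^2 + 2|T|^2 .$$
   Context: $M$ has real dimension $m=2n$, $J^2=-1$, $J$ is $g$-orthogonal. The Chern connection $\nabla$ is the unique connection on $TM$ with $\nabla g=0$, $\nabla J=0$ whose torsion $T_{XY}=\nabla_XY-\nabla_YX-[X,Y]$ satisfies $T_{JX,JY}=-T_{XY}$. Its curvature is $R_{XY}=[\nabla_X,\nabla_Y]-\nabla_{[X,Y]}$. For a local $g$-orthonormal frame $(e_i)_{i=1}^m$ with $e_{2\alpha}=Je_{2\alpha-1}$: Hermitian scalar curvature: $s^H=2s^C$ with $s^C=-\frac14\sum_{i,j}g(R_{e_i,Je_i}e_j,Je_j)$. $s^g$ is the usual scalar curvature of the Levi-Civita connection. Torsion $1$-form: $\theta=\Lambda(dF)$, i.e. $\theta(X)=\frac12\sum_i dF(e_i,Je_i,X)$; equivalently $\theta(X)=\operatorname{tr}(Z\mapsto T_{XZ})$. $t$ is the $3$-form $t_{XYZ}=\frac13\big(g(X,T_{YZ})+g(Z,T_{XY})+g(Y,T_{ZX})\big)$. Norms: $|T|^2=\frac12\sum_{i,j}|T_{e_ie_j}|^2$ (norm of a $TM$-valued $2$-form), $|t|^2=\frac16\sum_{i,j,k}t_{e_ie_je_k}^2$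 (usual norm of a $3$-form). $\delta^g$ is the codifferential with respect to $g$. *)

theory Defs
  imports "HOL-Analysis.Analysis" "HOL-Library.Function_Algebras"
begin

section \<open>Smooth manifolds\<close>

text \<open>
  \<open>Ck_on k S f\<close>: on the open set \<open>S\<close>, \<open>f\<close> has continuous iterated directional derivatives up to
  order \<open>k\<close>; in finite dimensions this is the usual class \<open>C\<^sup>k\<close>.
\<close>

primrec Ck_on :: "nat \<Rightarrow> 'e::euclidean_space set \<Rightarrow> ('e \<Rightarrow> 'f::real_normed_vector) \<Rightarrow> bool" where
  "Ck_on 0 S f \<longleftrightarrow> continuous_on S f"
| "Ck_on (Suc k) S f \<longleftrightarrow>
     (\<forall>x\<in>S. f differentiable (at x)) \<and> (\<forall>v. Ck_on k S (\<lambda>x. frechet_derivative f (at x) v))"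

definition smooth_on :: "'e::euclidean_space set \<Rightarrow> ('e \<Rightarrow> 'f::real_normed_vector) \<Rightarrow> bool" where
  "smooth_on S f \<longleftrightarrow> (\<forall>k. Ck_on k S f)"

record ('p, 'e) manifold =
  mtop :: "'p topology"
  atlas :: "('p set \<times> ('p \<Rightarrow> 'e)) set"

definition smooth_manifold :: "('p, 'e::euclidean_space) manifold \<Rightarrow> bool" where
  "smooth_manifold M \<longleftrightarrow>
     Hausdorff_space (mtop M) \<and> second_countable (mtop M) \<and>
     topspace (mtop M) = (\<Union>(V, \<phi>)\<in>atlas M. V) \<and>
     (\<forall>(V, \<phi>)\<in>atlas M.
        openin (mtop M) V \<and> open (\<phi> ` V) \<and>
        homeomorphic_map (subtopology (mtop M) V) (top_of_set (\<phi> ` V)) \<phi>) \<and>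
     (\<forall>(V, \<phi>)\<in>atlas M. \<forall>(W, \<psi>)\<in>atlas M. smooth_on (\<phi> ` (V \<inter> W)) (\<psi> \<circ> inv_into V \<phi>))"

definition smooth_fun :: "('p, 'e::euclidean_space) manifold \<Rightarrow> 'p set \<Rightarrow> ('p \<Rightarrow> real) \<Rightarrow> bool" where
  "smooth_fun M U f \<longleftrightarrow> (\<forall>(V, \<phi>)\<in>atlas M. smooth_on (\<phi> ` (U \<inter> V)) (f \<circ> inv_into V \<phi>))"

definition smooth_at :: "('p, 'e::euclidean_space) manifold \<Rightarrow> 'p \<Rightarrow> ('p \<Rightarrow> real) \<Rightarrow> bool" where
  "smooth_at M p f \<longleftrightarrow> (\<exists>U. openin (mtop M) U \<and> p \<in> U \<and> smooth_fun M U f)"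

section \<open>Tangent vectors and vector fields\<close>

text \<open>
  A tangent vector at \<open>p\<close> is a derivation, at \<open>p\<close>, of the functions that are smooth near \<open>p\<close>.  That it
  only depends on the germ of its argument follows from the Leibniz rule, since the indicator function
  of a neighbourhood of \<open>p\<close> is smooth near \<open>p\<close>.  The value \<open>0\<close> is prescribed on the remaining
  functions, so that equality of tangent vectors is equality in HOL.
\<close>

type_synonym 'p tvec = "('p \<Rightarrow> real) \<Rightarrow> real"
type_synonym 'p vfield = "'p \<Rightarrow> 'p tvec"

definition tangent_space :: "('p, 'e::euclidean_space) manifold \<Rightarrow> 'p \<Rightarrow> 'p tvec set" where
  "tangent_space M p = {v.
     (\<forall>f h a b. smooth_at M p f \<longrightarrow> smooth_at M p h \<longrightarrow>
        v (\<lambda>q. a * f q + b * h q) = a * v f + b * v h) \<and>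
     (\<forall>f h. smooth_at M p f \<longrightarrow> smooth_at M p h \<longrightarrow>
        v (\<lambda>q. f q * h q) = f p * v h + h p * v f) \<and>
     (\<forall>f. \<not> smooth_at M p f \<longrightarrow> v f = 0)}"

definition tscale :: "real \<Rightarrow> 'p tvec \<Rightarrow> 'p tvec" where
  "tscale a v = (\<lambda>f. a * v f)"

definition fscale :: "('p \<Rightarrow> real) \<Rightarrow> 'p vfield \<Rightarrow> 'p vfield" where
  "fscale f X = (\<lambda>p. tscale (f p) (X p))"

definition vector_field :: "('p, 'e::euclidean_space) manifold \<Rightarrow> 'p set \<Rightarrow> 'p vfield \<Rightarrow> bool" where
  "vector_field M U X \<longleftrightarrow>
     (\<forall>p\<in>U. X p \<in> tangent_space M p) \<and>
     (\<forall>W f. openin (mtop M) W \<longrightarrow> W \<subseteq> U \<longrightarrow> smooth_fun M W f \<longrightarrow> smooth_fun M W (\<lambda>p. X p f))"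

definition lie_bracket :: "('p, 'e::euclidean_space) manifold \<Rightarrow> 'p vfield \<Rightarrow> 'p vfield \<Rightarrow> 'p vfield" where
  "lie_bracket M X Y = (\<lambda>p f.
     if smooth_at M p f then X p (\<lambda>q. Y q f) - Y p (\<lambda>q. X q f) else 0)"

section \<open>Almost Hermitian structures\<close>

type_synonym 'p bilin_field = "'p \<Rightarrow> 'p tvec \<Rightarrow> 'p tvec \<Rightarrow> real"
type_synonym 'p endo_field = "'p \<Rightarrow> 'p tvec \<Rightarrow> 'p tvec"

definition fpair :: "'p bilin_field \<Rightarrow> 'p vfield \<Rightarrow> 'p vfield \<Rightarrow> 'p \<Rightarrow> real" where
  "fpair b X Y = (\<lambda>p. b p (X p) (Y p))"

definition fapp :: "'p endo_field \<Rightarrow> 'p vfield \<Rightarrow> 'p vfield" where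
  "fapp J X = (\<lambda>p. J p (X p))"

definition riemannian_metric :: "('p, 'e::euclidean_space) manifold \<Rightarrow> 'p bilin_field \<Rightarrow> bool" where
  "riemannian_metric M g \<longleftrightarrow>
     (\<forall>p\<in>topspace (mtop M). \<forall>u\<in>tangent_space M p. \<forall>v\<in>tangent_space M p.
        (\<forall>w\<in>tangent_space M p. \<forall>a b.
           g p (tscale a u + tscale b v) w = a * g p u w + b * g p v w) \<and>
        g p u v = g p v u \<and>
        (u \<noteq> 0 \<longrightarrow> g p u u > 0)) \<and>
     (\<forall>U X Y. openin (mtop M) U \<longrightarrow> vector_field M U X \<longrightarrow> vector_field M U Y \<longrightarrow>
        smooth_fun M U (fpair g X Y))"

definition almost_complex_structure :: "('p, 'e::euclidean_space) manifold \<Rightarrow> 'p endo_field \<Rightarrow> bool" where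
  "almost_complex_structure M J \<longleftrightarrow>
     (\<forall>p\<in>topspace (mtop M). \<forall>u\<in>tangent_space M p.
        J p u \<in> tangent_space M p \<and>
        (\<forall>v\<in>tangent_space M p. \<forall>a b.
           J p (tscale a u + tscale b v) = tscale a (J p u) + tscale b (J p v)) \<and>
        J p (J p u) = - u) \<and>
     (\<forall>U X. openin (mtop M) U \<longrightarrow> vector_field M U X \<longrightarrow> vector_field M U (fapp J X))"

definition almost_hermitian ::
  "('p, 'e::euclidean_space) manifold \<Rightarrow> 'p endo_field \<Rightarrow> 'p bilin_field \<Rightarrow> bool" where
  "almost_hermitian M J g \<longleftrightarrow>
     smooth_manifold M \<and> even DIM('e) \<and> riemannian_metric M g \<and> almost_complex_structure M J \<and>
     (\<forall>p\<in>topspace (mtop M). \<forall>u\<in>tangent_space M p. \<forall>v\<in>tangent_space M p.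
        g p (J p u) (J p v) = g p u v)"

definition fundamental_form :: "'p endo_field \<Rightarrow> 'p bilin_field \<Rightarrow> 'p bilin_field" where
  "fundamental_form J g = (\<lambda>p u v. g p (J p u) v)"

section \<open>Connections on the tangent bundle\<close>

text \<open>
  A connection acts on vector fields defined on any open set, compatibly with restriction.  On
  vector fields that are not smooth near a point its value there is irrelevant.
\<close>

type_synonym 'p conn = "'p vfield \<Rightarrow> 'p vfield \<Rightarrow> 'p vfield"

definition connection :: "('p, 'e::euclidean_space) manifold \<Rightarrow> 'p conn \<Rightarrow> bool" where
  "connection M nab \<longleftrightarrow> (\<forall>U. openin (mtop M) U \<longrightarrow>
     (\<forall>X Y. vector_field M U X \<longrightarrow> vector_field M U Y \<longrightarrow>
        vector_field M U (nab X Y) \<and>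
        (\<forall>X' Y'. (\<forall>p\<in>U. X' p = X p \<and> Y' p = Y p) \<longrightarrow> (\<forall>p\<in>U. nab X' Y' p = nab X Y p)) \<and>
        (\<forall>Z. vector_field M U Z \<longrightarrow>
           (\<forall>p\<in>U. nab (X + Z) Y p = nab X Y p + nab Z Y p \<and>
                  nab X (Y + Z) p = nab X Y p + nab X Z p)) \<and>
        (\<forall>f. smooth_fun M U f \<longrightarrow>
           (\<forall>p\<in>U. nab (fscale f X) Y p = tscale (f p) (nab X Y p) \<and>
                  nab X (fscale f Y) p = tscale (X p f) (Y p) + tscale (f p) (nab X Y p)))))"

definition torsion :: "('p, 'e::euclidean_space) manifold \<Rightarrow> 'p conn \<Rightarrow> 'p vfield \<Rightarrow> 'p vfield \<Rightarrow> 'p vfield" where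
  "torsion M nab X Y = nab X Y - nab Y X - lie_bracket M X Y"

definition curvature ::
  "('p, 'e::euclidean_space) manifold \<Rightarrow> 'p conn \<Rightarrow> 'p vfield \<Rightarrow> 'p vfield \<Rightarrow> 'p vfield \<Rightarrow> 'p vfield" where
  "curvature M nab X Y Z = nab X (nab Y Z) - nab Y (nab X Z) - nab (lie_bracket M X Y) Z"

definition metric_connection ::
  "('p, 'e::euclidean_space) manifold \<Rightarrow> 'p bilin_field \<Rightarrow> 'p conn \<Rightarrow> bool" where
  "metric_connection M g nab \<longleftrightarrow> connection M nab \<and>
     (\<forall>U X Y Z. openin (mtop M) U \<longrightarrow>
        vector_field M U X \<longrightarrow> vector_field M U Y \<longrightarrow> vector_field M U Z \<longrightarrow>
        (\<forall>p\<in>U. X p (fpair g Y Z) = fpair g (nab X Y) Z p + fpair g Y (nab X Z) p))"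

definition levi_civita_connection ::
  "('p, 'e::euclidean_space) manifold \<Rightarrow> 'p bilin_field \<Rightarrow> 'p conn \<Rightarrow> bool" where
  "levi_civita_connection M g D \<longleftrightarrow> metric_connection M g D \<and>
     (\<forall>U X Y. openin (mtop M) U \<longrightarrow> vector_field M U X \<longrightarrow> vector_field M U Y \<longrightarrow>
        (\<forall>p\<in>U. torsion M D X Y p = 0))"

definition chern_connection ::
  "('p, 'e::euclidean_space) manifold \<Rightarrow> 'p endo_field \<Rightarrow> 'p bilin_field \<Rightarrow> 'p conn \<Rightarrow> bool" where
  "chern_connection M J g nab \<longleftrightarrow> metric_connection M g nab \<and>
     (\<forall>U X Y. openin (mtop M) U \<longrightarrow> vector_field M U X \<longrightarrow> vector_field M U Y \<longrightarrow>
        (\<forall>p\<in>U. nab X (fapp J Y) p = fapp J (nab X Y) p \<and>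
               torsion M nab (fapp J X) (fapp J Y) p = - torsion M nab X Y p))"

section \<open>Local frames\<close>

text \<open>
  Frames are indexed by \<open>{1..DIM('e)}\<close>.  All the sums over a frame below are independent of the
  choice of the frame.
\<close>

definition orthonormal_frame ::
  "('p, 'e::euclidean_space) manifold \<Rightarrow> 'p bilin_field \<Rightarrow> 'p set \<Rightarrow> (nat \<Rightarrow> 'p vfield) \<Rightarrow> bool" where
  "orthonormal_frame M g U e \<longleftrightarrow>
     (\<forall>i\<in>{1..DIM('e)}. vector_field M U (e i)) \<and>
     (\<forall>p\<in>U. \<forall>i\<in>{1..DIM('e)}. \<forall>j\<in>{1..DIM('e)}. fpair g (e i) (e j) p = (if i = j then 1 else 0))"

definition hermitian_frame ::
  "('p, 'e::euclidean_space) manifold \<Rightarrow> 'p endo_field \<Rightarrow> 'p bilin_field \<Rightarrow> 'p set \<Rightarrow> (nat \<Rightarrow> 'p vfield) \<Rightarrow> bool" where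
  "hermitian_frame M J g U e \<longleftrightarrow> orthonormal_frame M g U e \<and>
     (\<forall>p\<in>U. \<forall>\<alpha>\<in>{1..DIM('e) div 2}. e (2 * \<alpha>) p = fapp J (e (2 * \<alpha> - 1)) p)"

definition on_frame_at :: "('p, 'e::euclidean_space) manifold \<Rightarrow> 'p bilin_field \<Rightarrow> 'p \<Rightarrow> nat \<Rightarrow> 'p vfield" where
  "on_frame_at M g p = (SOME e. \<exists>U. openin (mtop M) U \<and> p \<in> U \<and> orthonormal_frame M g U e)"

definition hermitian_frame_at ::
  "('p, 'e::euclidean_space) manifold \<Rightarrow> 'p endo_field \<Rightarrow> 'p bilin_field \<Rightarrow> 'p \<Rightarrow> nat \<Rightarrow> 'p vfield" where
  "hermitian_frame_at M J g p = (SOME e. \<exists>U. openin (mtop M) U \<and> p \<in> U \<and> hermitian_frame M J g U e)"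

section \<open>Riemannian notions\<close>

text \<open>
  Differential forms are represented by their action on (local) vector fields.
\<close>

definition scalar_curvature ::
  "('p, 'e::euclidean_space) manifold \<Rightarrow> 'p bilin_field \<Rightarrow> 'p conn \<Rightarrow> 'p \<Rightarrow> real" where
  "scalar_curvature M g D p = (let e = on_frame_at M g p in
     \<Sum>i=1..DIM('e). \<Sum>j=1..DIM('e). fpair g (curvature M D (e i) (e j) (e j)) (e i) p)"

text \<open>The summands are the values \<open>(D\<^bsub>e i\<^esub> \<theta>) (e i)\<close> of the covariant derivative of \<open>\<theta>\<close>.\<close>

definition codifferential ::
  "('p, 'e::euclidean_space) manifold \<Rightarrow> 'p bilin_field \<Rightarrow> 'p conn \<Rightarrow> ('p vfield \<Rightarrow> 'p \<Rightarrow> real) \<Rightarrow> 'p \<Rightarrow> real" where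
  "codifferential M g D \<theta> p = (let e = on_frame_at M g p in
     - (\<Sum>i=1..DIM('e). e i p (\<theta> (e i)) - \<theta> (D (e i) (e i)) p))"

definition norm2_vector_2form ::
  "('p, 'e::euclidean_space) manifold \<Rightarrow> 'p bilin_field \<Rightarrow> ('p vfield \<Rightarrow> 'p vfield \<Rightarrow> 'p vfield) \<Rightarrow> 'p \<Rightarrow> real" where
  "norm2_vector_2form M g T p = (let e = on_frame_at M g p in
     1/2 * (\<Sum>i=1..DIM('e). \<Sum>j=1..DIM('e). fpair g (T (e i) (e j)) (T (e i) (e j)) p))"

definition norm2_3form ::
  "('p, 'e::euclidean_space) manifold \<Rightarrow> 'p bilin_field \<Rightarrow>
   ('p vfield \<Rightarrow> 'p vfield \<Rightarrow> 'p vfield \<Rightarrow> 'p \<Rightarrow> real) \<Rightarrow> 'p \<Rightarrow> real" where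
  "norm2_3form M g t p = (let e = on_frame_at M g p in
     1/6 * (\<Sum>i=1..DIM('e). \<Sum>j=1..DIM('e). \<Sum>k=1..DIM('e). (t (e i) (e j) (e k) p)\<^sup>2))"

definition ext_deriv2 ::
  "('p, 'e::euclidean_space) manifold \<Rightarrow> 'p bilin_field \<Rightarrow> 'p vfield \<Rightarrow> 'p vfield \<Rightarrow> 'p vfield \<Rightarrow> 'p \<Rightarrow> real" where
  "ext_deriv2 M \<omega> X Y Z p =
     X p (fpair \<omega> Y Z) - Y p (fpair \<omega> X Z) + Z p (fpair \<omega> X Y)
     - fpair \<omega> (lie_bracket M X Y) Z p + fpair \<omega> (lie_bracket M X Z) Y p
     - fpair \<omega> (lie_bracket M Y Z) X p"

section \<open>Invariants of the Chern connection\<close>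

text \<open>The torsion 1-form \<open>\<Lambda> (dF)\<close>.\<close>

definition torsion_1form ::
  "('p, 'e::euclidean_space) manifold \<Rightarrow> 'p endo_field \<Rightarrow> 'p bilin_field \<Rightarrow> 'p vfield \<Rightarrow> 'p \<Rightarrow> real" where
  "torsion_1form M J g X p = (let e = hermitian_frame_at M J g p in
     1/2 * (\<Sum>i=1..DIM('e). ext_deriv2 M (fundamental_form J g) (e i) (fapp J (e i)) X p))"

definition torsion_3form ::
  "('p, 'e::euclidean_space) manifold \<Rightarrow> 'p bilin_field \<Rightarrow> 'p conn \<Rightarrow>
   'p vfield \<Rightarrow> 'p vfield \<Rightarrow> 'p vfield \<Rightarrow> 'p \<Rightarrow> real" where
  "torsion_3form M g nab X Y Z p = (let T = torsion M nab in
     1/3 * (fpair g X (T Y Z) p + fpair g Z (T X Y) p + fpair g Y (T Z X) p))"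

definition chern_scalar_curvature ::
  "('p, 'e::euclidean_space) manifold \<Rightarrow> 'p endo_field \<Rightarrow> 'p bilin_field \<Rightarrow> 'p conn \<Rightarrow> 'p \<Rightarrow> real" where
  "chern_scalar_curvature M J g nab p = (let e = hermitian_frame_at M J g p in
     - 1/4 * (\<Sum>i=1..DIM('e). \<Sum>j=1..DIM('e).
        fpair g (curvature M nab (e i) (fapp J (e i)) (e j)) (fapp J (e j)) p))"

definition hermitian_scalar_curvature ::
  "('p, 'e::euclidean_space) manifold \<Rightarrow> 'p endo_field \<Rightarrow> 'p bilin_field \<Rightarrow> 'p conn \<Rightarrow> 'p \<Rightarrow> real" where
  "hermitian_scalar_curvature M J g nab p = 2 * chern_scalar_curvature M J g nab p"

end

theory Submission
  imports Defs
begin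

text \<open>
  Write \<open>A = \<nabla> - D\<close> for the difference of the Chern and the Levi-Civita connection, and
  \<open>T\<^sub>i\<^sub>j\<^sub>k = g(T(e\<^sub>i, e\<^sub>j), e\<^sub>k)\<close>.  Three facts give the formula.

  Since both connections are metric, \<open>A\<close> is skew in its last two slots, so the torsion determines it:
  \<open>2 A\<^sub>i\<^sub>j\<^sub>k = T\<^sub>i\<^sub>j\<^sub>k - T\<^sub>j\<^sub>k\<^sub>i + T\<^sub>k\<^sub>i\<^sub>j\<close>.  Substituting \<open>\<nabla> = D + A\<close> in the curvature and tracing
  twice gives \<open>s\<^sup>\<nabla> - s\<^sup>g = 2 div \<theta> - |\<theta>|\<^sup>2 + \<Sum> A\<^sub>i\<^sub>j\<^sub>k A\<^sub>j\<^sub>i\<^sub>k\<close>, where \<open>s\<^sup>\<nabla>\<close> is the Riemannian-type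
  trace of the curvature of \<open>\<nabla>\<close> (\<open>scalar_curvature_difference\<close>).

  The first Bianchi identity with torsion, evaluated on \<open>e\<^sub>i, J e\<^sub>i, e\<^sub>j\<close> and paired with \<open>J e\<^sub>j\<close>, compares
  \<open>s\<^sup>H\<close> with \<open>s\<^sup>\<nabla>\<close>.  The first curvature term is the one in \<open>s\<^sup>H\<close>; as the curvature commutes with \<open>J\<close>,
  each of the other two sums to \<open>s\<^sup>\<nabla>\<close>.  The condition \<open>T(JX, JY) = - T(X, Y)\<close> says that
  \<open>T(JX, Y) = T(X, JY)\<close>, in particular \<open>T(X, JX) = 0\<close>, and the torsion terms collapse to
  \<open>s\<^sup>H = s\<^sup>\<nabla> - \<Sum> (\<nabla>\<^sub>i \<theta>)(e\<^sub>i) - \<Sum> T\<^sub>i\<^sub>j\<^sub>k T\<^sub>k\<^sub>i\<^sub>j\<close> with \<open>\<Sum> (\<nabla>\<^sub>i \<theta>)(e\<^sub>i) = div \<theta> - |\<theta>|\<^sup>2\<close>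
  (\<open>hermitian_scalar_curvature_components\<close>, \<open>N_trace\<close>).

  Adding up, \<open>s\<^sup>H - s\<^sup>g = div \<theta> + 1/4 \<Sum> T\<^sub>i\<^sub>j\<^sub>k\<^sup>2 - 3/2 \<Sum> T\<^sub>i\<^sub>j\<^sub>k T\<^sub>k\<^sub>i\<^sub>j\<close>.  Now \<open>|T|\<^sup>2 = 1/2 \<Sum> T\<^sub>i\<^sub>j\<^sub>k\<^sup>2\<close> and
  \<open>|t|\<^sup>2 = 1/18 (\<Sum> T\<^sub>i\<^sub>j\<^sub>k\<^sup>2 + 2 \<Sum> T\<^sub>i\<^sub>j\<^sub>k T\<^sub>k\<^sub>i\<^sub>j)\<close>, so the last two terms are \<open>- 27/2 |t|\<^sup>2 + 2 |T|\<^sup>2\<close>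
  (\<open>scalar_curvature_identity\<close>).

  These computations take place in one Hermitian frame, in which \<open>J\<close> only permutes the frame up to
  sign.  The invariants, however, are sums over frames picked by a choice operator, some orthonormal
  and some Hermitian.  Hence Hermitian frames must exist near every point
  (\<open>hermitian_frame_exists\<close>), for which one needs that the derivations at a point form a space of
  dimension \<open>DIM('e)\<close>: Hadamard's lemma gives the upper bound (\<open>tangent_coord_expansion\<close>).  And
  the sums must not depend on the frame, which follows from the linearity of the curvature, the torsion
  and \<open>D \<theta>\<close> over the smooth functions (\<open>trace_frame_independent\<close>).
\<close>

section \<open>Smooth functions on open sets of a Euclidean space\<close>

lemma Ck_on_cong:
  assumes "open S" "\<And>x. x \<in> S \<Longrightarrow> f x = h x"
  shows "Ck_on k S f \<longleftrightarrow> Ck_on k S h"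
  using assms(2)
proof (induction k arbitrary: f h)
  case 0
  then show ?case by (simp cong: continuous_on_cong)
next
  case (Suc k)
  have D: "(f has_derivative F) (at x) \<longleftrightarrow> (h has_derivative F) (at x)" if "x \<in> S" for x F
    using has_derivative_transform_within_open[OF _ assms(1) that] Suc.prems by metis
  have "f differentiable (at x) \<longleftrightarrow> h differentiable (at x)" if "x \<in> S" for x
    using D[OF that] by (simp add: differentiable_def)
  moreover have "frechet_derivative f (at x) = frechet_derivative h (at x)" if "x \<in> S" for x
    using D[OF that] by (simp add: frechet_derivative_def)
  then have "Ck_on k S (\<lambda>x. frechet_derivative f (at x) v) \<longleftrightarrow>
      Ck_on k S (\<lambda>x. frechet_derivative h (at x) v)" for v
    by (intro Suc.IH) simp
  ultimately show ?case by simp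
qed

lemma Ck_on_SucD: "Ck_on (Suc k) S f \<Longrightarrow> Ck_on k S f"
proof (induction k arbitrary: f)
  case 0
  then show ?case
    by (auto intro!: continuous_at_imp_continuous_on differentiable_imp_continuous_within)
next
  case (Suc k)
  then show ?case by (metis Ck_on.simps(2))
qed

lemma Ck_on_continuous: "Ck_on k S f \<Longrightarrow> continuous_on S f"
proof (induction k)
  case (Suc k)
  then show ?case using Ck_on_SucD by blast
qed simp

lemma Ck_on_subset: "Ck_on k S f \<Longrightarrow> T \<subseteq> S \<Longrightarrow> Ck_on k T f"
  by (induction k arbitrary: f) (auto intro: continuous_on_subset)

lemma Ck_on_SucI:
  assumes "open S" "\<And>x. x \<in> S \<Longrightarrow> (f has_derivative F x) (at x)"
    and "\<And>v. Ck_on k S (\<lambda>x. F x v)"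
  shows "Ck_on (Suc k) S f"
proof -
  have "frechet_derivative f (at x) = F x" if "x \<in> S" for x
    using assms(2)[OF that] by (metis frechet_derivative_at)
  then have "Ck_on k S (\<lambda>x. frechet_derivative f (at x) v)" for v
    using Ck_on_cong[OF assms(1), of "\<lambda>x. frechet_derivative f (at x) v" "\<lambda>x. F x v"] assms(3)
    by simp
  then show ?thesis
    using assms(2) by (auto simp: differentiable_def)
qed

lemma Ck_on_has_derivative:
  "Ck_on (Suc k) S f \<Longrightarrow> x \<in> S \<Longrightarrow> (f has_derivative frechet_derivative f (at x)) (at x)"
  using frechet_derivative_works by auto

lemma Ck_on_directional: "Ck_on (Suc k) S f \<Longrightarrow> Ck_on k S (\<lambda>x. frechet_derivative f (at x) v)"
  by simp

lemma Ck_on_const: "open S \<Longrightarrow> Ck_on k S (\<lambda>x. c)"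
proof (induction k arbitrary: c)
  case (Suc k)
  show ?case by (rule Ck_on_SucI[OF Suc.prems has_derivative_const]) (rule Suc.IH[OF Suc.prems])
qed simp

lemma Ck_on_linear:
  fixes f :: "'e::euclidean_space \<Rightarrow> 'f::real_normed_vector"
  assumes "open S" "bounded_linear L" "Ck_on k S f"
  shows "Ck_on k S (\<lambda>x. L (f x))"
  using assms(3)
proof (induction k arbitrary: f)
  case 0
  then show ?case using bounded_linear.continuous_on[OF assms(2)] by simp
next
  case (Suc k)
  show ?case
  proof (rule Ck_on_SucI[OF assms(1)])
    show "((\<lambda>x. L (f x)) has_derivative (\<lambda>v. L (frechet_derivative f (at x) v))) (at x)"
      if "x \<in> S" for x
      by (rule bounded_linear.has_derivative[OF assms(2) Ck_on_has_derivative[OF Suc.prems that]])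
  qed (use Suc in simp)
qed

lemma Ck_on_add:
  assumes "open S" "Ck_on k S f" "Ck_on k S h"
  shows "Ck_on k S (\<lambda>x. f x + h x)"
  using assms(2,3)
proof (induction k arbitrary: f h)
  case 0
  then show ?case by (simp add: continuous_on_add)
next
  case (Suc k)
  show ?case
    by (rule Ck_on_SucI[OF assms(1) has_derivative_add[OF Ck_on_has_derivative[OF Suc.prems(1)]
            Ck_on_has_derivative[OF Suc.prems(2)]]])
       (use Suc in auto)
qed

lemma Ck_on_sum:
  assumes "open S" "\<And>i. i \<in> I \<Longrightarrow> Ck_on k S (f i)"
  shows "Ck_on k S (\<lambda>x. \<Sum>i\<in>I. f i x)"
  using assms(2)
  by (induction I rule: infinite_finite_induct) (auto simp: assms(1) intro: Ck_on_const Ck_on_add)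

lemma Ck_on_mult:
  fixes f h :: "'e::euclidean_space \<Rightarrow> real"
  assumes "open S" "Ck_on k S f" "Ck_on k S h"
  shows "Ck_on k S (\<lambda>x. f x * h x)"
  using assms(2,3)
proof (induction k arbitrary: f h)
  case 0
  then show ?case by (simp add: continuous_on_mult)
next
  case (Suc k)
  show ?case
  proof (rule Ck_on_SucI[OF assms(1) has_derivative_mult[OF Ck_on_has_derivative[OF Suc.prems(1)]
            Ck_on_has_derivative[OF Suc.prems(2)]]])
    show "Ck_on k S (\<lambda>x. f x * frechet_derivative h (at x) v + frechet_derivative f (at x) v * h x)" for v
      by (intro Ck_on_add[OF assms(1)] Suc.IH Ck_on_SucD[OF Suc.prems(1)] Ck_on_SucD[OF Suc.prems(2)]
          Ck_on_directional Suc.prems)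
  qed
qed

text \<open>
  All exponents are treated at once, because the derivative of the power with exponent \<open>s\<close> involves
  the one with exponent \<open>s - 1\<close>.  The case \<open>s = - 1/2\<close> normalizes vector fields.
\<close>

lemma Ck_on_powr:
  fixes f :: "'e::euclidean_space \<Rightarrow> real"
  assumes "open S" "Ck_on k S f" "\<And>x. x \<in> S \<Longrightarrow> f x > 0"
  shows "Ck_on k S (\<lambda>x. f x powr s)"
  using assms(2)
proof (induction k arbitrary: s)
  case 0
  then show ?case
    using assms(3) by (fastforce intro!: continuous_on_powr continuous_on_const)
next
  case (Suc k)
  show ?case
  proof (rule Ck_on_SucI[OF assms(1)])
    show "((\<lambda>x. f x powr s) has_derivative
        (\<lambda>v. s * f x powr (s - 1) * frechet_derivative f (at x) v)) (at x)" if "x \<in> S" for x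
    proof -
      have "f x > 0" using assms(3) that by blast
      then have "((\<lambda>y. y powr s) has_derivative (\<lambda>v. s * f x powr (s - 1) * v)) (at (f x))"
        using has_real_derivative_powr[of "f x" s] by (simp add: has_field_derivative_def)
      from has_derivative_compose[OF Ck_on_has_derivative[OF Suc.prems that] this]
      show ?thesis .
    qed
    have "Ck_on k S (\<lambda>x. f x powr (s - 1))"
      using Suc Ck_on_SucD by blast
    then show "Ck_on k S (\<lambda>x. s * f x powr (s - 1) * frechet_derivative f (at x) v)" for v
      using Suc.prems by (intro Ck_on_mult Ck_on_const assms(1)) auto
  qed
qed

text \<open>
  By the chain rule, the derivative of \<open>f \<circ> \<tau>\<close> is a sum of products of components of the derivative of \<open>\<tau>\<close>
  with the partial derivatives of \<open>f\<close> composed with \<open>\<tau>\<close>, so one order of smoothness less is needed for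
  each factor.
\<close>

lemma Ck_on_compose:
  fixes f :: "'b::euclidean_space \<Rightarrow> real" and \<tau> :: "'a::euclidean_space \<Rightarrow> 'b"
  assumes "open S" "open T" "\<tau> ` S \<subseteq> T" "Ck_on k S \<tau>" "Ck_on k T f"
  shows "Ck_on k S (\<lambda>x. f (\<tau> x))"
  using assms(4,5)
proof (induction k arbitrary: f)
  case 0
  then show ?case
    using assms(3) by (auto intro: continuous_on_compose2[of T f S \<tau>])
next
  case (Suc k)
  have Df: "(f has_derivative frechet_derivative f (at (\<tau> x))) (at (\<tau> x))" if "x \<in> S" for x
    using Ck_on_has_derivative[OF Suc.prems(2)] assms(3) that by blast
  show ?case
  proof (rule Ck_on_SucI[OF assms(1)])
    show "((\<lambda>x. f (\<tau> x)) has_derivative (\<lambda>v. \<Sum>b\<in>Basis.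
         (frechet_derivative \<tau> (at x) v \<bullet> b) * frechet_derivative f (at (\<tau> x)) b)) (at x)"
      if "x \<in> S" for x
    proof -
      have "linear (frechet_derivative f (at (\<tau> x)))"
        using has_derivative_linear[OF Df[OF that]] .
      then have "frechet_derivative f (at (\<tau> x)) (\<Sum>b\<in>Basis. (w \<bullet> b) *\<^sub>R b) =
          (\<Sum>b\<in>Basis. (w \<bullet> b) * frechet_derivative f (at (\<tau> x)) b)" for w
        by (simp add: linear_sum linear_scale)
      then have "(\<lambda>w. frechet_derivative f (at (\<tau> x)) w) =
          (\<lambda>w. \<Sum>b\<in>Basis. (w \<bullet> b) * frechet_derivative f (at (\<tau> x)) b)"
        unfolding euclidean_representation by (rule ext)
      then have "(\<lambda>v. frechet_derivative f (at (\<tau> x)) (frechet_derivative \<tau> (at x) v)) =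
          (\<lambda>v. \<Sum>b\<in>Basis. (frechet_derivative \<tau> (at x) v \<bullet> b) * frechet_derivative f (at (\<tau> x)) b)"
        by (rule arg_cong[where f = "\<lambda>F v. F (frechet_derivative \<tau> (at x) v)"])
      then show ?thesis
        using has_derivative_compose[OF Ck_on_has_derivative[OF Suc.prems(1) that] Df[OF that]]
        by (simp only:)
    qed
    fix v
    have 1: "Ck_on k S (\<lambda>x. frechet_derivative \<tau> (at x) v \<bullet> b)" for b
      using Suc.prems(1) by (intro Ck_on_linear[OF assms(1) bounded_linear_inner_left]) simp
    have 2: "Ck_on k S (\<lambda>x. frechet_derivative f (at (\<tau> x)) b)" for b
      using Suc.prems(2) by (intro Suc.IH Ck_on_SucD[OF Suc.prems(1)]) simp
    show "Ck_on k S (\<lambda>x. \<Sum>b\<in>Basis.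
        (frechet_derivative \<tau> (at x) v \<bullet> b) * frechet_derivative f (at (\<tau> x)) b)"
      by (intro Ck_on_sum Ck_on_mult assms(1) 1 2)
  qed
qed

text \<open>
  Differentiation under the integral sign.  The weight \<open>t ^ m\<close> makes the induction go through, since
  each derivative in \<open>x\<close> produces one more factor \<open>t\<close>.
\<close>

lemma Ck_on_ray_integral:
  fixes f :: "'e::euclidean_space \<Rightarrow> real"
  assumes S: "open S" "convex S" "a \<in> S" and "Ck_on k S f"
  shows "Ck_on k S (\<lambda>x. integral (cbox 0 1) (\<lambda>t::real. t ^ m * f (a + t *\<^sub>R (x - a))))"
  using assms(4)
proof (induction k arbitrary: f m)
  have inS: "a + t *\<^sub>R (x - a) \<in> S" if "x \<in> S" "t \<in> cbox 0 1" for x t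
    using convexD_alt[OF S(2) S(3) that(1), of t] that(2) by (simp add: algebra_simps)
  have cont: "continuous_on (S \<times> cbox 0 1) (\<lambda>(x,t). t ^ m * h (a + t *\<^sub>R (x - a)))"
    if "continuous_on S h" for h :: "'e \<Rightarrow> real" and m
  proof -
    have "continuous_on (S \<times> cbox 0 1) (\<lambda>z. h (a + snd z *\<^sub>R (fst z - a)))"
      by (rule continuous_on_compose2[OF that]) (use inS in \<open>auto intro!: continuous_intros\<close>)
    then show ?thesis by (auto simp: split_beta intro!: continuous_intros)
  qed
  {
    case 0
    then show ?case using integral_continuous_on_param[OF cont[of f m]] by simp
  next
    case (Suc k)
    have cf: "continuous_on S f"
      by (rule Ck_on_continuous[OF Suc.prems])
    have cDf: "continuous_on S (\<lambda>x. frechet_derivative f (at x) v)" for v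
    proof -
      show ?thesis by (rule Ck_on_continuous[OF Ck_on_directional[OF Suc.prems]])
    qed
    \<comment> \<open>The integrand of the derivative as a bounded linear map, as the Leibniz rule requires.\<close>
    define G where "G x t = Blinfun (\<lambda>v. t ^ Suc m * frechet_derivative f (at (a + t *\<^sub>R (x - a))) v)"
      for x and t :: real
    have bl: "bounded_linear (frechet_derivative f (at y))" if "y \<in> S" for y
      using Ck_on_has_derivative[OF Suc.prems that] by (rule has_derivative_bounded_linear)
    have G: "blinfun_apply (G x t) v = t ^ Suc m * frechet_derivative f (at (a + t *\<^sub>R (x - a))) v"
      if "x \<in> S" "t \<in> cbox 0 1" for x t v
      unfolding G_def
      by (subst bounded_linear_Blinfun_apply[OF bounded_linear_const_mult[OF bl[OF inS[OF that]]]]) simp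
    have cG: "continuous_on (S \<times> cbox 0 1) (\<lambda>(x, t). G x t)"
    proof (rule continuous_on_blinfun_componentwise)
      fix b :: 'e
      show "continuous_on (S \<times> cbox 0 1) (\<lambda>z. blinfun_apply (case z of (x, t) \<Rightarrow> G x t) b)"
        by (rule continuous_on_eq[OF cont[OF cDf[of b], of "Suc m"]]) (auto simp: G)
    qed
    show ?case
    proof (rule Ck_on_SucI[OF S(1)])
      fix x assume x: "x \<in> S"
      have "((\<lambda>x. integral (cbox 0 1) (\<lambda>t. t ^ m * f (a + t *\<^sub>R (x - a)))) has_derivative
        blinfun_apply (integral (cbox 0 1) (G x))) (at x within S)"
      proof (rule leibniz_rule[OF _ _ cG x S(2)])
        fix y :: 'e and t :: real assume y: "y \<in> S" "t \<in> cbox 0 1"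
        have "(f has_derivative frechet_derivative f (at (a + t *\<^sub>R (y - a)))) (at (a + t *\<^sub>R (y - a)))"
          using Ck_on_has_derivative[OF Suc.prems inS[OF y]] .
        moreover have "((\<lambda>x. a + t *\<^sub>R (x - a)) has_derivative (\<lambda>v. t *\<^sub>R v)) (at y within S)"
          by (auto intro!: derivative_eq_intros)
        ultimately have "((\<lambda>x. f (a + t *\<^sub>R (x - a))) has_derivative
            (\<lambda>v. frechet_derivative f (at (a + t *\<^sub>R (y - a))) (t *\<^sub>R v))) (at y within S)"
          by (rule has_derivative_compose[rotated])
        from has_derivative_mult_right[OF this, of "t ^ m"]
        have "((\<lambda>x. t ^ m * f (a + t *\<^sub>R (x - a))) has_derivative
          (\<lambda>v. t ^ m * frechet_derivative f (at (a + t *\<^sub>R (y - a))) (t *\<^sub>R v))) (at y within S)" .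
        moreover have "(\<lambda>v. t ^ m * frechet_derivative f (at (a + t *\<^sub>R (y - a))) (t *\<^sub>R v)) = blinfun_apply (G y t)"
          by (simp add: G[OF y] fun_eq_iff linear_scale[OF bounded_linear.linear[OF bl[OF inS[OF y]]]])
        ultimately
        show "((\<lambda>x. t ^ m * f (a + t *\<^sub>R (x - a))) has_derivative blinfun_apply (G y t)) (at y within S)"
          by simp
      next
        fix y assume y: "y \<in> S"
        have "continuous_on (cbox 0 1) (\<lambda>t. (\<lambda>(x,t). t ^ m * f (a + t *\<^sub>R (x - a))) (y, t))"
          by (rule continuous_on_compose2[OF cont[OF cf, of m]]) (use y in \<open>auto intro!: continuous_intros\<close>)
        then show "(\<lambda>t. t ^ m * f (a + t *\<^sub>R (y - a))) integrable_on cbox 0 1"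
          by (intro integrable_continuous) simp
      qed
      moreover have "G x integrable_on cbox 0 1"
      proof (intro integrable_continuous)
        have "continuous_on (cbox 0 1) (\<lambda>t. (\<lambda>(x,t). G x t) (x, t))"
          by (rule continuous_on_compose2[OF cG]) (use x in \<open>auto intro!: continuous_intros\<close>)
        then show "continuous_on (cbox 0 1) (G x)" by simp
      qed
      then have "blinfun_apply (integral (cbox 0 1) (G x)) v =
          integral (cbox 0 1) (\<lambda>t. blinfun_apply (G x t) v)" for v
        by (rule blinfun_apply_integral)
      then have "blinfun_apply (integral (cbox 0 1) (G x)) = (\<lambda>v. integral (cbox 0 1)
           (\<lambda>t. t ^ Suc m * frechet_derivative f (at (a + t *\<^sub>R (x - a))) v))"
        by (simp only: fun_eq_iff) (intro allI integral_cong, simp only: G[OF x])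
      ultimately show "((\<lambda>x. integral (cbox 0 1) (\<lambda>t. t ^ m * f (a + t *\<^sub>R (x - a)))) has_derivative
        (\<lambda>v. integral (cbox 0 1) (\<lambda>t. t ^ Suc m * frechet_derivative f (at (a + t *\<^sub>R (x - a))) v))) (at x)"
        unfolding at_within_open[OF x S(1)] by simp
    next
      show "Ck_on k S (\<lambda>x. integral (cbox 0 1)
          (\<lambda>t. t ^ Suc m * frechet_derivative f (at (a + t *\<^sub>R (x - a))) v))" for v
        by (rule Suc.IH[OF Ck_on_directional[OF Suc.prems]])
    qed
  }
qed

text \<open>
  Integrate the derivative of \<open>f\<close> along the segment from \<open>a\<close> to \<open>x\<close>.
\<close>

lemma smooth_on_Hadamard:
  fixes f :: "'e::euclidean_space \<Rightarrow> real"
  assumes S: "open S" "convex S" "a \<in> S" and f: "smooth_on S f"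
  obtains h where "\<And>b. smooth_on S (h b)"
    "\<And>b. h b a = frechet_derivative f (at a) b"
    "\<And>x. x \<in> S \<Longrightarrow> f x = f a + (\<Sum>b\<in>Basis. ((x - a) \<bullet> b) * h b x)"
proof
  define h where "h b x = integral (cbox 0 1)
     (\<lambda>t::real. t ^ 0 * frechet_derivative f (at (a + t *\<^sub>R (x - a))) b)" for b x
  have f1: "Ck_on (Suc k) S f" for k using f by (simp add: smooth_on_def)
  show "smooth_on S (h b)" for b
    unfolding smooth_on_def h_def using f1 by (intro allI Ck_on_ray_integral S) simp
  show "h b a = frechet_derivative f (at a) b" for b by (simp add: h_def)
  fix x assume x: "x \<in> S"
  have inS: "a + t *\<^sub>R (x - a) \<in> S" if "t \<in> {0..1}" for t
    using convexD_alt[OF S(2) S(3) x, of t] that by (simp add: algebra_simps)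
  have Df: "(f has_derivative frechet_derivative f (at (a + t *\<^sub>R (x - a)))) (at (a + t *\<^sub>R (x - a)))"
    if "t \<in> {0..1}" for t
    using Ck_on_has_derivative[OF f1 inS[OF that]] .
  have "((\<lambda>t. frechet_derivative f (at (a + t *\<^sub>R (x - a))) (x - a)) has_integral
      f (a + 1 *\<^sub>R (x - a)) - f (a + 0 *\<^sub>R (x - a))) {0..1}"
  proof (rule fundamental_theorem_of_calculus)
    fix t :: real assume t: "t \<in> {0..1}"
    have "((\<lambda>t. a + t *\<^sub>R (x - a)) has_derivative (\<lambda>s. s *\<^sub>R (x - a))) (at t within {0..1})"
      by (auto intro!: derivative_eq_intros)
    from has_derivative_compose[OF this Df[OF t]]
    show "((\<lambda>t. f (a + t *\<^sub>R (x - a))) has_vector_derivative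
        frechet_derivative f (at (a + t *\<^sub>R (x - a))) (x - a)) (at t within {0..1})"
      using linear_scale[OF has_derivative_linear[OF Df[OF t]]]
      by (simp add: has_vector_derivative_def)
  qed simp
  then have "f x - f a = integral {0..1} (\<lambda>t. frechet_derivative f (at (a + t *\<^sub>R (x - a))) (x - a))"
    by (simp add: integral_unique)
  moreover have "frechet_derivative f (at (a + t *\<^sub>R (x - a))) (x - a) =
      (\<Sum>b\<in>Basis. ((x - a) \<bullet> b) * frechet_derivative f (at (a + t *\<^sub>R (x - a))) b)"
    if "t \<in> {0..1}" for t
  proof -
    have "frechet_derivative f (at (a + t *\<^sub>R (x - a))) (x - a) =
       frechet_derivative f (at (a + t *\<^sub>R (x - a))) (\<Sum>b\<in>Basis. ((x - a) \<bullet> b) *\<^sub>R b)"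
      by (simp add: euclidean_representation)
    also have "\<dots> = (\<Sum>b\<in>Basis. ((x - a) \<bullet> b) * frechet_derivative f (at (a + t *\<^sub>R (x - a))) b)"
      using has_derivative_linear[OF Df[OF that]] by (simp add: linear_sum linear_scale)
    finally show ?thesis .
  qed
  moreover have int: "(\<lambda>t. ((x - a) \<bullet> b) * frechet_derivative f (at (a + t *\<^sub>R (x - a))) b) integrable_on {0..1}"
    for b
  proof -
    have "continuous_on S (\<lambda>x. frechet_derivative f (at x) b)"
      using f1[of 0] by simp
    then have "continuous_on {0..1} (\<lambda>t. frechet_derivative f (at (a + t *\<^sub>R (x - a))) b)"
      by (rule continuous_on_compose2) (use inS in \<open>auto intro!: continuous_intros\<close>)
    then show ?thesis
      by (intro integrable_continuous_real continuous_intros)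
  qed
  ultimately have "f x - f a = integral {0..1} (\<lambda>t. \<Sum>b\<in>Basis. ((x - a) \<bullet> b) *
      frechet_derivative f (at (a + t *\<^sub>R (x - a))) b)"
    by (subst (asm) integral_cong) auto
  also have "\<dots> = (\<Sum>b\<in>Basis. ((x - a) \<bullet> b) * h b x)"
    using int by (subst integral_sum) (auto simp: h_def)
  finally show "f x = f a + (\<Sum>b\<in>Basis. ((x - a) \<bullet> b) * h b x)" by simp
qed

section \<open>Smooth functions on a manifold\<close>

locale smooth_mfd =
  fixes M :: "('p, 'e::euclidean_space) manifold"
  assumes mfd: "smooth_manifold M"
begin

abbreviation points :: "'p set" where
  "points \<equiv> topspace (mtop M)"

abbreviation open_in :: "'p set \<Rightarrow> bool" where
  "open_in \<equiv> openin (mtop M)"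

abbreviation TM :: "'p \<Rightarrow> 'p tvec set" where
  "TM \<equiv> tangent_space M"

abbreviation vf :: "'p set \<Rightarrow> 'p vfield \<Rightarrow> bool" where
  "vf \<equiv> vector_field M"

abbreviation smooth :: "'p set \<Rightarrow> ('p \<Rightarrow> real) \<Rightarrow> bool" where
  "smooth \<equiv> smooth_fun M"

abbreviation lie :: "'p vfield \<Rightarrow> 'p vfield \<Rightarrow> 'p vfield" where
  "lie \<equiv> lie_bracket M"

lemma chart_openin: "(V, \<phi>) \<in> atlas M \<Longrightarrow> open_in V"
  and chart_homeo: "(V, \<phi>) \<in> atlas M \<Longrightarrow>
    homeomorphic_map (subtopology (mtop M) V) (top_of_set (\<phi> ` V)) \<phi>"
  and chart_open: "(V, \<phi>) \<in> atlas M \<Longrightarrow> open (\<phi> ` V)"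
  using mfd by (auto simp: smooth_manifold_def)

lemma transition_smooth:
  "(V, \<phi>) \<in> atlas M \<Longrightarrow> (W, \<psi>) \<in> atlas M \<Longrightarrow> smooth_on (\<phi> ` (V \<inter> W)) (\<psi> \<circ> inv_into V \<phi>)"
  using mfd unfolding smooth_manifold_def by fast

lemma chart_exists:
  assumes "p \<in> points"
  obtains V \<phi> where "(V, \<phi>) \<in> atlas M" "p \<in> V"
  using mfd assms unfolding smooth_manifold_def by auto

lemma chart_subset: "(V, \<phi>) \<in> atlas M \<Longrightarrow> V \<subseteq> points"
  using chart_openin openin_subset by blast

lemma chart_inj: "(V, \<phi>) \<in> atlas M \<Longrightarrow> inj_on \<phi> V"
  using homeomorphic_imp_injective_map[OF chart_homeo, of V \<phi>] chart_subset[of V \<phi>]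
  by (simp add: Int_absorb1)

lemma chart_inv: "(V, \<phi>) \<in> atlas M \<Longrightarrow> q \<in> V \<Longrightarrow> inv_into V \<phi> (\<phi> q) = q"
  using chart_inj inv_into_f_f by metis

lemma chart_image_open:
  assumes "(V, \<phi>) \<in> atlas M" "open_in U"
  shows "open (\<phi> ` (U \<inter> V))"
proof -
  have "openin (subtopology (mtop M) V) (U \<inter> V)"
    using assms(2) by (rule openin_subtopology_Int)
  then have "openin (top_of_set (\<phi> ` V)) (\<phi> ` (U \<inter> V))"
    using homeomorphic_imp_open_map[OF chart_homeo[OF assms(1)]] by (simp add: open_map_def)
  then show ?thesis using chart_open[OF assms(1)] openin_open_trans by blast
qed

lemma chart_preimage_openin:
  assumes "(V, \<phi>) \<in> atlas M" "open S"
  shows "open_in {q \<in> V. \<phi> q \<in> S}"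
proof -
  have "openin (top_of_set (\<phi> ` V)) (S \<inter> \<phi> ` V)"
    using assms(2) by (metis inf_commute openin_open_Int)
  then have "openin (subtopology (mtop M) V)
      {q \<in> topspace (subtopology (mtop M) V). \<phi> q \<in> S \<inter> \<phi> ` V}"
    by (rule openin_continuous_map_preimage[OF homeomorphic_imp_continuous_map[OF chart_homeo[OF assms(1)]]])
  moreover have "{q \<in> topspace (subtopology (mtop M) V). \<phi> q \<in> S \<inter> \<phi> ` V} = {q \<in> V. \<phi> q \<in> S}"
    using chart_subset[OF assms(1)] by auto
  ultimately show ?thesis using chart_openin[OF assms(1)] openin_trans_full by metis
qed

lemma smooth_fun_iff:
  "smooth U f \<longleftrightarrow>
    (\<forall>V \<phi> k. (V, \<phi>) \<in> atlas M \<longrightarrow> Ck_on k (\<phi> ` (U \<inter> V)) (\<lambda>x. f (inv_into V \<phi> x)))"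
  by (auto simp: smooth_fun_def smooth_on_def o_def)

lemma smooth_fun_cong:
  assumes "open_in U" "\<And>q. q \<in> U \<Longrightarrow> f q = h q"
  shows "smooth U f \<longleftrightarrow> smooth U h"
proof -
  have "Ck_on k (\<phi> ` (U \<inter> V)) (\<lambda>x. f (inv_into V \<phi> x)) \<longleftrightarrow>
      Ck_on k (\<phi> ` (U \<inter> V)) (\<lambda>x. h (inv_into V \<phi> x))" if "(V, \<phi>) \<in> atlas M" for V \<phi> k
    by (rule Ck_on_cong[OF chart_image_open[OF that assms(1)]]) (auto simp: chart_inv[OF that] assms(2))
  then show ?thesis unfolding smooth_fun_iff by blast
qed

lemma smooth_fun_subset: "smooth U f \<Longrightarrow> W \<subseteq> U \<Longrightarrow> smooth W f"
  unfolding smooth_fun_iff by (blast intro: Ck_on_subset)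

lemma smooth_fun_const: "open_in U \<Longrightarrow> smooth U (\<lambda>q. c)"
  unfolding smooth_fun_iff by (simp add: Ck_on_const chart_image_open)

lemma smooth_fun_add:
  "open_in U \<Longrightarrow> smooth U f \<Longrightarrow> smooth U h \<Longrightarrow> smooth U (\<lambda>q. f q + h q)"
  unfolding smooth_fun_iff by (simp add: Ck_on_add chart_image_open)

lemma smooth_fun_mult:
  "open_in U \<Longrightarrow> smooth U f \<Longrightarrow> smooth U h \<Longrightarrow> smooth U (\<lambda>q. f q * h q)"
  unfolding smooth_fun_iff by (simp add: Ck_on_mult chart_image_open)

lemma smooth_fun_powr:
  assumes "open_in U" "smooth U f" "\<And>q. q \<in> U \<Longrightarrow> f q > 0"
  shows "smooth U (\<lambda>q. f q powr s)"
  unfolding smooth_fun_iff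
proof (intro allI impI)
  fix V \<phi> k assume V: "(V, \<phi>) \<in> atlas M"
  show "Ck_on k (\<phi> ` (U \<inter> V)) (\<lambda>x. f (inv_into V \<phi> x) powr s)"
    using assms(2) V
    by (intro Ck_on_powr chart_image_open[OF V assms(1)]) (auto simp: smooth_fun_iff chart_inv[OF V] assms(3))
qed

lemma smooth_fun_uminus:
  "open_in U \<Longrightarrow> smooth U f \<Longrightarrow> smooth U (\<lambda>q. - f q)"
  using smooth_fun_mult[OF _ smooth_fun_const, of U f "-1"] by simp

lemma smooth_fun_diff:
  "open_in U \<Longrightarrow> smooth U f \<Longrightarrow> smooth U h \<Longrightarrow> smooth U (\<lambda>q. f q - h q)"
  using smooth_fun_add[OF _ _ smooth_fun_uminus, of U f h] by simp

lemma smooth_fun_sum: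
  "open_in U \<Longrightarrow> (\<And>i. i \<in> I \<Longrightarrow> smooth U (f i)) \<Longrightarrow> smooth U (\<lambda>q. \<Sum>i\<in>I. f i q)"
  unfolding smooth_fun_iff by (simp add: Ck_on_sum chart_image_open)

text \<open>
  Smoothness in one chart suffices, because the transition maps to all other charts are smooth.
\<close>

lemma smooth_fun_chartI:
  assumes V: "(V, \<phi>) \<in> atlas M" and U: "open_in U" "U \<subseteq> V"
    and f: "smooth_on (\<phi> ` U) (\<lambda>x. f (inv_into V \<phi> x))"
  shows "smooth U f"
  unfolding smooth_fun_iff
proof (intro allI impI)
  fix W \<psi> k assume W: "(W, \<psi>) \<in> atlas M"
  let ?\<tau> = "\<phi> \<circ> inv_into W \<psi>"
  have op: "open (\<psi> ` (U \<inter> W))" by (rule chart_image_open[OF W U(1)])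
  have "Ck_on k (\<psi> ` (W \<inter> V)) ?\<tau>"
    using transition_smooth[OF W V] by (simp add: smooth_on_def)
  then have \<tau>: "Ck_on k (\<psi> ` (U \<inter> W)) ?\<tau>"
    by (rule Ck_on_subset) (use U(2) in auto)
  have "U \<inter> V = U" using U(2) by auto
  then have opf: "open (\<phi> ` U)" using chart_image_open[OF V U(1)] by simp
  have "Ck_on k (\<psi> ` (U \<inter> W)) (\<lambda>x. f (inv_into V \<phi> (?\<tau> x)))"
    by (rule Ck_on_compose[OF op opf _ \<tau>, of "\<lambda>y. f (inv_into V \<phi> y)"])
       (use f in \<open>auto simp: smooth_on_def chart_inv[OF W]\<close>)
  also have "?this \<longleftrightarrow> Ck_on k (\<psi> ` (U \<inter> W)) (\<lambda>x. f (inv_into W \<psi> x))"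
    by (rule Ck_on_cong[OF op]) (use U(2) in \<open>auto simp: chart_inv[OF W] chart_inv[OF V]\<close>)
  finally show "Ck_on k (\<psi> ` (U \<inter> W)) (\<lambda>x. f (inv_into W \<psi> x))" .
qed

lemma smooth_fun_chartD:
  "smooth U f \<Longrightarrow> (V, \<phi>) \<in> atlas M \<Longrightarrow> U \<subseteq> V \<Longrightarrow> smooth_on (\<phi> ` U) (\<lambda>x. f (inv_into V \<phi> x))"
  unfolding smooth_on_def smooth_fun_iff using Int_absorb2[of U V] by metis

lemma smooth_fun_chart_coord:
  assumes V: "(V, \<phi>) \<in> atlas M"
  shows "smooth V (\<lambda>q. \<phi> q \<bullet> b)"
proof (rule smooth_fun_chartI[OF V chart_openin[OF V] order_refl], unfold smooth_on_def, intro allI)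
  fix k
  have "Ck_on k (\<phi> ` V) (\<lambda>x. x \<bullet> b)"
  proof (cases k)
    case (Suc j)
    show ?thesis unfolding Suc
      by (rule Ck_on_SucI[OF chart_open[OF V] bounded_linear.has_derivative[OF bounded_linear_inner_left
            has_derivative_ident]]) (simp add: Ck_on_const chart_open[OF V])
  qed (simp add: continuous_on_inner continuous_on_id continuous_on_const)
  then show "Ck_on k (\<phi> ` V) (\<lambda>x. \<phi> (inv_into V \<phi> x) \<bullet> b)"
    by (subst Ck_on_cong[OF chart_open[OF V], of _ "\<lambda>x. x \<bullet> b"]) (auto simp: chart_inv[OF V])
qed

lemma smooth_fun_positive_openin:
  assumes U: "open_in U" and f: "smooth U f"
  shows "open_in {q \<in> U. f q > 0}"
proof (subst openin_subopen, intro ballI)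
  fix q assume q: "q \<in> {q \<in> U. f q > 0}"
  then obtain V \<phi> where V: "(V, \<phi>) \<in> atlas M" "q \<in> V"
    using chart_exists openin_subset[OF U] by blast
  let ?S = "{x \<in> \<phi> ` (U \<inter> V). f (inv_into V \<phi> x) > 0}"
  have "continuous_on (\<phi> ` (U \<inter> V)) (\<lambda>x. f (inv_into V \<phi> x))"
    using f V(1) Ck_on_continuous unfolding smooth_fun_iff by blast
  then have "openin (top_of_set (\<phi> ` (U \<inter> V))) (\<phi> ` (U \<inter> V) \<inter> (\<lambda>x. f (inv_into V \<phi> x)) -` {0<..})"
    by (rule continuous_openin_preimage_gen) simp
  moreover have "\<phi> ` (U \<inter> V) \<inter> (\<lambda>x. f (inv_into V \<phi> x)) -` {0<..} = ?S" by auto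
  ultimately have "openin (top_of_set (\<phi> ` (U \<inter> V))) ?S" by simp
  then have "open ?S" using chart_image_open[OF V(1) U] openin_open_trans by blast
  from chart_preimage_openin[OF V(1) this]
  have "open_in {q \<in> V. \<phi> q \<in> ?S}" .
  moreover have "q \<in> {q \<in> V. \<phi> q \<in> ?S}" using q V by (auto simp: chart_inv[OF V(1)])
  moreover have "{q \<in> V. \<phi> q \<in> ?S} \<subseteq> {q \<in> U. f q > 0}"
    by (auto simp: chart_inv[OF V(1)] dest: inj_onD[OF chart_inj[OF V(1)]])
  ultimately show "\<exists>T. open_in T \<and> q \<in> T \<and> T \<subseteq> {q \<in> U. f q > 0}" by blast
qed

lemma smooth_atI: "open_in U \<Longrightarrow> p \<in> U \<Longrightarrow> smooth U f \<Longrightarrow> smooth_at M p f"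
  unfolding smooth_at_def by blast

end

section \<open>Tangent spaces\<close>

lemma tscale_apply [simp]: "tscale a v f = a * v f"
  by (simp add: tscale_def)

lemma sum_fun_apply: "(\<Sum>i\<in>I. F i) x = (\<Sum>i\<in>I. F i x)"
  for F :: "'i \<Rightarrow> 'a \<Rightarrow> 'b::comm_monoid_add"
  by (induction I rule: infinite_finite_induct) auto

text \<open>
  Derivations are elements of a function space; regarded as a real vector space, it supplies the
  exchange lemma, which is all the dimension theory needed below.
\<close>

interpretation tvs: vector_space "tscale :: real \<Rightarrow> 'p tvec \<Rightarrow> 'p tvec"
  by standard (auto simp: fun_eq_iff algebra_simps)

context smooth_mfd
begin

lemma smooth_at_obtain2:
  assumes "smooth_at M p f" "smooth_at M p h"
  obtains U where "open_in U" "p \<in> U" "smooth U f" "smooth U h"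
proof -
  obtain U W where "open_in U" "p \<in> U" "smooth U f"
    "open_in W" "p \<in> W" "smooth W h"
    using assms unfolding smooth_at_def by blast
  then show thesis
    using that[of "U \<inter> W"] smooth_fun_subset by (meson IntI Int_lower1 Int_lower2 openin_Int)
qed

lemma smooth_at_const: "p \<in> points \<Longrightarrow> smooth_at M p (\<lambda>q. c)"
  using smooth_atI[OF openin_topspace _ smooth_fun_const[OF openin_topspace]] .

lemma smooth_at_add: "smooth_at M p f \<Longrightarrow> smooth_at M p h \<Longrightarrow> smooth_at M p (\<lambda>q. f q + h q)"
  by (erule (1) smooth_at_obtain2) (rule smooth_atI[OF _ _ smooth_fun_add])

lemma smooth_at_mult: "smooth_at M p f \<Longrightarrow> smooth_at M p h \<Longrightarrow> smooth_at M p (\<lambda>q. f q * h q)"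
  by (erule (1) smooth_at_obtain2) (rule smooth_atI[OF _ _ smooth_fun_mult])

lemma smooth_at_sum:
  "p \<in> points \<Longrightarrow> (\<And>i. i \<in> I \<Longrightarrow> smooth_at M p (f i)) \<Longrightarrow> smooth_at M p (\<lambda>q. \<Sum>i\<in>I. f i q)"
  by (induction I rule: infinite_finite_induct) (auto intro: smooth_at_const smooth_at_add)

lemma smooth_at_topspace: "smooth_at M p f \<Longrightarrow> p \<in> points"
  unfolding smooth_at_def using openin_subset by blast

lemma smooth_at_scale: "smooth_at M p f \<Longrightarrow> smooth_at M p (\<lambda>q. c * f q)"
  by (rule smooth_at_mult[OF smooth_at_const[OF smooth_at_topspace]])

lemma smooth_at_cong:
  assumes "open_in U" "p \<in> U" "\<And>q. q \<in> U \<Longrightarrow> f q = h q" "smooth_at M p f"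
  shows "smooth_at M p h"
proof -
  obtain W where W: "open_in W" "p \<in> W" "smooth W f"
    using assms(4) unfolding smooth_at_def by blast
  then have "open_in (W \<inter> U)" "smooth (W \<inter> U) f"
    using assms(1) smooth_fun_subset by blast+
  then have "smooth (W \<inter> U) h"
    using smooth_fun_cong[of "W \<inter> U" f h] assms(3) by simp
  then show ?thesis
    using smooth_atI[OF \<open>open_in (W \<inter> U)\<close>] W(2) assms(2) by simp
qed

lemma tangent_add:
  assumes "v \<in> TM p" "smooth_at M p f" "smooth_at M p h"
  shows "v (\<lambda>q. f q + h q) = v f + v h"
proof -
  have "v (\<lambda>q. 1 * f q + 1 * h q) = 1 * v f + 1 * v h"
    using assms unfolding tangent_space_def by blast
  then show ?thesis by simp
qed

lemma tangent_scale:
  assumes "v \<in> TM p" "smooth_at M p f"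
  shows "v (\<lambda>q. c * f q) = c * v f"
proof -
  have "v (\<lambda>q. c * f q + 0 * f q) = c * v f + 0 * v f"
    using assms unfolding tangent_space_def by blast
  then show ?thesis by simp
qed

lemma tangent_mult:
  "v \<in> TM p \<Longrightarrow> smooth_at M p f \<Longrightarrow> smooth_at M p h \<Longrightarrow>
    v (\<lambda>q. f q * h q) = f p * v h + h p * v f"
  unfolding tangent_space_def by blast

lemma tangent_nonsmooth: "v \<in> TM p \<Longrightarrow> \<not> smooth_at M p f \<Longrightarrow> v f = 0"
  unfolding tangent_space_def by blast

lemma tangent_const:
  assumes "v \<in> TM p" "p \<in> points"
  shows "v (\<lambda>q. c) = 0"
proof -
  have "v (\<lambda>q. 1 * 1) = 1 * v (\<lambda>q. 1) + 1 * v (\<lambda>q. 1)"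
    using tangent_mult[OF assms(1) smooth_at_const smooth_at_const, of 1 1] assms(2) by simp
  then have "v (\<lambda>q. 1) = 0" by simp
  then show ?thesis
    using tangent_scale[OF assms(1) smooth_at_const[OF assms(2)], of c 1] by simp
qed

text \<open>
  Derivations are local: multiplying two functions that agree near \<open>p\<close> by the indicator function of a
  neighbourhood, which is smooth at \<open>p\<close>, makes them equal.
\<close>

lemma tangent_cong:
  assumes "v \<in> TM p" "open_in U" "p \<in> U" "\<And>q. q \<in> U \<Longrightarrow> f q = h q"
  shows "v f = v h"
proof (cases "smooth_at M p f")
  case True
  have h: "smooth_at M p h" by (rule smooth_at_cong[OF assms(2-4) True])
  define \<eta> :: "'p \<Rightarrow> real" where "\<eta> q = (if q \<in> U then 1 else 0)" for q
  have p: "p \<in> points" using True smooth_at_topspace by blast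
  have \<eta>: "smooth_at M p \<eta>"
    by (rule smooth_at_cong[OF assms(2,3) _ smooth_at_const[OF p, of 1]]) (simp add: \<eta>_def)
  have "(\<lambda>q. \<eta> q * f q) = (\<lambda>q. \<eta> q * h q)" using assms(4) by (auto simp: \<eta>_def)
  then have "\<eta> p * v f + f p * v \<eta> = \<eta> p * v h + h p * v \<eta>"
    using tangent_mult[OF assms(1) \<eta> True] tangent_mult[OF assms(1) \<eta> h] by metis
  then show ?thesis using assms(3,4) by (simp add: \<eta>_def)
next
  case False
  have "\<not> smooth_at M p h" using False smooth_at_cong[OF assms(2,3), of h f] assms(4) by auto
  with False show ?thesis using assms(1) by (simp add: tangent_nonsmooth)
qed

lemma tangent_sum:
  assumes "v \<in> TM p" "p \<in> points" "\<And>i. i \<in> I \<Longrightarrow> smooth_at M p (f i)"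
  shows "v (\<lambda>q. \<Sum>i\<in>I. f i q) = (\<Sum>i\<in>I. v (f i))"
  using assms(3)
  by (induction I rule: infinite_finite_induct)
     (auto simp: tangent_const[OF assms(1,2)] tangent_add[OF assms(1)] smooth_at_sum[OF assms(2)])

lemma tangent_subspace:
  assumes "p \<in> points"
  shows "tvs.subspace (TM p)"
  unfolding tvs.subspace_def tangent_space_def
  by (auto simp: algebra_simps)

lemma tangent_zero_mem: "p \<in> points \<Longrightarrow> 0 \<in> TM p"
  by (rule tvs.subspace_0[OF tangent_subspace])

lemma tangent_add_mem: "p \<in> points \<Longrightarrow> u \<in> TM p \<Longrightarrow>
    v \<in> TM p \<Longrightarrow> u + v \<in> TM p"
  by (rule tvs.subspace_add[OF tangent_subspace])

lemma tangent_scale_mem: "p \<in> points \<Longrightarrow> u \<in> TM p \<Longrightarrow>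
    tscale c u \<in> TM p"
  by (rule tvs.subspace_scale[OF tangent_subspace])

lemma tangent_diff_mem: "p \<in> points \<Longrightarrow> u \<in> TM p \<Longrightarrow>
    v \<in> TM p \<Longrightarrow> u - v \<in> TM p"
  by (rule tvs.subspace_diff[OF tangent_subspace])

lemma tangent_uminus_mem: "p \<in> points \<Longrightarrow> u \<in> TM p \<Longrightarrow>
    - u \<in> TM p"
  by (rule tvs.subspace_neg[OF tangent_subspace])

lemma tangent_sum_mem: "p \<in> points \<Longrightarrow>
    (\<And>i. i \<in> I \<Longrightarrow> w i \<in> TM p) \<Longrightarrow> (\<Sum>i\<in>I. w i) \<in> TM p"
  by (rule tvs.subspace_sum[OF tangent_subspace])

text \<open>
  The coordinate vector field \<open>\<partial>/\<partial>x\<^sub>b\<close> of a chart.  It vanishes on functions that are not smooth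
  at the point, as tangent vectors have to.
\<close>

definition coord_field :: "'p set \<Rightarrow> ('p \<Rightarrow> 'e) \<Rightarrow> 'e \<Rightarrow> 'p vfield" where
  "coord_field V \<phi> b = (\<lambda>q f. if smooth_at M q f
     then frechet_derivative (\<lambda>x. f (inv_into V \<phi> x)) (at (\<phi> q)) b else 0)"

lemma smooth_at_chart_derivative:
  assumes V: "(V, \<phi>) \<in> atlas M" "q \<in> V" and f: "smooth_at M q f"
  shows "((\<lambda>x. f (inv_into V \<phi> x)) has_derivative
    frechet_derivative (\<lambda>x. f (inv_into V \<phi> x)) (at (\<phi> q))) (at (\<phi> q))"
proof -
  obtain U where U: "open_in U" "q \<in> U" "smooth U f"
    using f unfolding smooth_at_def by blast
  have "Ck_on (Suc 0) (\<phi> ` (U \<inter> V)) (\<lambda>x. f (inv_into V \<phi> x))"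
    using U(3) V(1) unfolding smooth_fun_iff by blast
  from Ck_on_has_derivative[OF this, of "\<phi> q"] show ?thesis using U V by simp
qed

lemma coord_field_tangent:
  assumes V: "(V, \<phi>) \<in> atlas M" "q \<in> V"
  shows "coord_field V \<phi> b q \<in> TM q"
  unfolding tangent_space_def
proof (intro CollectI conjI allI impI)
  note D = smooth_at_chart_derivative[OF V]
  fix f h :: "'p \<Rightarrow> real" and a c :: real
  assume f: "smooth_at M q f" and h: "smooth_at M q h"
  have 1: "frechet_derivative (\<lambda>x. a * f (inv_into V \<phi> x) + c * h (inv_into V \<phi> x)) (at (\<phi> q)) =
     (\<lambda>v. a * frechet_derivative (\<lambda>x. f (inv_into V \<phi> x)) (at (\<phi> q)) v
        + c * frechet_derivative (\<lambda>x. h (inv_into V \<phi> x)) (at (\<phi> q)) v)"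
    by (rule frechet_derivative_at[symmetric])
       (intro has_derivative_add has_derivative_mult_right D f h)
  show "coord_field V \<phi> b q (\<lambda>q. a * f q + c * h q) = a * coord_field V \<phi> b q f + c * coord_field V \<phi> b q h"
    using f h smooth_at_add[OF smooth_at_scale[OF f, of a] smooth_at_scale[OF h, of c]]
    by (simp add: coord_field_def 1)
  have 2: "frechet_derivative (\<lambda>x. f (inv_into V \<phi> x) * h (inv_into V \<phi> x)) (at (\<phi> q)) =
     (\<lambda>v. f (inv_into V \<phi> (\<phi> q)) * frechet_derivative (\<lambda>x. h (inv_into V \<phi> x)) (at (\<phi> q)) v
        + frechet_derivative (\<lambda>x. f (inv_into V \<phi> x)) (at (\<phi> q)) v * h (inv_into V \<phi> (\<phi> q)))"
    by (rule frechet_derivative_at[symmetric]) (intro has_derivative_mult D f h)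
  show "coord_field V \<phi> b q (\<lambda>q. f q * h q) = f q * coord_field V \<phi> b q h + h q * coord_field V \<phi> b q f"
    using f h smooth_at_mult[OF f h] by (simp add: coord_field_def 2 chart_inv[OF V])
qed (simp add: coord_field_def)

lemma coord_field_vector_field:
  assumes V: "(V, \<phi>) \<in> atlas M"
  shows "vf V (coord_field V \<phi> b)"
  unfolding vector_field_def
proof (intro conjI ballI allI impI)
  show "coord_field V \<phi> b q \<in> TM q" if "q \<in> V" for q
    by (rule coord_field_tangent[OF V that])
  fix W f assume W: "open_in W" "W \<subseteq> V" and f: "smooth W f"
  let ?h = "\<lambda>q. frechet_derivative (\<lambda>x. f (inv_into V \<phi> x)) (at (\<phi> q)) b"
  have op: "open (\<phi> ` W)"
    using chart_image_open[OF V W(1)] Int_absorb2[OF W(2)] by simp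
  have "smooth W ?h"
  proof (rule smooth_fun_chartI[OF V W], unfold smooth_on_def, intro allI)
    fix k
    have "Ck_on (Suc k) (\<phi> ` W) (\<lambda>x. f (inv_into V \<phi> x))"
      using smooth_fun_chartD[OF f V W(2)] unfolding smooth_on_def by blast
    from Ck_on_directional[OF this, of b]
    show "Ck_on k (\<phi> ` W) (\<lambda>x. ?h (inv_into V \<phi> x))"
      by (subst Ck_on_cong[OF op, of _ "\<lambda>x. frechet_derivative (\<lambda>x. f (inv_into V \<phi> x)) (at x) b"])
         (use W in \<open>auto simp: chart_inv[OF V]\<close>)
  qed
  then show "smooth W (\<lambda>q. coord_field V \<phi> b q f)"
    by (subst smooth_fun_cong[OF W(1), of _ ?h]) (use smooth_atI[OF W(1) _ f] in \<open>auto simp: coord_field_def\<close>)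
qed

lemma coord_field_coord:
  assumes V: "(V, \<phi>) \<in> atlas M" "p \<in> V" and b: "b \<in> Basis" "c \<in> Basis"
  shows "coord_field V \<phi> b p (\<lambda>q. \<phi> q \<bullet> c) = (if b = c then 1 else 0)"
proof -
  have "((\<lambda>x. \<phi> (inv_into V \<phi> x) \<bullet> c) has_derivative (\<lambda>v. v \<bullet> c)) (at (\<phi> p))"
    by (rule has_derivative_transform_within_open[OF
          bounded_linear.has_derivative[OF bounded_linear_inner_left has_derivative_ident] chart_open[OF V(1)]])
       (use V in \<open>auto simp: chart_inv[OF V(1)]\<close>)
  then have "frechet_derivative (\<lambda>x. \<phi> (inv_into V \<phi> x) \<bullet> c) (at (\<phi> p)) = (\<lambda>v. v \<bullet> c)"
    by (rule frechet_derivative_at[symmetric])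
  then show ?thesis
    using smooth_atI[OF chart_openin[OF V(1)] V(2) smooth_fun_chart_coord[OF V(1), of c]] b
    by (simp add: coord_field_def inner_Basis)
qed

text \<open>
  By Hadamard's lemma \<open>f = f p + \<Sum> (x\<^sub>b - x\<^sub>b(p)) h\<^sub>b\<close> near \<open>p\<close>, with \<open>h\<^sub>b\<close> smooth and
  \<open>h\<^sub>b(p)\<close> the partial derivative of \<open>f\<close>; a derivation kills constants and, by the Leibniz rule, sees only
  \<open>h\<^sub>b(p)\<close> in each product.
\<close>

lemma tangent_coord_expansion:
  assumes V: "(V, \<phi>) \<in> atlas M" "p \<in> V" and v: "v \<in> TM p"
  shows "v = (\<Sum>b\<in>Basis. tscale (v (\<lambda>q. \<phi> q \<bullet> b)) (coord_field V \<phi> b p))"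
proof (rule ext)
  fix f
  have p: "p \<in> points" using V chart_subset by blast
  show "v f = (\<Sum>b\<in>Basis. tscale (v (\<lambda>q. \<phi> q \<bullet> b)) (coord_field V \<phi> b p)) f"
  proof (cases "smooth_at M p f")
    case False
    then show ?thesis using v by (simp add: sum_fun_apply coord_field_def tangent_nonsmooth)
  next
    case True
    then obtain U where U: "open_in U" "p \<in> U" "smooth U f"
      unfolding smooth_at_def by blast
    let ?a = "\<phi> p"
    have "open (\<phi> ` (U \<inter> V))" by (rule chart_image_open[OF V(1) U(1)])
    then obtain r where r: "r > 0" "ball ?a r \<subseteq> \<phi> ` (U \<inter> V)"
      using U(2) V(2) open_contains_ball by blast
    let ?B = "ball ?a r"
    have aB: "?a \<in> ?B" using r(1) by simp
    have sm: "smooth_on ?B (\<lambda>x. f (inv_into V \<phi> x))"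
      using U(3) V(1) Ck_on_subset[OF _ r(2)] unfolding smooth_fun_iff smooth_on_def by blast
    obtain h where h: "\<And>b. smooth_on ?B (h b)"
        "\<And>b. h b ?a = frechet_derivative (\<lambda>x. f (inv_into V \<phi> x)) (at ?a) b"
        "\<And>x. x \<in> ?B \<Longrightarrow> f (inv_into V \<phi> x) = f (inv_into V \<phi> ?a) + (\<Sum>b\<in>Basis. ((x - ?a) \<bullet> b) * h b x)"
      by (rule smooth_on_Hadamard[OF open_ball convex_ball aB sm]) (rule that)
    define W where "W = {q \<in> V. \<phi> q \<in> ?B}"
    have W: "open_in W" "p \<in> W" "W \<subseteq> V"
      unfolding W_def using V r(1) chart_preimage_openin[OF V(1) open_ball[of ?a r]] by auto
    have \<phi>W: "\<phi> ` W = ?B" using r(2) by (auto simp: W_def)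
    have \<phi>inv: "\<phi> (inv_into V \<phi> x) = x" if "x \<in> ?B" for x
      using that W(3) unfolding \<phi>W[symmetric] by (auto simp: chart_inv[OF V(1)])
    have hs: "smooth_at M p (\<lambda>q. h b (\<phi> q))" for b
    proof (rule smooth_atI[OF W(1,2) smooth_fun_chartI[OF V(1) W(1,3)]], unfold \<phi>W smooth_on_def, intro allI)
      fix k
      have "Ck_on k ?B (h b)" using h(1) by (simp add: smooth_on_def)
      then show "Ck_on k ?B (\<lambda>x. h b (\<phi> (inv_into V \<phi> x)))"
        by (subst Ck_on_cong[OF open_ball, of _ _ _ "h b"]) (simp_all only: \<phi>inv)
    qed
    have cs: "smooth_at M p (\<lambda>q. \<phi> q \<bullet> b)" for b
      by (rule smooth_atI[OF chart_openin[OF V(1)] V(2) smooth_fun_chart_coord[OF V(1)]])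
    have cs': "smooth_at M p (\<lambda>q. \<phi> q \<bullet> b + - (?a \<bullet> b))" for b
      by (intro smooth_at_add cs smooth_at_const p)
    have "v f = v (\<lambda>q. f p + (\<Sum>b\<in>Basis. (\<phi> q \<bullet> b + - (?a \<bullet> b)) * h b (\<phi> q)))"
    proof (rule tangent_cong[OF v W(1,2)])
      fix q assume "q \<in> W"
      then have "q \<in> V" "\<phi> q \<in> ?B" by (auto simp: W_def)
      with h(3)[of "\<phi> q"] show "f q = f p + (\<Sum>b\<in>Basis. (\<phi> q \<bullet> b + - (?a \<bullet> b)) * h b (\<phi> q))"
        by (simp add: chart_inv[OF V(1)] V(2) inner_diff_left)
    qed
    also have "\<dots> = (\<Sum>b\<in>Basis. v (\<lambda>q. (\<phi> q \<bullet> b + - (?a \<bullet> b)) * h b (\<phi> q)))"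
    proof -
      have m: "smooth_at M p (\<lambda>q. (\<phi> q \<bullet> b + - (?a \<bullet> b)) * h b (\<phi> q))" for b
        by (rule smooth_at_mult[OF cs' hs])
      show ?thesis
        by (subst tangent_add[OF v smooth_at_const[OF p] smooth_at_sum[OF p m]])
           (simp only: tangent_const[OF v p] tangent_sum[OF v p m] add_0)
    qed
    also have "\<dots> = (\<Sum>b\<in>Basis. v (\<lambda>q. \<phi> q \<bullet> b) * h b ?a)"
      by (intro sum.cong refl)
         (simp del: add_uminus_conv_diff add: tangent_mult[OF v cs' hs] tangent_add[OF v cs smooth_at_const[OF p]] tangent_const[OF v p])
    also have "\<dots> = (\<Sum>b\<in>Basis. tscale (v (\<lambda>q. \<phi> q \<bullet> b)) (coord_field V \<phi> b p)) f"
      using True by (simp add: sum_fun_apply coord_field_def h(2))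
    finally show ?thesis .
  qed
qed

text \<open>
  Evaluating a linear relation on the coordinate functions isolates its coefficients.
\<close>

lemma coord_field_independent:
  assumes V: "(V, \<phi>) \<in> atlas M" "p \<in> V"
  shows "tvs.independent ((\<lambda>b. coord_field V \<phi> b p) ` Basis)"
    and "card ((\<lambda>b. coord_field V \<phi> b p) ` Basis) = DIM('e)"
proof -
  have inj: "inj_on (\<lambda>b. coord_field V \<phi> b p) Basis"
  proof (rule inj_onI)
    fix b c :: 'e assume bc: "b \<in> Basis" "c \<in> Basis" "coord_field V \<phi> b p = coord_field V \<phi> c p"
    have "coord_field V \<phi> c p (\<lambda>q. \<phi> q \<bullet> b) = 1"
      using coord_field_coord[OF V bc(1,1)] bc(3) by simp
    then show "b = c" using coord_field_coord[OF V bc(2,1)] by (auto split: if_splits)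
  qed
  show "tvs.independent ((\<lambda>b. coord_field V \<phi> b p) ` Basis)"
  proof
    assume "tvs.dependent ((\<lambda>b. coord_field V \<phi> b p) ` Basis)"
    then obtain k c where s: "(\<Sum>x\<in>(\<lambda>b. coord_field V \<phi> b p) ` Basis. tscale (k x) x) = 0"
      and c: "c \<in> Basis" "k (coord_field V \<phi> c p) \<noteq> 0"
      by (subst (asm) tvs.dependent_finite) auto
    let ?k = "\<lambda>b. k (coord_field V \<phi> b p)"
    have "(\<Sum>b\<in>Basis. tscale (?k b) (coord_field V \<phi> b p)) = 0"
      using s by (simp only: sum.reindex[OF inj] o_def)
    then have "(\<Sum>b\<in>Basis. tscale (?k b) (coord_field V \<phi> b p)) (\<lambda>q. \<phi> q \<bullet> c) = 0"
      by (simp only: zero_fun_apply)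
    then have "(\<Sum>b\<in>Basis. ?k b * coord_field V \<phi> b p (\<lambda>q. \<phi> q \<bullet> c)) = 0"
      by (simp only: sum_fun_apply tscale_apply)
    moreover have "?k b * coord_field V \<phi> b p (\<lambda>q. \<phi> q \<bullet> c) = (if b = c then ?k b else 0)"
      if "b \<in> Basis" for b
      using coord_field_coord[OF V that c(1)] by simp
    ultimately show False using c by simp
  qed
  show "card ((\<lambda>b. coord_field V \<phi> b p) ` Basis) = DIM('e)"
    using card_image[OF inj] by simp
qed

lemma tangent_independent_card_le:
  assumes "p \<in> points" "tvs.independent S" "S \<subseteq> TM p"
  shows "finite S \<and> card S \<le> DIM('e)"
proof -
  obtain V \<phi> where V: "(V, \<phi>) \<in> atlas M" "p \<in> V" using chart_exists assms(1) by blast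
  have "v \<in> tvs.span ((\<lambda>b. coord_field V \<phi> b p) ` Basis)" if "v \<in> TM p" for v
    by (subst tangent_coord_expansion[OF V that])
       (intro tvs.span_sum tvs.span_scale tvs.span_base imageI)
  then have "finite S \<and> card S \<le> card ((\<lambda>b. coord_field V \<phi> b p) ` Basis)"
    using assms by (intro tvs.independent_span_bound) auto
  then show ?thesis by (simp add: coord_field_independent[OF V])
qed

lemma coord_field_not_spanned:
  assumes V: "(V, \<phi>) \<in> atlas M" "p \<in> V" and S: "finite S" "card S < DIM('e)"
  obtains b where "b \<in> Basis" "coord_field V \<phi> b p \<notin> tvs.span S"
proof -
  have "\<not> (\<lambda>b. coord_field V \<phi> b p) ` Basis \<subseteq> tvs.span S"
    using tvs.independent_span_bound[OF S(1) coord_field_independent(1)[OF V]] S(2)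
      coord_field_independent(2)[OF V] by force
  then show thesis using that by blast
qed

end

section \<open>Vector fields and the Lie bracket\<close>

(* Frame indices start at 1; without this the simplifier turns {1..n} into {Suc 0..n}. *)
declare One_nat_def [simp del]

context smooth_mfd
begin

lemma vf_tangent: "vf U X \<Longrightarrow> p \<in> U \<Longrightarrow> X p \<in> TM p"
  by (simp add: vector_field_def)

lemma vf_smooth: "vf U X \<Longrightarrow> open_in W \<Longrightarrow> W \<subseteq> U \<Longrightarrow> smooth W f \<Longrightarrow>
    smooth W (\<lambda>p. X p f)"
  by (simp add: vector_field_def)

lemma vf_subset: "vf U X \<Longrightarrow> W \<subseteq> U \<Longrightarrow> vf W X"
  unfolding vector_field_def by (meson subset_iff subset_trans)

lemma open_in_topspace: "open_in U \<Longrightarrow> p \<in> U \<Longrightarrow> p \<in> points"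
  using openin_subset by blast

lemma vf_cong:
  assumes "open_in U" "\<And>q. q \<in> U \<Longrightarrow> X q = Y q" "vf U X"
  shows "vf U Y"
  unfolding vector_field_def
proof (intro conjI ballI allI impI)
  show "Y q \<in> TM q" if "q \<in> U" for q
    using vf_tangent[OF assms(3) that] assms(2)[OF that] by simp
  show "smooth W (\<lambda>p. Y p f)" if "open_in W" "W \<subseteq> U" "smooth W f" for W f
  proof -
    have "X q f = Y q f" if "q \<in> W" for q using assms(2) \<open>W \<subseteq> U\<close> that by auto
    from smooth_fun_cong[OF that(1), of "\<lambda>p. X p f", OF this] vf_smooth[OF assms(3) that]
    show ?thesis by blast
  qed
qed

lemma vf_add:
  assumes "open_in U" "vf U X" "vf U Y"
  shows "vf U (X + Y)"
  unfolding vector_field_def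
proof (intro conjI ballI allI impI)
  show "(X + Y) p \<in> TM p" if "p \<in> U" for p
    using tangent_add_mem[OF open_in_topspace[OF assms(1) that] vf_tangent vf_tangent] assms(2,3) that
    by simp
  show "smooth W (\<lambda>p. (X + Y) p f)" if "open_in W" "W \<subseteq> U" "smooth W f" for W f
    using smooth_fun_add[OF that(1) vf_smooth[OF assms(2) that] vf_smooth[OF assms(3) that]] by simp
qed

lemma vf_fscale:
  assumes "open_in U" "smooth U f" "vf U X"
  shows "vf U (fscale f X)"
  unfolding vector_field_def fscale_def
proof (intro conjI ballI allI impI)
  show "tscale (f p) (X p) \<in> TM p" if "p \<in> U" for p
    using tangent_scale_mem[OF open_in_topspace[OF assms(1) that] vf_tangent[OF assms(3) that]] .
  show "smooth W (\<lambda>p. tscale (f p) (X p) h)" if "open_in W" "W \<subseteq> U" "smooth W h" for W h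
    using smooth_fun_mult[OF that(1) smooth_fun_subset[OF assms(2) that(2)] vf_smooth[OF assms(3) that]]
    by simp
qed

lemma vf_uminus:
  assumes "open_in U" "vf U X"
  shows "vf U (- X)"
proof -
  have "fscale (\<lambda>q. - 1) X = - X" by (simp add: fscale_def fun_eq_iff)
  then show ?thesis using vf_fscale[OF assms(1) smooth_fun_const[OF assms(1)] assms(2), of "-1"] by simp
qed

lemma vf_diff:
  assumes "open_in U" "vf U X" "vf U Y"
  shows "vf U (X - Y)"
  using vf_add[OF assms(1,2) vf_uminus[OF assms(1,3)]] by simp

lemma vf_zero:
  assumes "open_in U" shows "vf U 0"
  unfolding vector_field_def
  using tangent_zero_mem[OF open_in_topspace[OF assms]] by (auto intro: smooth_fun_const)

lemma vf_sum:
  assumes "open_in U" "\<And>i. i \<in> I \<Longrightarrow> vf U (F i)"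
  shows "vf U (\<Sum>i\<in>I. F i)"
  using assms(2)
  by (induction I rule: infinite_finite_induct) (auto simp: vf_zero vf_add assms(1))

lemma lie_bracket_apply:
  "smooth_at M p f \<Longrightarrow> lie X Y p f = X p (\<lambda>q. Y q f) - Y p (\<lambda>q. X q f)"
  by (simp add: lie_bracket_def)

lemma smooth_at_vf:
  assumes "open_in U" "vf U X" "p \<in> U" "smooth_at M p f"
  shows "smooth_at M p (\<lambda>q. X q f)"
proof -
  obtain W where W: "open_in W" "p \<in> W" "smooth W f"
    using assms(4) unfolding smooth_at_def by blast
  have o: "open_in (W \<inter> U)" using W(1) assms(1) by blast
  have "smooth (W \<inter> U) (\<lambda>q. X q f)"
    by (rule vf_smooth[OF assms(2) o _ smooth_fun_subset[OF W(3)]]) auto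
  then show ?thesis using smooth_atI[OF o] W(2) assms(3) by blast
qed

text \<open>
  With \<open>u = X p\<close>, this and the next lemma expand second derivatives, from which the bracket inherits
  linearity and the Leibniz rule: the mixed first-order terms are symmetric in \<open>X\<close> and \<open>Y\<close>.
\<close>

lemma vf_vf_linear:
  assumes U: "open_in U" "p \<in> U" and u: "u \<in> TM p" and Y: "vf U Y"
    and f: "smooth_at M p f" and h: "smooth_at M p h"
  shows "u (\<lambda>q. Y q (\<lambda>r. a * f r + b * h r)) = a * u (\<lambda>q. Y q f) + b * u (\<lambda>q. Y q h)"
proof -
  obtain W where W: "open_in W" "p \<in> W" "smooth W f" "smooth W h"
    using f h by (rule smooth_at_obtain2)
  note Yf = smooth_at_vf[OF U(1) Y U(2) f] and Yh = smooth_at_vf[OF U(1) Y U(2) h]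
  have "u (\<lambda>q. Y q (\<lambda>r. a * f r + b * h r)) = u (\<lambda>q. a * Y q f + b * Y q h)"
  proof (rule tangent_cong[OF u openin_Int[OF W(1) U(1)]])
    fix q assume q: "q \<in> W \<inter> U"
    have "smooth_at M q f" "smooth_at M q h" using smooth_atI[OF W(1)] W(3,4) q by blast+
    moreover have Yq: "Y q \<in> TM q" using vf_tangent[OF Y] q by blast
    ultimately show "Y q (\<lambda>r. a * f r + b * h r) = a * Y q f + b * Y q h"
      by (simp add: tangent_add[OF Yq] tangent_scale[OF Yq] smooth_at_scale)
  qed (use W U in auto)
  also have "\<dots> = a * u (\<lambda>q. Y q f) + b * u (\<lambda>q. Y q h)"
    by (simp add: tangent_add[OF u] tangent_scale[OF u] smooth_at_scale Yf Yh)
  finally show ?thesis .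
qed

lemma vf_vf_mult:
  assumes U: "open_in U" "p \<in> U" and u: "u \<in> TM p" and Y: "vf U Y"
    and f: "smooth_at M p f" and h: "smooth_at M p h"
  shows "u (\<lambda>q. Y q (\<lambda>r. f r * h r)) =
    f p * u (\<lambda>q. Y q h) + Y p h * u f + (h p * u (\<lambda>q. Y q f) + Y p f * u h)"
proof -
  obtain W where W: "open_in W" "p \<in> W" "smooth W f" "smooth W h"
    using f h by (rule smooth_at_obtain2)
  note Yf = smooth_at_vf[OF U(1) Y U(2) f] and Yh = smooth_at_vf[OF U(1) Y U(2) h]
  have "u (\<lambda>q. Y q (\<lambda>r. f r * h r)) = u (\<lambda>q. f q * Y q h + h q * Y q f)"
  proof (rule tangent_cong[OF u openin_Int[OF W(1) U(1)]])
    fix q assume q: "q \<in> W \<inter> U"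
    have "smooth_at M q f" "smooth_at M q h" using smooth_atI[OF W(1)] W(3,4) q by blast+
    moreover have Yq: "Y q \<in> TM q" using vf_tangent[OF Y] q by blast
    ultimately show "Y q (\<lambda>r. f r * h r) = f q * Y q h + h q * Y q f"
      by (simp add: tangent_mult[OF Yq])
  qed (use W U in auto)
  then show ?thesis
    by (simp add: tangent_add[OF u] tangent_mult[OF u] smooth_at_mult Yf Yh f h)
qed

lemma vf_lie_bracket:
  assumes U: "open_in U" and X: "vf U X" and Y: "vf U Y"
  shows "vf U (lie X Y)"
  unfolding vector_field_def
proof (intro conjI ballI allI impI)
  fix p assume p: "p \<in> U"
  note Xp = vf_tangent[OF X p] and Yp = vf_tangent[OF Y p]
  show "lie X Y p \<in> TM p"
    unfolding tangent_space_def
  proof (intro CollectI conjI allI impI)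
    fix f h :: "'p \<Rightarrow> real" and a b :: real assume f: "smooth_at M p f" and h: "smooth_at M p h"
    show "lie X Y p (\<lambda>q. a * f q + b * h q) = a * lie X Y p f + b * lie X Y p h"
      using smooth_at_add[OF smooth_at_scale[OF f, of a] smooth_at_scale[OF h, of b]]
      by (simp add: lie_bracket_apply f h vf_vf_linear[OF U p Xp Y f h] vf_vf_linear[OF U p Yp X f h])
         (simp add: algebra_simps)
    show "lie X Y p (\<lambda>q. f q * h q) = f p * lie X Y p h + h p * lie X Y p f"
      using smooth_at_mult[OF f h]
      by (simp add: lie_bracket_apply f h vf_vf_mult[OF U p Xp Y f h] vf_vf_mult[OF U p Yp X f h])
         (simp add: algebra_simps)
  qed (simp add: lie_bracket_def)
next
  fix W f assume W: "open_in W" "W \<subseteq> U" and f: "smooth W f"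
  have "smooth W (\<lambda>p. X p (\<lambda>q. Y q f) - Y p (\<lambda>q. X q f))"
    by (intro smooth_fun_diff vf_smooth[OF X] vf_smooth[OF Y] W f)
  then show "smooth W (\<lambda>p. lie X Y p f)"
    by (subst smooth_fun_cong[OF W(1), of _ "\<lambda>p. X p (\<lambda>q. Y q f) - Y p (\<lambda>q. X q f)"])
       (use smooth_atI[OF W(1) _ f] in \<open>auto simp: lie_bracket_apply\<close>)
qed

lemma vf_smooth_self: "open_in U \<Longrightarrow> vf U X \<Longrightarrow> smooth U f \<Longrightarrow>
    smooth U (\<lambda>p. X p f)"
  by (rule vf_smooth) auto

end

section \<open>Riemannian metrics and the existence of Hermitian frames\<close>

locale riem_mfd = smooth_mfd M for M :: "('p, 'e::euclidean_space) manifold" +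
  fixes g :: "'p bilin_field"
  assumes metric: "riemannian_metric M g"
begin

abbreviation on_frame :: "'p set \<Rightarrow> (nat \<Rightarrow> 'p vfield) \<Rightarrow> bool" where
  "on_frame \<equiv> orthonormal_frame M g"

lemma g_lin:
  assumes "p \<in> points" "u \<in> TM p" "v \<in> TM p" "w \<in> TM p"
  shows "g p (tscale a u + tscale b v) w = a * g p u w + b * g p v w"
  using metric assms unfolding riemannian_metric_def by blast

lemma g_sym:
  assumes "p \<in> points" "u \<in> TM p" "v \<in> TM p"
  shows "g p u v = g p v u"
  using metric assms unfolding riemannian_metric_def by blast

lemma g_pos:
  assumes "p \<in> points" "u \<in> TM p" "u \<noteq> 0"
  shows "g p u u > 0"
  using metric assms unfolding riemannian_metric_def by blast

lemma g_add:
  assumes "p \<in> points" "u \<in> TM p" "v \<in> TM p" "w \<in> TM p"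
  shows "g p (u + v) w = g p u w + g p v w"
  using g_lin[OF assms, of 1 1] by simp

lemma g_scale:
  assumes "p \<in> points" "u \<in> TM p" "w \<in> TM p"
  shows "g p (tscale a u) w = a * g p u w"
  using g_lin[OF assms(1,2,2,3), of a 0] by simp

lemma g_uminus:
  assumes "p \<in> points" "u \<in> TM p" "w \<in> TM p"
  shows "g p (- u) w = - g p u w"
proof -
  have "- u = tscale (-1) u" by (simp add: fun_eq_iff)
  then show ?thesis using g_scale[OF assms, of "-1"] by simp
qed

lemma g_diff:
  assumes "p \<in> points" "u \<in> TM p" "v \<in> TM p" "w \<in> TM p"
  shows "g p (u - v) w = g p u w - g p v w"
  using g_add[OF assms(1,2) tangent_uminus_mem[OF assms(1,3)] assms(4)] g_uminus[OF assms(1,3,4)] by simp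

lemma g_zero:
  assumes "p \<in> points" "w \<in> TM p"
  shows "g p 0 w = 0"
  using g_uminus[OF assms(1) tangent_zero_mem[OF assms(1)] assms(2)] by simp

lemma g_sum:
  assumes "p \<in> points" "\<And>i. i \<in> I \<Longrightarrow> u i \<in> TM p" "w \<in> TM p"
  shows "g p (\<Sum>i\<in>I. u i) w = (\<Sum>i\<in>I. g p (u i) w)"
  using assms(2)
  by (induction I rule: infinite_finite_induct)
     (auto simp: g_zero g_add assms(1,3) tangent_sum_mem)

lemma smooth_fpair:
  "open_in U \<Longrightarrow> vf U X \<Longrightarrow> vf U Y \<Longrightarrow> smooth U (fpair g X Y)"
  using metric[unfolded riemannian_metric_def, THEN conjunct2] by blast

lemma orthogonal_independent:
  assumes p: "p \<in> points" and S: "finite S" "S \<subseteq> TM p" "0 \<notin> S"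
    and orth: "\<And>u v. u \<in> S \<Longrightarrow> v \<in> S \<Longrightarrow> u \<noteq> v \<Longrightarrow> g p u v = 0"
  shows "tvs.independent S"
proof
  assume "tvs.dependent S"
  then obtain k w where s: "(\<Sum>v\<in>S. tscale (k v) v) = 0" and w: "w \<in> S" "k w \<noteq> 0"
    using tvs.dependent_finite[OF S(1)] by auto
  have wT: "w \<in> TM p" using w S by blast
  have "g p (\<Sum>v\<in>S. tscale (k v) v) w = (\<Sum>v\<in>S. k v * g p v w)"
    using S(2) by (subst g_sum[OF p _ wT]) (auto intro!: sum.cong tangent_scale_mem[OF p] g_scale[OF p _ wT])
  also have "\<dots> = (\<Sum>v\<in>S. if v = w then k w * g p w w else 0)"
    using orth w(1) by (intro sum.cong) auto
  also have "\<dots> = k w * g p w w" using S(1) w(1) by simp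
  finally have "k w * g p w w = 0" using s g_zero[OF p wT] by simp
  then show False using w S(3) g_pos[OF p wT] by auto
qed

text \<open>
  Otherwise the component of \<open>v\<close> orthogonal to all \<open>u i\<close> would be an additional independent vector,
  exceeding the dimension of the tangent space.
\<close>

lemma orthonormal_expansion:
  assumes p: "p \<in> points" and u: "\<And>i. i \<in> {1..DIM('e)} \<Longrightarrow> u i \<in> TM p"
    and orth: "\<And>i j. i \<in> {1..DIM('e)} \<Longrightarrow> j \<in> {1..DIM('e)} \<Longrightarrow> g p (u i) (u j) = (if i = j then 1 else 0)"
    and v: "v \<in> TM p"
  shows "v = (\<Sum>i=1..DIM('e). tscale (g p v (u i)) (u i))"
proof (rule ccontr)
  let ?I = "{1..DIM('e)}"
  let ?s = "\<Sum>i\<in>?I. tscale (g p v (u i)) (u i)"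
  assume ne: "v \<noteq> ?s"
  define w where "w = v - ?s"
  have sT: "?s \<in> TM p" by (intro tangent_sum_mem tangent_scale_mem p u)
  have wT: "w \<in> TM p" unfolding w_def by (intro tangent_diff_mem p v sT)
  have wu: "g p w (u j) = 0" if j: "j \<in> ?I" for j
  proof -
    have "g p ?s (u j) = (\<Sum>i\<in>?I. g p v (u i) * g p (u i) (u j))"
      using u j by (subst g_sum[OF p _ u[OF j]]) (auto intro!: sum.cong tangent_scale_mem[OF p] g_scale[OF p])
    also have "\<dots> = (\<Sum>i\<in>?I. if i = j then g p v (u j) else 0)"
      using orth j by (intro sum.cong) auto
    also have "\<dots> = g p v (u j)" using j by simp
    finally show ?thesis unfolding w_def by (simp add: g_diff[OF p v sT u[OF j]])
  qed
  have w0: "w \<noteq> 0" using ne by (simp add: w_def)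
  have inj: "inj_on u ?I"
    by (rule inj_onI) (metis orth zero_neq_one)
  have nin: "w \<notin> u ` ?I" using wu orth by force
  have "tvs.independent (insert w (u ` ?I))"
  proof (rule orthogonal_independent[OF p])
    show "0 \<notin> insert w (u ` ?I)" using w0 orth g_zero[OF p] u by (metis imageE insertE zero_neq_one)
    fix a b assume "a \<in> insert w (u ` ?I)" "b \<in> insert w (u ` ?I)" "a \<noteq> b"
    then show "g p a b = 0"
      using wu orth g_sym[OF p wT u] by auto
  qed (use wT u in auto)
  then have "card (insert w (u ` ?I)) \<le> DIM('e)"
    using tangent_independent_card_le[OF p] wT u by blast
  then show False using nin by (simp add: card_image[OF inj])
qed

end

locale herm_mfd = riem_mfd M g for M :: "('p, 'e::euclidean_space) manifold" and g +
  fixes J :: "'p endo_field"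
  assumes even_dim: "even DIM('e)" and acs: "almost_complex_structure M J"
    and J_orth: "\<And>p u v. p \<in> points \<Longrightarrow> u \<in> TM p \<Longrightarrow> v \<in> TM p \<Longrightarrow>
        g p (J p u) (J p v) = g p u v"
begin

lemma J_mem: "p \<in> points \<Longrightarrow> u \<in> TM p \<Longrightarrow> J p u \<in> TM p"
  and J_J: "p \<in> points \<Longrightarrow> u \<in> TM p \<Longrightarrow> J p (J p u) = - u"
  using acs unfolding almost_complex_structure_def by blast+

lemma vf_J: "open_in U \<Longrightarrow> vf U X \<Longrightarrow> vf U (fapp J X)"
  using acs[unfolded almost_complex_structure_def, THEN conjunct2] by blast

lemma J_skew:
  assumes "p \<in> points" "u \<in> TM p" "v \<in> TM p"
  shows "g p (J p u) v = - g p u (J p v)"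
proof -
  have "g p (J p u) v = g p (J p (J p u)) (J p v)"
    using J_orth[OF assms(1) J_mem[OF assms(1,2)] assms(3)] by simp
  then show ?thesis by (simp add: J_J[OF assms(1,2)] g_uminus assms J_mem)
qed

text \<open>
  Gram-Schmidt, two fields at a time.  The span of a partial Hermitian frame is \<open>J\<close>-invariant, so if \<open>Y\<close> is a
  unit field orthogonal to it, then \<open>J Y\<close> is orthogonal to it as well; it is orthogonal to \<open>Y\<close> because
  \<open>J\<close> is skew.  To find \<open>Y\<close>, project a coordinate field that is not spanned by the frame at \<open>p\<close>; the
  projection stays nonzero near \<open>p\<close>.
\<close>

lemma partial_hermitian_frame_exists:
  assumes p: "p \<in> points" and "2 * k \<le> DIM('e)"
  shows "\<exists>U e. open_in U \<and> p \<in> U \<and> (\<forall>i\<in>{1..2*k}. vf U (e i)) \<and>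
     (\<forall>q\<in>U. \<forall>i\<in>{1..2*k}. \<forall>j\<in>{1..2*k}. g q (e i q) (e j q) = (if i = j then 1 else 0)) \<and>
     (\<forall>q\<in>U. \<forall>\<alpha>\<in>{1..k}. e (2 * \<alpha>) q = J q (e (2 * \<alpha> - 1) q))"
  using assms(2)
proof (induction k)
  case 0
  show ?case using p by (intro exI[of _ "points"]) auto
next
  case (Suc k)
  let ?I = "{1..2*k}"
  have "2 * k \<le> DIM('e)" using Suc.prems by simp
  from Suc.IH[OF this] obtain U e where U: "open_in U" "p \<in> U"
    and e_all: "\<forall>i\<in>?I. vf U (e i)"
    and on_all: "\<forall>q\<in>U. \<forall>i\<in>?I. \<forall>j\<in>?I. g q (e i q) (e j q) = (if i = j then 1 else 0)"
    and Je_all: "\<forall>q\<in>U. \<forall>\<alpha>\<in>{1..k}. e (2 * \<alpha>) q = J q (e (2 * \<alpha> - 1) q)"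
    by (elim exE conjE)
  have e: "vf U (e i)" if "i \<in> ?I" for i using e_all that by blast
  have on: "g q (e i q) (e j q) = (if i = j then 1 else 0)" if "q \<in> U" "i \<in> ?I" "j \<in> ?I" for q i j
    using on_all that by blast
  have Je: "e (2 * \<alpha>) q = J q (e (2 * \<alpha> - 1) q)" if "q \<in> U" "\<alpha> \<in> {1..k}" for q \<alpha>
    using Je_all that by blast
  obtain V \<phi> where V: "(V, \<phi>) \<in> atlas M" "p \<in> V" using chart_exists p by blast
  have "card ((\<lambda>i. e i p) ` ?I) < DIM('e)"
    using card_image_le[of ?I "\<lambda>i. e i p"] Suc.prems by simp
  then obtain b where b: "coord_field V \<phi> b p \<notin> tvs.span ((\<lambda>i. e i p) ` ?I)"
    using coord_field_not_spanned[OF V, of "(\<lambda>i. e i p) ` ?I"] by blast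
  let ?B = "coord_field V \<phi> b"
  define W where "W = U \<inter> V"
  have W: "open_in W" "p \<in> W" "W \<subseteq> U" "W \<subseteq> V"
    using U V chart_openin[OF V(1)] by (auto simp: W_def)
  have B: "vf W ?B" by (rule vf_subset[OF coord_field_vector_field[OF V(1)] W(4)])
  have eW: "vf W (e i)" if "i \<in> ?I" for i by (rule vf_subset[OF e[OF that] W(3)])
  define X where "X = ?B - (\<Sum>i\<in>?I. fscale (fpair g ?B (e i)) (e i))"
  have X: "vf W X"
    unfolding X_def by (intro vf_diff vf_sum vf_fscale smooth_fpair W B eW)
  have Xq: "X q = ?B q - (\<Sum>i\<in>?I. tscale (g q (?B q) (e i q)) (e i q))" for q
    by (simp add: X_def sum_fun_apply fscale_def fpair_def)
  have Xe: "g q (X q) (e j q) = 0" if q: "q \<in> W" and j: "j \<in> ?I" for q j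
  proof -
    note qt = open_in_topspace[OF W(1) q]
    note T = vf_tangent[OF eW q] vf_tangent[OF B q]
    have "g q (\<Sum>i\<in>?I. tscale (g q (?B q) (e i q)) (e i q)) (e j q) =
        (\<Sum>i\<in>?I. g q (?B q) (e i q) * g q (e i q) (e j q))"
      using T j by (subst g_sum[OF qt]) (auto intro!: sum.cong tangent_scale_mem[OF qt] g_scale[OF qt])
    also have "\<dots> = (\<Sum>i\<in>?I. if i = j then g q (?B q) (e j q) else 0)"
      using on W q j by (intro sum.cong) auto
    also have "\<dots> = g q (?B q) (e j q)" using j by simp
    finally have eq: "g q (\<Sum>i\<in>?I. tscale (g q (?B q) (e i q)) (e i q)) (e j q) = g q (?B q) (e j q)" .
    show ?thesis
    proof -
      have "(\<Sum>i\<in>?I. tscale (g q (?B q) (e i q)) (e i q)) \<in> TM q"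
        by (intro tangent_sum_mem tangent_scale_mem qt T)
      from g_diff[OF qt T(2) this T(1)[OF j]] show ?thesis
        unfolding Xq by (simp only: eq diff_self)
    qed
  qed
  have "X p \<noteq> 0"
  proof
    assume "X p = 0"
    then have "?B p = (\<Sum>i\<in>?I. tscale (g p (?B p) (e i p)) (e i p))" by (simp add: Xq)
    moreover have "\<dots> \<in> tvs.span ((\<lambda>i. e i p) ` ?I)"
      by (intro tvs.span_sum tvs.span_scale tvs.span_base imageI)
    ultimately show False using b by simp
  qed
  let ?N = "fpair g X X"
  define U' where "U' = {q \<in> W. ?N q > 0}"
  have U': "open_in U'" "U' \<subseteq> W"
    unfolding U'_def using smooth_fun_positive_openin[OF W(1) smooth_fpair[OF W(1) X X]] by auto
  have pU': "p \<in> U'"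
    using g_pos[OF p vf_tangent[OF X W(2)] \<open>X p \<noteq> 0\<close>] W(2) by (simp add: U'_def fpair_def)
  define Y where "Y = fscale (\<lambda>q. ?N q powr (-1/2)) X"
  have Y: "vf U' Y"
    unfolding Y_def
    by (intro vf_fscale smooth_fun_powr U' smooth_fpair vf_subset[OF X]) (auto simp: U'_def)
  have JY: "vf U' (fapp J Y)" by (rule vf_J[OF U'(1) Y])
  have Yq: "Y q = tscale (?N q powr (-1/2)) (X q)" for q by (simp add: Y_def fscale_def)
  have eU': "vf U' (e i)" if "i \<in> ?I" for i by (rule vf_subset[OF eW[OF that] U'(2)])
  define e' where "e' = e(2 * k + 1 := Y, 2 * k + 2 := fapp J Y)"
  have facts: "g q (Y q) (Y q) = 1" "g q (fapp J Y q) (fapp J Y q) = 1" "g q (Y q) (fapp J Y q) = 0"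
     "g q (fapp J Y q) (Y q) = 0"
     "\<And>j. j \<in> ?I \<Longrightarrow> g q (Y q) (e j q) = 0 \<and> g q (e j q) (Y q) = 0 \<and>
        g q (fapp J Y q) (e j q) = 0 \<and> g q (e j q) (fapp J Y q) = 0"
    if q: "q \<in> U'" for q
  proof -
    note qt = open_in_topspace[OF U'(1) q]
    have XT: "X q \<in> TM q" using vf_tangent[OF X] q U'(2) by blast
    note YT = vf_tangent[OF Y q] and JYT = vf_tangent[OF JY q]
    have N: "?N q > 0" using q by (simp add: U'_def)
    have "g q (Y q) (Y q) = ?N q powr (-1/2) * (?N q powr (-1/2) * ?N q)"
    proof -
      note sX = tangent_scale_mem[OF qt XT]
      have "g q (Y q) (Y q) = ?N q powr (-1/2) * g q (X q) (Y q)"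
        unfolding Yq by (rule g_scale[OF qt XT sX])
      also have "g q (X q) (Y q) = g q (Y q) (X q)"
        unfolding Yq by (rule g_sym[OF qt XT sX])
      also have "\<dots> = ?N q powr (-1/2) * ?N q"
        unfolding Yq g_scale[OF qt XT XT] by (simp only: fpair_def)
      finally show ?thesis .
    qed
    also have "\<dots> = ?N q powr (-1/2) * ?N q powr (-1/2) * ?N q powr 1" using N by simp
    also have "\<dots> = 1" using N unfolding powr_add[symmetric] by simp
    finally show 1: "g q (Y q) (Y q) = 1" .
    show "g q (fapp J Y q) (fapp J Y q) = 1" using 1 J_orth[OF qt YT YT] by (simp add: fapp_def)
    have 2: "g q (J q (Y q)) (Y q) = - g q (J q (Y q)) (Y q)"
      using J_skew[OF qt YT YT] g_sym[OF qt YT J_mem[OF qt YT]] by simp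
    then show "g q (fapp J Y q) (Y q) = 0" by (simp add: fapp_def)
    with g_sym[OF qt YT JYT] show "g q (Y q) (fapp J Y q) = 0" by simp
    fix j assume j: "j \<in> ?I"
    note eT = vf_tangent[OF eU' q]
    have Ye: "g q (Y q) (e i q) = 0" if i: "i \<in> ?I" for i
      unfolding Yq using Xe[OF _ i] q U'(2) by (simp add: g_scale[OF qt XT eT[OF i]] subset_iff)
    have "g q (fapp J Y q) (e j q) = 0"
    proof -
      consider \<alpha> where "\<alpha> \<in> {1..k}" "j = 2 * \<alpha>" | \<alpha> where "\<alpha> \<in> {1..k}" "j = 2 * \<alpha> - 1"
      proof -
        assume a: "\<And>\<alpha>. \<alpha> \<in> {1..k} \<Longrightarrow> j = 2 * \<alpha> \<Longrightarrow> thesis" "\<And>\<alpha>. \<alpha> \<in> {1..k} \<Longrightarrow> j = 2 * \<alpha> - 1 \<Longrightarrow> thesis"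
        show thesis
        proof (cases "even j")
          case True
          with j show ?thesis by (intro a(1)[of "j div 2"]) auto
        next
          case False
          then obtain c where "j = 2 * c + 1" by (elim oddE)
          with j show ?thesis by (intro a(2)[of "c + 1"]) auto
        qed
      qed
      then show ?thesis
      proof cases
        case (1 \<alpha>)
        have i: "2 * \<alpha> - 1 \<in> ?I" using 1 by auto
        have "e j q = J q (e (2 * \<alpha> - 1) q)" using Je[of q \<alpha>] 1 q U'(2) W(3) by auto
        then show ?thesis using J_orth[OF qt YT eT[OF i]] Ye[OF i] by (simp add: fapp_def)
      next
        case (2 \<alpha>)
        have i: "2 * \<alpha> \<in> ?I" using 2 by auto
        have "e (2 * \<alpha>) q = J q (e j q)" using Je[of q \<alpha>] 2 q U'(2) W(3) by auto
        then show ?thesis using J_skew[OF qt YT eT[OF j]] Ye[OF i] by (simp add: fapp_def)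
      qed
    qed
    then show "g q (Y q) (e j q) = 0 \<and> g q (e j q) (Y q) = 0 \<and>
        g q (fapp J Y q) (e j q) = 0 \<and> g q (e j q) (fapp J Y q) = 0"
      using Ye[OF j] g_sym[OF qt eT[OF j] YT] g_sym[OF qt eT[OF j] JYT] by simp
  qed
  have I: "{1..2 * Suc k} = insert (2*k+1) (insert (2*k+2) ?I)" by auto
  have e'I: "e' i = e i" if "i \<in> ?I" for i using that by (auto simp: e'_def)
  have e'1: "e' (2*k+1) = Y" "e' (2*k+2) = fapp J Y" by (auto simp: e'_def)
  show ?case
  proof (intro exI[of _ U'] exI[of _ e'] conjI ballI)
    show "open_in U'" "p \<in> U'" by fact+
    show "vf U' (e' i)" if "i \<in> {1..2 * Suc k}" for i
      using that unfolding I by (auto simp: e'1[simplified] e'I Y JY eU')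
    show "g q (e' i q) (e' j q) = (if i = j then 1 else 0)"
      if "q \<in> U'" "i \<in> {1..2 * Suc k}" "j \<in> {1..2 * Suc k}" for q i j
    proof -
      have qU: "q \<in> U" using that(1) U'(2) W(3) by blast
      show ?thesis
        using that(2,3) facts[OF that(1)] on[OF qU] unfolding I
        by (elim insertE) (simp_all only: e'1 e'I, auto)
    qed
    show "e' (2 * \<alpha>) q = J q (e' (2 * \<alpha> - 1) q)" if "q \<in> U'" "\<alpha> \<in> {1..Suc k}" for q \<alpha>
    proof (cases "\<alpha> = Suc k")
      case True
      then show ?thesis by (simp add: e'_def fapp_def)
    next
      case False
      then have "\<alpha> \<in> {1..k}" using that(2) by auto
      then show ?thesis using Je[of q \<alpha>] that(1) U'(2) W(3) by (auto simp: e'_def)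
    qed
  qed
qed

lemma hermitian_frame_exists:
  assumes p: "p \<in> points"
  shows "\<exists>e U. open_in U \<and> p \<in> U \<and> hermitian_frame M J g U e"
proof -
  have d: "2 * (DIM('e) div 2) = DIM('e)" using even_dim by simp
  obtain U e where U: "open_in U" "p \<in> U" "\<forall>i\<in>{1..DIM('e)}. vf U (e i)"
     "\<forall>q\<in>U. \<forall>i\<in>{1..DIM('e)}. \<forall>j\<in>{1..DIM('e)}. g q (e i q) (e j q) = (if i = j then 1 else 0)"
     "\<forall>q\<in>U. \<forall>\<alpha>\<in>{1..DIM('e) div 2}. e (2 * \<alpha>) q = J q (e (2 * \<alpha> - 1) q)"
    using partial_hermitian_frame_exists[OF p, of "DIM('e) div 2", unfolded d, OF order_refl]
    by (elim exE conjE)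
  have "hermitian_frame M J g U e"
    unfolding hermitian_frame_def orthonormal_frame_def fpair_def fapp_def
    by (intro conjI U)
  with U(1,2) show ?thesis by blast
qed

lemma hermitian_frame_at:
  assumes p: "p \<in> points"
  obtains U where "open_in U" "p \<in> U" "hermitian_frame M J g U (hermitian_frame_at M J g p)"
  using someI_ex[OF hermitian_frame_exists[OF p]] unfolding hermitian_frame_at_def by blast

lemma on_frame_at:
  assumes p: "p \<in> points"
  obtains U where "open_in U" "p \<in> U" "on_frame U (on_frame_at M g p)"
proof -
  have "\<exists>e U. open_in U \<and> p \<in> U \<and> on_frame U e"
    using hermitian_frame_exists[OF p] unfolding hermitian_frame_def by blast
  from someI_ex[OF this] show thesis using that unfolding on_frame_at_def by blast
qed

end

section \<open>Tensoriality and traces\<close>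

lemma fscale_apply [simp]: "fscale f X p = tscale (f p) (X p)"
  by (simp add: fscale_def)

context smooth_mfd
begin

text \<open>
  Linearity over the smooth functions on \<open>U\<close> of an expression evaluated at the point \<open>q\<close>.  Agreement on \<open>U\<close> is part of
  the definition since a connection is only determined by its arguments on an open set where they
  are smooth.
\<close>

definition tensorial :: "'p set \<Rightarrow> 'p \<Rightarrow> ('p vfield \<Rightarrow> real) \<Rightarrow> bool" where
  "tensorial U q B \<longleftrightarrow>
     (\<forall>X Y. vf U X \<longrightarrow> vf U Y \<longrightarrow> B (X + Y) = B X + B Y) \<and>
     (\<forall>f X. smooth U f \<longrightarrow> vf U X \<longrightarrow> B (fscale f X) = f q * B X) \<and>
     (\<forall>X Y. vf U X \<longrightarrow> (\<forall>r\<in>U. X r = Y r) \<longrightarrow> B X = B Y)"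

lemma tensorialI:
  assumes "\<And>X Y. vf U X \<Longrightarrow> vf U Y \<Longrightarrow> B (X + Y) = B X + B Y"
    and "\<And>f X. smooth U f \<Longrightarrow> vf U X \<Longrightarrow> B (fscale f X) = f q * B X"
    and "\<And>X Y. vf U X \<Longrightarrow> (\<And>r. r \<in> U \<Longrightarrow> X r = Y r) \<Longrightarrow> B X = B Y"
  shows "tensorial U q B"
  unfolding tensorial_def
proof (intro conjI allI impI)
  show "B X = B Y" if "vf U X" "\<forall>r\<in>U. X r = Y r" for X Y
    by (rule assms(3)[OF that(1)]) (use that(2) in blast)
qed (rule assms(1) assms(2); assumption)+

lemma tensorial_add:
  "tensorial U q B \<Longrightarrow> vf U X \<Longrightarrow> vf U Y \<Longrightarrow> B (X + Y) = B X + B Y"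
  unfolding tensorial_def by blast

lemma tensorial_fscale:
  "tensorial U q B \<Longrightarrow> smooth U f \<Longrightarrow> vf U X \<Longrightarrow> B (fscale f X) = f q * B X"
  unfolding tensorial_def by blast

lemma tensorial_cong:
  "tensorial U q B \<Longrightarrow> vf U X \<Longrightarrow> (\<And>r. r \<in> U \<Longrightarrow> X r = Y r) \<Longrightarrow> B X = B Y"
  unfolding tensorial_def by blast

lemma tensorial_lincomb:
  assumes "tensorial U q B" "tensorial U q B'"
  shows "tensorial U q (\<lambda>X. a * B X + b * B' X)"
proof (rule tensorialI)
  show "a * B X + b * B' X = a * B Y + b * B' Y" if "vf U X" "\<And>r. r \<in> U \<Longrightarrow> X r = Y r" for X Y
    using tensorial_cong[OF assms(1) that] tensorial_cong[OF assms(2) that] by simp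
qed (simp_all add: tensorial_add[OF assms(1)] tensorial_add[OF assms(2)]
    tensorial_fscale[OF assms(1)] tensorial_fscale[OF assms(2)] algebra_simps)

lemma tensorial_cmult: "tensorial U q B \<Longrightarrow> tensorial U q (\<lambda>X. a * B X)"
  using tensorial_lincomb[of U q B B a 0] by simp

lemma tensorial_zero: "open_in U \<Longrightarrow> tensorial U q B \<Longrightarrow> B 0 = 0"
  using tensorial_add[OF _ vf_zero vf_zero, of U q B] by simp

lemma tensorial_sum_fscale:
  assumes U: "open_in U" and B: "tensorial U q B"
    and "\<And>i. i \<in> I \<Longrightarrow> smooth U (c i)" "\<And>i. i \<in> I \<Longrightarrow> vf U (E i)"
  shows "B (\<Sum>i\<in>I. fscale (c i) (E i)) = (\<Sum>i\<in>I. c i q * B (E i))"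
  using assms(3,4)
  by (induction I rule: infinite_finite_induct)
     (simp_all add: tensorial_zero[OF U B] tensorial_add[OF B] tensorial_fscale[OF B] vf_sum[OF U] vf_fscale[OF U])

lemma lie_bracket_sym: "lie Y X = - lie X Y"
  by (simp add: lie_bracket_def fun_eq_iff)

lemma lie_bracket_add:
  assumes U: "open_in U" "p \<in> U" and X: "vf U X" and X': "vf U X'"
    and Y: "vf U Y"
  shows "lie (X + X') Y p = lie X Y p + lie X' Y p"
proof
  fix f
  show "lie (X + X') Y p f = (lie X Y p + lie X' Y p) f"
  proof (cases "smooth_at M p f")
    case True
    then show ?thesis
      by (simp add: lie_bracket_apply tangent_add[OF vf_tangent[OF Y U(2)]] smooth_at_vf[OF U(1) X U(2)]
          smooth_at_vf[OF U(1) X' U(2)])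
  qed (simp add: lie_bracket_def)
qed

lemma lie_bracket_fscale:
  assumes U: "open_in U" "p \<in> U" and X: "vf U X" and f: "smooth U f"
    and Y: "vf U Y"
  shows "lie (fscale f X) Y p = tscale (f p) (lie X Y p) - tscale (Y p f) (X p)"
proof
  fix h
  show "lie (fscale f X) Y p h = (tscale (f p) (lie X Y p) - tscale (Y p f) (X p)) h"
  proof (cases "smooth_at M p h")
    case True
    then show ?thesis
      by (simp add: lie_bracket_apply algebra_simps tangent_mult[OF vf_tangent[OF Y U(2)] smooth_atI[OF U f]
          smooth_at_vf[OF U(1) X U(2)]])
  next
    case False
    then show ?thesis
      using tangent_nonsmooth[OF vf_tangent[OF X U(2)] False] by (simp add: lie_bracket_def)
  qed
qed

lemma lie_bracket_cong:
  assumes U: "open_in U" "p \<in> U" and X: "vf U X" and Y: "vf U Y"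
    and eq: "\<And>q. q \<in> U \<Longrightarrow> X' q = X q" "\<And>q. q \<in> U \<Longrightarrow> Y' q = Y q"
  shows "lie X' Y' p = lie X Y p"
proof -
  have "X p (\<lambda>q. Y' q f) = X p (\<lambda>q. Y q f)" for f
    by (rule tangent_cong[OF vf_tangent[OF X U(2)] U]) (simp add: eq)
  moreover have "Y p (\<lambda>q. X' q f) = Y p (\<lambda>q. X q f)" for f
    by (rule tangent_cong[OF vf_tangent[OF Y U(2)] U]) (simp add: eq)
  ultimately show ?thesis by (simp only: lie_bracket_def eq[OF U(2)])
qed

lemma lie_bracket_nested:
  assumes U: "open_in U" "p \<in> U" and X: "vf U X" and Y: "vf U Y"
    and Z: "vf U Z" and f: "smooth_at M p f"
  shows "lie X (lie Y Z) p f =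
     X p (\<lambda>q. Y q (\<lambda>r. Z r f)) - X p (\<lambda>q. Z q (\<lambda>r. Y r f))
     - Y p (\<lambda>q. Z q (\<lambda>r. X r f)) + Z p (\<lambda>q. Y q (\<lambda>r. X r f))"
proof -
  obtain W where W: "open_in W" "p \<in> W" "smooth W f"
    using f unfolding smooth_at_def by blast
  note Xp = vf_tangent[OF X U(2)]
  have s: "smooth_at M p (\<lambda>q. A q (\<lambda>r. B r f))" if "vf U A" "vf U B" for A B
    using smooth_at_vf[OF U(1) that(1) U(2) smooth_at_vf[OF U(1) that(2) U(2) f]] .
  have "X p (\<lambda>q. lie Y Z q f) = X p (\<lambda>q. Y q (\<lambda>r. Z r f) + -1 * Z q (\<lambda>r. Y r f))"
    by (rule tangent_cong[OF Xp W(1,2)]) (simp add: lie_bracket_apply smooth_atI[OF W(1) _ W(3)])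
  also have "\<dots> = X p (\<lambda>q. Y q (\<lambda>r. Z r f)) - X p (\<lambda>q. Z q (\<lambda>r. Y r f))"
    by (simp only: tangent_add[OF Xp s[OF Y Z] smooth_at_scale[OF s[OF Z Y]]]
        tangent_scale[OF Xp s[OF Z Y]])
  finally show ?thesis
    by (simp add: lie_bracket_apply f smooth_at_vf[OF U(1) X U(2) f])
qed

text \<open>
  Each of the six third-order derivatives occurs twice, with opposite signs.
\<close>

lemma jacobi_identity:
  assumes U: "open_in U" "p \<in> U" and X: "vf U X" and Y: "vf U Y"
    and Z: "vf U Z"
  shows "lie X (lie Y Z) p + lie Y (lie Z X) p
    + lie Z (lie X Y) p = 0"
proof
  fix f
  show "(lie X (lie Y Z) p + lie Y (lie Z X) p
    + lie Z (lie X Y) p) f = 0 f"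
  proof (cases "smooth_at M p f")
    case True
    then show ?thesis
      by (simp add: lie_bracket_nested[OF U X Y Z] lie_bracket_nested[OF U Y Z X] lie_bracket_nested[OF U Z X Y])
  qed (simp add: lie_bracket_def)
qed

end

context riem_mfd
begin

lemma fpair_sym:
  "open_in U \<Longrightarrow> p \<in> U \<Longrightarrow> vf U X \<Longrightarrow> vf U Y \<Longrightarrow>
    fpair g X Y p = fpair g Y X p"
  unfolding fpair_def by (rule g_sym) (auto intro: open_in_topspace vf_tangent)

lemma fpair_tensorial:
  assumes U: "open_in U" "q \<in> U" and W: "vf U W"
  shows "tensorial U q (\<lambda>X. fpair g X W q)"
  by (rule tensorialI)
     (simp_all add: fpair_def g_add g_scale open_in_topspace[OF U] vf_tangent[OF _ U(2)] W U(2))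

lemma fpair_tensorial2:
  assumes U: "open_in U" "q \<in> U" and W: "vf U W"
  shows "tensorial U q (\<lambda>X. fpair g W X q)"
proof -
  note p = open_in_topspace[OF U] and T = vf_tangent[OF _ U(2)]
  show ?thesis
  proof (rule tensorialI)
    fix X Y assume X: "vf U X" and Y: "vf U Y"
    show "fpair g W (X + Y) q = fpair g W X q + fpair g W Y q"
      using fpair_sym[OF U W] X Y vf_add[OF U(1) X Y] tensorial_add[OF fpair_tensorial[OF U W] X Y] by simp
  next
    fix f X assume f: "smooth U f" and X: "vf U X"
    show "fpair g W (fscale f X) q = f q * fpair g W X q"
      using fpair_sym[OF U W] X vf_fscale[OF U(1) f X] tensorial_fscale[OF fpair_tensorial[OF U W] f X] by simp
  qed (simp add: fpair_def U(2))
qed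

lemma orthonormal_frame_subset: "on_frame U e \<Longrightarrow> W \<subseteq> U \<Longrightarrow> on_frame W e"
  unfolding orthonormal_frame_def by (blast intro: vf_subset)

lemma frame_vf: "on_frame U e \<Longrightarrow> i \<in> {1..DIM('e)} \<Longrightarrow> vf U (e i)"
  unfolding orthonormal_frame_def by blast

lemma frame_fpair: "on_frame U e \<Longrightarrow> q \<in> U \<Longrightarrow> i \<in> {1..DIM('e)} \<Longrightarrow> j \<in> {1..DIM('e)} \<Longrightarrow>
    fpair g (e i) (e j) q = (if i = j then 1 else 0)"
  unfolding orthonormal_frame_def by blast

lemma frame_expansion:
  assumes U: "open_in U" "q \<in> U" and e: "on_frame U e" and X: "vf U X"
  shows "X q = (\<Sum>i=1..DIM('e). fscale (fpair g X (e i)) (e i)) q"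
proof -
  have "X q = (\<Sum>i=1..DIM('e). tscale (g q (X q) (e i q)) (e i q))"
    by (rule orthonormal_expansion[OF open_in_topspace[OF U]])
       (use frame_fpair[OF e U(2)] frame_vf[OF e] vf_tangent[OF _ U(2)] X in \<open>auto simp: fpair_def\<close>)
  then show ?thesis by (simp add: sum_fun_apply fpair_def)
qed

lemma tensorial_expansion:
  assumes U: "open_in U" "q \<in> U" and e: "on_frame U e" and X: "vf U X"
    and B: "tensorial U q B"
  shows "B X = (\<Sum>i=1..DIM('e). fpair g X (e i) q * B (e i))"
proof -
  have "B X = B (\<Sum>i=1..DIM('e). fscale (fpair g X (e i)) (e i))"
    by (rule tensorial_cong[OF B X frame_expansion[OF U(1) _ e X]])
  also have "\<dots> = (\<Sum>i=1..DIM('e). fpair g X (e i) q * B (e i))"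
    by (rule tensorial_sum_fscale[OF U(1) B smooth_fpair[OF U(1) X frame_vf[OF e]] frame_vf[OF e]])
  finally show ?thesis .
qed

lemma parseval:
  assumes U: "open_in U" "q \<in> U" and e: "on_frame U e" and X: "vf U X"
    and Y: "vf U Y"
  shows "fpair g X Y q = (\<Sum>i=1..DIM('e). fpair g X (e i) q * fpair g Y (e i) q)"
  using tensorial_expansion[OF U e X fpair_tensorial[OF U Y]] fpair_sym[OF U frame_vf[OF e] Y] by simp

text \<open>
  The transition coefficients between two orthonormal frames form an orthogonal matrix.
\<close>

lemma trace_frame_independent:
  assumes U: "open_in U" "q \<in> U" and e: "on_frame U e" and f: "on_frame U f"
    and B1: "\<And>Y. vf U Y \<Longrightarrow> tensorial U q (\<lambda>X. B X Y)"
    and B2: "\<And>X. vf U X \<Longrightarrow> tensorial U q (\<lambda>Y. B X Y)"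
  shows "(\<Sum>i=1..DIM('e). B (e i) (e i)) = (\<Sum>i=1..DIM('e). B (f i) (f i))"
proof -
  let ?I = "{1..DIM('e)}"
  let ?c = "\<lambda>i j. fpair g (f i) (e j) q"
  note fe = frame_vf[OF e] and ff = frame_vf[OF f]
  have Bf: "B (f i) (f i) = (\<Sum>j\<in>?I. \<Sum>k\<in>?I. ?c i j * ?c i k * B (e j) (e k))" if i: "i \<in> ?I" for i
  proof -
    have "B (f i) (f i) = (\<Sum>j\<in>?I. ?c i j * B (e j) (f i))"
      by (rule tensorial_expansion[OF U e ff[OF i] B1[OF ff[OF i]]])
    also have "\<dots> = (\<Sum>j\<in>?I. ?c i j * (\<Sum>k\<in>?I. ?c i k * B (e j) (e k)))"
      by (intro sum.cong refl arg_cong2[where f = "(*)"] tensorial_expansion[OF U e ff[OF i] B2[OF fe]])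
    finally show ?thesis by (simp add: sum_distrib_left mult.assoc)
  qed
  have c: "(\<Sum>i\<in>?I. ?c i j * ?c i k) = (if j = k then 1 else 0)" if jk: "j \<in> ?I" "k \<in> ?I" for j k
  proof -
    have "(\<Sum>i\<in>?I. ?c i j * ?c i k) = (\<Sum>i\<in>?I. fpair g (e j) (f i) q * fpair g (e k) (f i) q)"
      by (intro sum.cong refl arg_cong2[where f = "(*)"] fpair_sym[OF U] fe ff jk)
    also have "\<dots> = fpair g (e j) (e k) q" by (rule parseval[OF U f fe[OF jk(1)] fe[OF jk(2)], symmetric])
    finally show ?thesis by (simp add: frame_fpair[OF e U(2) jk])
  qed
  have "(\<Sum>i\<in>?I. B (f i) (f i)) = (\<Sum>i\<in>?I. \<Sum>j\<in>?I. \<Sum>k\<in>?I. ?c i j * ?c i k * B (e j) (e k))"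
    by (intro sum.cong refl Bf)
  also have "\<dots> = (\<Sum>j\<in>?I. \<Sum>i\<in>?I. \<Sum>k\<in>?I. ?c i j * ?c i k * B (e j) (e k))"
    by (rule sum.swap)
  also have "\<dots> = (\<Sum>j\<in>?I. \<Sum>k\<in>?I. \<Sum>i\<in>?I. ?c i j * ?c i k * B (e j) (e k))"
    by (intro sum.cong refl sum.swap)
  also have "\<dots> = (\<Sum>j\<in>?I. \<Sum>k\<in>?I. (if j = k then 1 else 0) * B (e j) (e k))"
    by (intro sum.cong refl) (simp only: sum_distrib_right[symmetric] c)
  also have "\<dots> = (\<Sum>j\<in>?I. \<Sum>k\<in>?I. if j = k then B (e j) (e k) else 0)"
    by (intro sum.cong refl) auto
  also have "\<dots> = (\<Sum>j\<in>?I. B (e j) (e j))"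
    by (intro sum.cong refl) (simp add: sum.delta')
  finally show ?thesis by simp
qed

text \<open>
  Trace over one slot at a time; for a linear form \<open>b\<close>, the sum of the \<open>b(e\<^sub>i)\<^sup>2\<close> is the trace of \<open>b \<otimes> b\<close>.
\<close>

lemma square_norm_frame_independent:
  assumes U: "open_in U" "q \<in> U" and e: "on_frame U e" and f: "on_frame U f"
    and t1: "\<And>Y Z. vf U Y \<Longrightarrow> vf U Z \<Longrightarrow> tensorial U q (\<lambda>X. t X Y Z)"
    and t2: "\<And>X Z. vf U X \<Longrightarrow> vf U Z \<Longrightarrow> tensorial U q (\<lambda>Y. t X Y Z)"
    and t3: "\<And>X Y. vf U X \<Longrightarrow> vf U Y \<Longrightarrow> tensorial U q (\<lambda>Z. t X Y Z)"
  shows "(\<Sum>i=1..DIM('e). \<Sum>j=1..DIM('e). \<Sum>k=1..DIM('e). (t (e i) (e j) (e k))\<^sup>2) =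
    (\<Sum>i=1..DIM('e). \<Sum>j=1..DIM('e). \<Sum>k=1..DIM('e). (t (f i) (f j) (f k))\<^sup>2)"
proof -
  let ?I = "{1..DIM('e)}"
  note fe = frame_vf[OF e] and ff = frame_vf[OF f]
  have tr: "(\<Sum>i\<in>?I. (b (e i))\<^sup>2) = (\<Sum>i\<in>?I. (b (f i))\<^sup>2)" if b: "tensorial U q b" for b
  proof -
    have b': "tensorial U q (\<lambda>X. b X * b Y)" for Y
      using tensorial_cmult[OF b, of "b Y"] by (simp add: mult.commute)
    show ?thesis
      unfolding power2_eq_square by (rule trace_frame_independent[OF U e f b' tensorial_cmult[OF b]])
  qed
  have "(\<Sum>i\<in>?I. \<Sum>j\<in>?I. \<Sum>k\<in>?I. (t (e i) (e j) (e k))\<^sup>2) =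
      (\<Sum>i\<in>?I. \<Sum>j\<in>?I. \<Sum>k\<in>?I. (t (e i) (e j) (f k))\<^sup>2)"
    by (intro sum.cong refl tr t3 fe)
  also have "\<dots> = (\<Sum>i\<in>?I. \<Sum>k\<in>?I. \<Sum>j\<in>?I. (t (e i) (e j) (f k))\<^sup>2)"
    by (intro sum.cong refl sum.swap)
  also have "\<dots> = (\<Sum>i\<in>?I. \<Sum>k\<in>?I. \<Sum>j\<in>?I. (t (e i) (f j) (f k))\<^sup>2)"
    by (intro sum.cong refl tr t2 fe ff)
  also have "\<dots> = (\<Sum>k\<in>?I. \<Sum>i\<in>?I. \<Sum>j\<in>?I. (t (e i) (f j) (f k))\<^sup>2)"
    by (rule sum.swap)
  also have "\<dots> = (\<Sum>k\<in>?I. \<Sum>j\<in>?I. \<Sum>i\<in>?I. (t (e i) (f j) (f k))\<^sup>2)"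
    by (intro sum.cong refl sum.swap)
  also have "\<dots> = (\<Sum>k\<in>?I. \<Sum>j\<in>?I. \<Sum>i\<in>?I. (t (f i) (f j) (f k))\<^sup>2)"
    by (intro sum.cong refl tr t1 ff)
  also have "\<dots> = (\<Sum>k\<in>?I. \<Sum>i\<in>?I. \<Sum>j\<in>?I. (t (f i) (f j) (f k))\<^sup>2)"
    by (intro sum.cong refl sum.swap)
  also have "\<dots> = (\<Sum>i\<in>?I. \<Sum>k\<in>?I. \<Sum>j\<in>?I. (t (f i) (f j) (f k))\<^sup>2)"
    by (rule sum.swap)
  also have "\<dots> = (\<Sum>i\<in>?I. \<Sum>j\<in>?I. \<Sum>k\<in>?I. (t (f i) (f j) (f k))\<^sup>2)"
    by (intro sum.cong refl sum.swap)
  finally show ?thesis .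
qed

end

section \<open>Metric connections\<close>

locale metric_conn = riem_mfd M g for M :: "('p, 'e::euclidean_space) manifold" and g +
  fixes nab :: "'p conn"
  assumes metric_connection: "metric_connection M g nab"
begin

lemma connection: "connection M nab"
  using metric_connection by (simp add: metric_connection_def)

context
  fixes U X Y
  assumes U: "open_in U" and X: "vf U X" and Y: "vf U Y"
begin

text \<open>
  The axioms of a connection for fixed arguments; the lemmas after it take them apart.
\<close>

lemma nab_all:
  "vf U (nab X Y) \<and>
   (\<forall>X' Y'. (\<forall>p\<in>U. X' p = X p \<and> Y' p = Y p) \<longrightarrow> (\<forall>p\<in>U. nab X' Y' p = nab X Y p)) \<and>
   (\<forall>Z. vf U Z \<longrightarrow>
      (\<forall>p\<in>U. nab (X + Z) Y p = nab X Y p + nab Z Y p \<and> nab X (Y + Z) p = nab X Y p + nab X Z p)) \<and>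
   (\<forall>f. smooth U f \<longrightarrow>
      (\<forall>p\<in>U. nab (fscale f X) Y p = tscale (f p) (nab X Y p) \<and>
             nab X (fscale f Y) p = tscale (X p f) (Y p) + tscale (f p) (nab X Y p)))"
  using connection[unfolded connection_def, rule_format, OF U X Y] .

lemma nab_vf: "vf U (nab X Y)"
  using nab_all by (rule conjunct1)

lemma nab_cong:
  assumes "p \<in> U" "\<And>q. q \<in> U \<Longrightarrow> X' q = X q" "\<And>q. q \<in> U \<Longrightarrow> Y' q = Y q"
  shows "nab X' Y' p = nab X Y p"
  using nab_all[THEN conjunct2, THEN conjunct1, rule_format, of X' Y' p] assms by simp

lemma nab_add1: "vf U Z \<Longrightarrow> p \<in> U \<Longrightarrow> nab (X + Z) Y p = nab X Y p + nab Z Y p"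
  and nab_add2: "vf U Z \<Longrightarrow> p \<in> U \<Longrightarrow> nab X (Y + Z) p = nab X Y p + nab X Z p"
  using nab_all[THEN conjunct2, THEN conjunct2, THEN conjunct1] by simp_all

lemma nab_fscale1: "smooth U f \<Longrightarrow> p \<in> U \<Longrightarrow> nab (fscale f X) Y p = tscale (f p) (nab X Y p)"
  and nab_fscale2: "smooth U f \<Longrightarrow> p \<in> U \<Longrightarrow>
     nab X (fscale f Y) p = tscale (X p f) (Y p) + tscale (f p) (nab X Y p)"
  using nab_all[THEN conjunct2, THEN conjunct2, THEN conjunct2] by simp_all

lemma nab_cscale2:
  assumes p: "p \<in> U"
  shows "nab X (fscale (\<lambda>q. c) Y) p = tscale c (nab X Y p)"
proof -
  have "X p (\<lambda>q. c) = 0"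
    by (rule tangent_const[OF vf_tangent[OF X p] open_in_topspace[OF U p]])
  then show ?thesis
    using nab_fscale2[OF smooth_fun_const[OF U, of c] p] by (simp add: fun_eq_iff)
qed

lemma nab_uminus1:
  assumes p: "p \<in> U"
  shows "nab (- X) Y p = - nab X Y p"
proof -
  have e: "fscale (\<lambda>q. -1) X = - X" by (simp add: fun_eq_iff)
  show ?thesis
    using nab_fscale1[OF smooth_fun_const[OF U, of "-1"] p] unfolding e by (simp add: fun_eq_iff)
qed

lemma nab_uminus2:
  assumes p: "p \<in> U"
  shows "nab X (- Y) p = - nab X Y p"
proof -
  have e: "fscale (\<lambda>q. -1) Y = - Y" by (simp add: fun_eq_iff)
  show ?thesis
    using nab_cscale2[OF p, of "-1"] unfolding e by (simp add: fun_eq_iff)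
qed

end

lemma nab_diff1:
  assumes "open_in U" "vf U X" "vf U Z" "vf U Y" "p \<in> U"
  shows "nab (X - Z) Y p = nab X Y p - nab Z Y p"
  using nab_add1[OF assms(1,2,4) vf_uminus[OF assms(1,3)] assms(5)] nab_uminus1[OF assms(1,3,4,5)] by simp

lemma nab_diff2:
  assumes "open_in U" "vf U X" "vf U Y" "vf U Z" "p \<in> U"
  shows "nab X (Y - Z) p = nab X Y p - nab X Z p"
  using nab_add2[OF assms(1,2,3) vf_uminus[OF assms(1,4)] assms(5)] nab_uminus2[OF assms(1,2,4,5)] by simp

lemma nab_metric:
  assumes "open_in U" "vf U X" "vf U Y" "vf U Z" "p \<in> U"
  shows "X p (fpair g Y Z) = fpair g (nab X Y) Z p + fpair g Y (nab X Z) p"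
  using metric_connection[unfolded metric_connection_def, THEN conjunct2, rule_format, OF assms] .

lemma nab_tensorial:
  assumes U: "open_in U" "q \<in> U" and Y: "vf U Y" and W: "vf U W"
  shows "tensorial U q (\<lambda>X. fpair g (nab X Y) W q)"
proof (rule tensorialI)
  fix X Z assume X: "vf U X" and Z: "vf U Z"
  show "fpair g (nab (X + Z) Y) W q = fpair g (nab X Y) W q + fpair g (nab Z Y) W q"
    using nab_add1[OF U(1) X Y Z U(2)]
      tensorial_add[OF fpair_tensorial[OF U W] nab_vf[OF U(1) X Y] nab_vf[OF U(1) Z Y]]
    by (simp add: fpair_def)
next
  fix f X assume f: "smooth U f" and X: "vf U X"
  show "fpair g (nab (fscale f X) Y) W q = f q * fpair g (nab X Y) W q"
    using nab_fscale1[OF U(1) X Y f U(2)]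
      tensorial_fscale[OF fpair_tensorial[OF U W] f nab_vf[OF U(1) X Y]]
    by (simp add: fpair_def)
next
  fix X Z assume X: "vf U X" and eq: "\<And>r. r \<in> U \<Longrightarrow> X r = Z r"
  show "fpair g (nab X Y) W q = fpair g (nab Z Y) W q"
    using nab_cong[OF U(1) X Y U(2), of Z Y] eq by (simp add: fpair_def)
qed

abbreviation tor :: "'p vfield \<Rightarrow> 'p vfield \<Rightarrow> 'p vfield" where
  "tor \<equiv> torsion M nab"

lemma torsion_apply: "tor X Y p = nab X Y p - nab Y X p - lie X Y p"
  by (simp add: torsion_def)

lemma torsion_vf:
  "open_in U \<Longrightarrow> vf U X \<Longrightarrow> vf U Y \<Longrightarrow> vf U (tor X Y)"
  unfolding torsion_def by (intro vf_diff nab_vf vf_lie_bracket)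

lemma torsion_sym: "tor Y X = - tor X Y"
  using lie_bracket_sym[of X Y] by (simp add: torsion_def)

lemma torsion_tensorial:
  assumes U: "open_in U" "q \<in> U" and Y: "vf U Y" and W: "vf U W"
  shows "tensorial U q (\<lambda>X. fpair g (tor X Y) W q)"
proof (rule tensorialI)
  fix X Z assume X: "vf U X" and Z: "vf U Z"
  have "tor (X + Z) Y q = (tor X Y + tor Z Y) q"
    by (simp add: torsion_apply nab_add1[OF U(1) X Y Z U(2)] nab_add2[OF U(1) Y X Z U(2)]
        lie_bracket_add[OF U X Z Y])
  then show "fpair g (tor (X + Z) Y) W q = fpair g (tor X Y) W q + fpair g (tor Z Y) W q"
    using tensorial_add[OF fpair_tensorial[OF U W] torsion_vf[OF U(1) X Y] torsion_vf[OF U(1) Z Y]]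
    by (simp add: fpair_def)
next
  fix f X assume f: "smooth U f" and X: "vf U X"
  have "tor (fscale f X) Y q = fscale f (tor X Y) q"
    by (simp add: torsion_apply nab_fscale1[OF U(1) X Y f U(2)] nab_fscale2[OF U(1) Y X f U(2)]
        lie_bracket_fscale[OF U X f Y] fun_eq_iff algebra_simps)
  then show "fpair g (tor (fscale f X) Y) W q = f q * fpair g (tor X Y) W q"
    using tensorial_fscale[OF fpair_tensorial[OF U W] f torsion_vf[OF U(1) X Y]]
    by (simp add: fpair_def)
next
  fix X Z assume X: "vf U X" and eq: "\<And>r. r \<in> U \<Longrightarrow> X r = Z r"
  show "fpair g (tor X Y) W q = fpair g (tor Z Y) W q"
    using nab_cong[OF U(1) X Y U(2), of Z Y] nab_cong[OF U(1) Y X U(2), of Y Z]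
      lie_bracket_cong[OF U X Y, of Z Y] eq by (simp add: fpair_def torsion_apply)
qed

lemma torsion_fpair_sym:
  assumes U: "open_in U" "q \<in> U" and X: "vf U X" and Y: "vf U Y"
    and W: "vf U W"
  shows "fpair g (tor Y X) W q = - fpair g (tor X Y) W q"
  unfolding torsion_sym[of Y X] fpair_def
  using g_uminus[OF open_in_topspace[OF U] vf_tangent[OF torsion_vf[OF U(1) X Y] U(2)] vf_tangent[OF W U(2)]]
  by simp

lemma tensorial_eqI:
  assumes "tensorial U q B" "\<And>X. vf U X \<Longrightarrow> B' X = B X" "open_in U"
  shows "tensorial U q B'"
proof (rule tensorialI)
  show "B' (X + Y) = B' X + B' Y" if "vf U X" "vf U Y" for X Y
    using tensorial_add[OF assms(1) that] assms(2)[OF vf_add[OF assms(3) that]] assms(2) that by simp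
  show "B' (fscale f X) = f q * B' X" if "smooth U f" "vf U X" for f X
    using tensorial_fscale[OF assms(1) that] assms(2)[OF vf_fscale[OF assms(3) that]] assms(2) that by simp
  show "B' X = B' Y" if X: "vf U X" and eq: "\<And>r. r \<in> U \<Longrightarrow> X r = Y r" for X Y
    using tensorial_cong[OF assms(1) X eq] assms(2)[OF X] assms(2)[OF vf_cong[OF assms(3) eq X]] by simp
qed

lemma torsion_tensorial2:
  assumes U: "open_in U" "q \<in> U" and X: "vf U X" and W: "vf U W"
  shows "tensorial U q (\<lambda>Y. fpair g (tor X Y) W q)"
  by (rule tensorial_eqI[OF tensorial_cmult[OF torsion_tensorial[OF U X W], of "-1"] _ U(1)])
     (simp add: torsion_fpair_sym[OF U _ X W])

lemma curvature_apply:
  "curvature M nab X Y Z p = nab X (nab Y Z) p - nab Y (nab X Z) p - nab (lie X Y) Z p"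
  by (simp add: curvature_def)

lemma curvature_vf:
  "open_in U \<Longrightarrow> vf U X \<Longrightarrow> vf U Y \<Longrightarrow> vf U Z \<Longrightarrow>
    vf U (curvature M nab X Y Z)"
  unfolding curvature_def by (intro vf_diff nab_vf vf_lie_bracket)

lemma curvature_sym:
  assumes U: "open_in U" "q \<in> U" and X: "vf U X" and Y: "vf U Y"
    and Z: "vf U Z"
  shows "curvature M nab Y X Z q = - curvature M nab X Y Z q"
  unfolding curvature_apply lie_bracket_sym[of Y X]
  using nab_uminus1[OF U(1) vf_lie_bracket[OF U(1) X Y] Z U(2)] by simp

text \<open>
  The term \<open>(Y f) \<nabla>\<^sub>X Z\<close> from differentiating \<open>f\<close> in \<open>\<nabla>\<^sub>Y (f \<nabla>\<^sub>X Z)\<close> cancels against the one from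
  \<open>[f X, Y] = f [X, Y] - (Y f) X\<close>.
\<close>

lemma curvature_tensorial:
  assumes U: "open_in U" "q \<in> U" and Y: "vf U Y" and Z: "vf U Z"
    and W: "vf U W"
  shows "tensorial U q (\<lambda>X. fpair g (curvature M nab X Y Z) W q)"
proof (rule tensorialI)
  note o = U(1) and q = U(2)
  note YZ = nab_vf[OF o Y Z]
  fix X X' assume X: "vf U X" and X': "vf U X'"
  note XZ = nab_vf[OF o X Z] and X'Z = nab_vf[OF o X' Z]
  note XY = vf_lie_bracket[OF o X Y] and X'Y = vf_lie_bracket[OF o X' Y]
  have "nab Y (nab (X + X') Z) q = nab Y (nab X Z + nab X' Z) q"
    by (rule nab_cong[OF o Y vf_add[OF o XZ X'Z] q]) (simp_all add: nab_add1[OF o X Z X'])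
  moreover have "nab (lie (X + X') Y) Z q = nab (lie X Y + lie X' Y) Z q"
    by (rule nab_cong[OF o vf_add[OF o XY X'Y] Z q]) (simp_all add: lie_bracket_add[OF o _ X X' Y])
  ultimately have "curvature M nab (X + X') Y Z q = (curvature M nab X Y Z + curvature M nab X' Y Z) q"
    by (simp add: curvature_apply nab_add1[OF o X YZ X' q] nab_add2[OF o Y XZ X'Z q] nab_add1[OF o XY Z X'Y q])
  then show "fpair g (curvature M nab (X + X') Y Z) W q =
      fpair g (curvature M nab X Y Z) W q + fpair g (curvature M nab X' Y Z) W q"
    using tensorial_add[OF fpair_tensorial[OF U W] curvature_vf[OF o X Y Z] curvature_vf[OF o X' Y Z]]
    by (simp add: fpair_def)
next
  note o = U(1) and q = U(2)
  note YZ = nab_vf[OF o Y Z]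
  fix f X assume f: "smooth U f" and X: "vf U X"
  note XZ = nab_vf[OF o X Z] and XY = vf_lie_bracket[OF o X Y]
  have Yf: "smooth U (\<lambda>r. Y r f)" by (rule vf_smooth_self[OF o Y f])
  have "nab Y (nab (fscale f X) Z) q = nab Y (fscale f (nab X Z)) q"
    by (rule nab_cong[OF o Y vf_fscale[OF o f XZ] q]) (simp_all add: nab_fscale1[OF o X Z f])
  moreover have "nab (lie (fscale f X) Y) Z q =
      nab (fscale f (lie X Y) - fscale (\<lambda>r. Y r f) X) Z q"
    by (rule nab_cong[OF o vf_diff[OF o vf_fscale[OF o f XY] vf_fscale[OF o Yf X]] Z q])
       (simp_all add: lie_bracket_fscale[OF o _ X f Y])
  ultimately have "curvature M nab (fscale f X) Y Z q = fscale f (curvature M nab X Y Z) q"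
    by (simp add: curvature_apply nab_fscale1[OF o X YZ f q] nab_fscale2[OF o Y XZ f q]
        nab_diff1[OF o vf_fscale[OF o f XY] vf_fscale[OF o Yf X] Z q]
        nab_fscale1[OF o XY Z f q] nab_fscale1[OF o X Z Yf q] fun_eq_iff algebra_simps)
  then show "fpair g (curvature M nab (fscale f X) Y Z) W q = f q * fpair g (curvature M nab X Y Z) W q"
    using tensorial_fscale[OF fpair_tensorial[OF U W] f curvature_vf[OF o X Y Z]]
    by (simp add: fpair_def)
next
  note o = U(1) and q = U(2)
  fix X X' assume X: "vf U X" and eq: "\<And>r. r \<in> U \<Longrightarrow> X r = X' r"
  have eq': "X' r = X r" if "r \<in> U" for r using eq[OF that] by simp
  have "nab X' Z r = nab X Z r" if "r \<in> U" for r
    by (rule nab_cong[OF o X Z that eq' refl])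
  then have "nab Y (nab X' Z) q = nab Y (nab X Z) q"
    by (rule nab_cong[OF o Y nab_vf[OF o X Z] q refl])
  moreover have "nab X' (nab Y Z) q = nab X (nab Y Z) q"
    by (rule nab_cong[OF o X nab_vf[OF o Y Z] q eq' refl])
  moreover have "lie X' Y r = lie X Y r" if "r \<in> U" for r
    by (rule lie_bracket_cong[OF o that X Y eq' refl])
  then have "nab (lie X' Y) Z q = nab (lie X Y) Z q"
    by (rule nab_cong[OF o vf_lie_bracket[OF o X Y] Z q _ refl])
  ultimately show "fpair g (curvature M nab X Y Z) W q = fpair g (curvature M nab X' Y Z) W q"
    by (simp add: curvature_apply fpair_def)
qed

lemma curvature_tensorial2:
  assumes U: "open_in U" "q \<in> U" and X: "vf U X" and Z: "vf U Z"
    and W: "vf U W"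
  shows "tensorial U q (\<lambda>Y. fpair g (curvature M nab X Y Z) W q)"
proof (rule tensorial_eqI[OF tensorial_cmult[OF curvature_tensorial[OF U X Z W], of "-1"] _ U(1)])
  fix Y assume Y: "vf U Y"
  show "fpair g (curvature M nab X Y Z) W q = -1 * fpair g (curvature M nab Y X Z) W q"
    unfolding fpair_def curvature_sym[OF U Y X Z]
    by (simp add: g_uminus[OF open_in_topspace[OF U] vf_tangent[OF curvature_vf[OF U(1) Y X Z] U(2)] vf_tangent[OF W U(2)]])
qed

text \<open>
  Differentiating \<open>g(\<nabla>\<^sub>Y Z, W)\<close> trades second covariant derivatives for derivatives of functions; in a
  frame it expresses the curvature by connection coefficients.
\<close>

lemma curvature_fpair:
  assumes U: "open_in U" "q \<in> U" and X: "vf U X" and Y: "vf U Y"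
    and Z: "vf U Z" and W: "vf U W"
  shows "fpair g (curvature M nab X Y Z) W q =
     X q (fpair g (nab Y Z) W) - fpair g (nab Y Z) (nab X W) q
     - Y q (fpair g (nab X Z) W) + fpair g (nab X Z) (nab Y W) q
     - fpair g (nab (lie X Y) Z) W q"
proof -
  note o = U(1) and q = U(2)
  note t = open_in_topspace[OF U] and T = vf_tangent[OF _ q]
  have "fpair g (curvature M nab X Y Z) W q =
     fpair g (nab X (nab Y Z)) W q - fpair g (nab Y (nab X Z)) W q - fpair g (nab (lie X Y) Z) W q"
    unfolding fpair_def curvature_apply
    by (simp add: g_diff t T nab_vf[OF o] vf_lie_bracket[OF o] X Y Z W tangent_diff_mem)
  then show ?thesis
    using nab_metric[OF o X nab_vf[OF o Y Z] W q] nab_metric[OF o Y nab_vf[OF o X Z] W q] by simp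
qed

text \<open>
  Apply \<open>X Y - Y X - [X, Y] = 0\<close> to the function \<open>g(Z, W)\<close>.
\<close>

lemma curvature_skew:
  assumes U: "open_in U" "q \<in> U" and X: "vf U X" and Y: "vf U Y"
    and Z: "vf U Z" and W: "vf U W"
  shows "fpair g (curvature M nab X Y W) Z q = - fpair g (curvature M nab X Y Z) W q"
proof -
  note o = U(1) and q = U(2)
  have sm: "smooth_at M q (fpair g A B)" if "vf U A" "vf U B" for A B
    by (rule smooth_atI[OF U smooth_fpair[OF o that]])
  have d: "A q (\<lambda>r. B r (fpair g Z W)) = A q (fpair g (nab B Z) W) + A q (fpair g (nab B W) Z)"
    if A: "vf U A" and B: "vf U B" for A B
  proof -
    have "A q (\<lambda>r. B r (fpair g Z W)) = A q (\<lambda>r. fpair g (nab B Z) W r + fpair g (nab B W) Z r)"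
      by (rule tangent_cong[OF vf_tangent[OF A q] U])
         (simp add: nab_metric[OF o B Z W] fpair_sym[OF o _ Z nab_vf[OF o B W]])
    then show ?thesis
      by (simp add: tangent_add[OF vf_tangent[OF A q] sm[OF nab_vf[OF o B Z] W] sm[OF nab_vf[OF o B W] Z]])
  qed
  have "lie X Y q (fpair g Z W) =
      fpair g (nab (lie X Y) Z) W q + fpair g (nab (lie X Y) W) Z q"
    using nab_metric[OF o vf_lie_bracket[OF o X Y] Z W q]
      fpair_sym[OF o q Z nab_vf[OF o vf_lie_bracket[OF o X Y] W]] by simp
  moreover have "lie X Y q (fpair g Z W) =
      X q (\<lambda>r. Y r (fpair g Z W)) - Y q (\<lambda>r. X r (fpair g Z W))"
    by (rule lie_bracket_apply[OF sm[OF Z W]])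
  moreover have "fpair g (nab Y Z) (nab X W) q = fpair g (nab X W) (nab Y Z) q"
    "fpair g (nab X Z) (nab Y W) q = fpair g (nab Y W) (nab X Z) q"
    by (intro fpair_sym[OF U] nab_vf o X Y Z W)+
  ultimately show ?thesis
    unfolding curvature_fpair[OF U X Y Z W] curvature_fpair[OF U X Y W Z] d[OF X Y] d[OF Y X] by simp
qed

text \<open>
  By skewness, tensoriality in the third slot is that in the fourth, which is trivial.
\<close>

lemma curvature_tensorial3:
  assumes U: "open_in U" "q \<in> U" and X: "vf U X" and Y: "vf U Y"
    and W: "vf U W"
  shows "tensorial U q (\<lambda>Z. fpair g (curvature M nab X Y Z) W q)"
  by (rule tensorial_eqI[OF tensorial_cmult[OF fpair_tensorial2[OF U curvature_vf[OF U(1) X Y W]], of "-1"] _ U(1)])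
     (simp add: curvature_skew[OF U X Y W])

text \<open>
  In the cyclic sum, \<open>\<nabla>\<^sub>X \<nabla>\<^sub>Y Z - \<nabla>\<^sub>X \<nabla>\<^sub>Z Y = \<nabla>\<^sub>X (T(Y, Z) + [Y, Z])\<close>, and
  \<open>\<nabla>\<^sub>X [Y, Z] - \<nabla>\<^bsub>[Y, Z]\<^esub> X = T(X, [Y, Z]) + [X, [Y, Z]]\<close>; the double brackets cancel by the Jacobi
  identity.
\<close>

lemma first_bianchi_identity:
  assumes U: "open_in U" "q \<in> U" and X: "vf U X" and Y: "vf U Y"
    and Z: "vf U Z"
  shows "curvature M nab X Y Z q + curvature M nab Y Z X q + curvature M nab Z X Y q =
     nab X (tor Y Z) q + tor X (lie Y Z) q
     + (nab Y (tor Z X) q + tor Y (lie Z X) q)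
     + (nab Z (tor X Y) q + tor Z (lie X Y) q)"
proof -
  note o = U(1) and q = U(2)
  have t: "nab A (tor B C) q + tor A (lie B C) q =
      nab A (nab B C) q - nab A (nab C B) q - nab (lie B C) A q - lie A (lie B C) q"
    if A: "vf U A" and B: "vf U B" and C: "vf U C" for A B C
  proof -
    have 1: "nab A (tor B C) q = nab A (nab B C) q - nab A (nab C B) q - nab A (lie B C) q"
      unfolding torsion_def[of M nab B C]
      by (simp only: nab_diff2[OF o A vf_diff[OF o nab_vf[OF o B C] nab_vf[OF o C B]] vf_lie_bracket[OF o B C] q]
        nab_diff2[OF o A nab_vf[OF o B C] nab_vf[OF o C B] q])
    show ?thesis unfolding 1 torsion_apply by (simp add: fun_eq_iff)
  qed
  have neg: "c = - a - b" if "a + b + c = 0" for a b c :: "'p tvec"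
  proof -
    have "c = (a + b + c) + (- a - b)" by (simp add: algebra_simps)
    then show ?thesis unfolding that by simp
  qed
  have "lie Z (lie X Y) q =
      - lie X (lie Y Z) q - lie Y (lie Z X) q"
    by (rule neg[OF jacobi_identity[OF U X Y Z]])
  then show ?thesis
    unfolding t[OF X Y Z] t[OF Y Z X] t[OF Z X Y] curvature_apply
    by (simp add: algebra_simps)
qed

end

section \<open>Connection coefficients in an orthonormal frame\<close>

locale frame_sums =
  fixes I :: "'i set"
begin

definition sum2 :: "('i \<Rightarrow> 'i \<Rightarrow> real) \<Rightarrow> real" where
  "sum2 f = (\<Sum>i\<in>I. \<Sum>j\<in>I. f i j)"

definition sum3 :: "('i \<Rightarrow> 'i \<Rightarrow> 'i \<Rightarrow> real) \<Rightarrow> real" where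
  "sum3 f = (\<Sum>i\<in>I. \<Sum>j\<in>I. \<Sum>k\<in>I. f i j k)"

lemma sum2_simps [simp]:
  "sum2 (\<lambda>i j. f i j + h i j) = sum2 f + sum2 h"
  "sum2 (\<lambda>i j. f i j - h i j) = sum2 f - sum2 h"
  "sum2 (\<lambda>i j. - f i j) = - sum2 f"
  "sum2 (\<lambda>i j. c * f i j) = c * sum2 f"
  "sum2 (\<lambda>i j. \<Sum>k\<in>I. t i j k) = sum3 t"
  by (simp_all add: sum2_def sum3_def sum.distrib sum_subtractf sum_negf sum_distrib_left)

lemma sum3_simps [simp]:
  "sum3 (\<lambda>i j k. f i j k + h i j k) = sum3 f + sum3 h"
  "sum3 (\<lambda>i j k. f i j k - h i j k) = sum3 f - sum3 h"
  "sum3 (\<lambda>i j k. - f i j k) = - sum3 f"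
  "sum3 (\<lambda>i j k. c * f i j k) = c * sum3 f"
  "sum3 (\<lambda>i j k. f i j k / c) = sum3 f / c"
  by (simp_all add: sum3_def sum.distrib sum_subtractf sum_negf sum_distrib_left sum_divide_distrib)

lemma sum2_swap: "sum2 f = sum2 (\<lambda>i j. f j i)"
  unfolding sum2_def by (rule sum.swap)

lemma sum3_swap12: "sum3 f = sum3 (\<lambda>i j k. f j i k)"
  unfolding sum3_def by (rule sum.swap)

lemma sum3_swap23: "sum3 f = sum3 (\<lambda>i j k. f i k j)"
  unfolding sum3_def by (rule sum.cong[OF refl sum.swap])

lemma sum3_rotate: "sum3 f = sum3 (\<lambda>i j k. f j k i)"
  by (subst sum3_swap12, subst sum3_swap23) (rule refl)

end

text \<open>
  The components at one point of two metric connections in an orthonormal frame.  \<open>G i j k\<close> stands for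
  \<open>g(\<nabla>\<^sub>i e\<^sub>j, e\<^sub>k)\<close>, \<open>L i j k\<close> for \<open>g(D\<^sub>i e\<^sub>j, e\<^sub>k)\<close>, and \<open>dG a i j k\<close>, \<open>dL a i j k\<close> for the derivatives of
  these functions in direction \<open>e\<^sub>a\<close>; \<open>R\<close> and \<open>RD\<close> are the curvatures.  Since \<open>D\<close> has no torsion,
  \<open>L i j m - L j i m\<close> are the components of the bracket \<open>[e\<^sub>i, e\<^sub>j]\<close>.
\<close>

locale connection_components = frame_sums I for I :: "'i set" +
  fixes G L :: "'i \<Rightarrow> 'i \<Rightarrow> 'i \<Rightarrow> real"
    and dG dL :: "'i \<Rightarrow> 'i \<Rightarrow> 'i \<Rightarrow> 'i \<Rightarrow> real"
    and R RD :: "'i \<Rightarrow> 'i \<Rightarrow> 'i \<Rightarrow> 'i \<Rightarrow> real"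
  assumes G_skew: "\<And>i j k. G i j k = - G i k j"
    and L_skew: "\<And>i j k. L i j k = - L i k j"
    and dG_skew: "\<And>a i j k. dG a i j k = - dG a i k j"
    and dL_skew: "\<And>a i j k. dL a i j k = - dL a i k j"
    and R_components: "\<And>i j k l. R i j k l = dG i j k l - dG j i k l
          - (\<Sum>m\<in>I. G j k m * G i l m) + (\<Sum>m\<in>I. G i k m * G j l m)
          - (\<Sum>m\<in>I. (L i j m - L j i m) * G m k l)"
    and RD_components: "\<And>i j k l. RD i j k l = dL i j k l - dL j i k l
          - (\<Sum>m\<in>I. L j k m * L i l m) + (\<Sum>m\<in>I. L i k m * L j l m)
          - (\<Sum>m\<in>I. (L i j m - L j i m) * L m k l)"
begin

definition T :: "'i \<Rightarrow> 'i \<Rightarrow> 'i \<Rightarrow> real" where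
  "T i j k = G i j k - G j i k - (L i j k - L j i k)"

definition dT :: "'i \<Rightarrow> 'i \<Rightarrow> 'i \<Rightarrow> 'i \<Rightarrow> real" where
  "dT a i j k = dG a i j k - dG a j i k - (dL a i j k - dL a j i k)"

definition A :: "'i \<Rightarrow> 'i \<Rightarrow> 'i \<Rightarrow> real" where
  "A i j k = G i j k - L i j k"

definition \<theta> :: "'i \<Rightarrow> real" where
  "\<theta> i = (\<Sum>k\<in>I. T i k k)"

definition div\<theta> :: real where
  "div\<theta> = sum2 (\<lambda>i j. dT i i j j) - sum2 (\<lambda>i m. L i i m * \<theta> m)"

text \<open>
  The components \<open>g((\<nabla>\<^sub>a T)(e\<^sub>b, e\<^sub>c), e\<^sub>l)\<close> of the covariant derivative of the torsion; \<open>dT\<close> is the plain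
  derivative of the components of \<open>T\<close>.
\<close>

definition N :: "'i \<Rightarrow> 'i \<Rightarrow> 'i \<Rightarrow> 'i \<Rightarrow> real" where
  "N a b c l = dT a b c l - (\<Sum>m\<in>I. T b c m * G a l m) - (\<Sum>m\<in>I. G a b m * T m c l)
     - (\<Sum>m\<in>I. G a c m * T b m l)"

lemma T_skew: "T i j k = - T j i k"
  by (simp add: T_def)

lemma N_skew: "N a b c l = - N a c b l"
proof -
  have "dT a b c l = - dT a c b l" by (simp add: dT_def)
  moreover have "(\<Sum>m\<in>I. T b c m * G a l m) = - (\<Sum>m\<in>I. T c b m * G a l m)"
    by (subst T_skew) (simp add: sum_negf)
  moreover have "(\<Sum>m\<in>I. G a x m * T m y l) = - (\<Sum>m\<in>I. G a x m * T y m l)" for x y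
    by (subst T_skew) (simp add: sum_negf)
  ultimately show ?thesis by (simp add: N_def)
qed

lemma A_skew: "A i j k = - A i k j"
  unfolding A_def using G_skew[of i j k] L_skew[of i j k] by simp

text \<open>
  Koszul's trick: \<open>A\<close> is skew in its last two slots, and \<open>A i j k - A j i k = T i j k\<close>.
\<close>

lemma A_eq_T: "A i j k = (T i j k - T j k i + T k i j) / 2"
  using A_skew[of i j k] A_skew[of j i k] A_skew[of k i j] by (simp add: T_def A_def)

lemma T_diag: "T i j j = A j j i"
  using A_skew[of j i j] A_skew[of i j j] by (simp add: T_def A_def)

lemma dT_diag: "dT a i j j = dG a j j i - dL a j j i"
  using dG_skew[of a j i j] dG_skew[of a i j j] dL_skew[of a j i j] dL_skew[of a i j j]
  by (simp add: dT_def)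

lemma \<theta>_eq_trace: "\<theta> m = (\<Sum>j\<in>I. A j j m)"
  by (simp add: \<theta>_def T_diag)

text \<open>
  Substitute \<open>G = L + A\<close>.  The terms with derivatives give twice the sum of the \<open>dT i i j j\<close>.  Of the
  terms linear in \<open>A\<close>, those with \<open>L i i m\<close> complete this to \<open>2 div \<theta>\<close>; all others are multiples of one
  sum (\<open>q1\<close>, \<open>q2\<close>, \<open>q3\<close>) and cancel.
\<close>

lemma scalar_curvature_difference:
  "sum2 (\<lambda>i j. R i j j i) - sum2 (\<lambda>i j. RD i j j i) =
     2 * div\<theta> - (\<Sum>m\<in>I. \<theta> m * \<theta> m) + sum3 (\<lambda>i j m. A i j m * A j i m)"
proof -
  have G: "G i j k = L i j k + A i j k" for i j k by (simp add: A_def)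
  have d: "sum2 (\<lambda>i j. dG i j j i) - sum2 (\<lambda>i j. dG j i j i) - (sum2 (\<lambda>i j. dL i j j i) - sum2 (\<lambda>i j. dL j i j i))
      = 2 * sum2 (\<lambda>i j. dT i i j j)"
  proof -
    have "sum2 (\<lambda>i j. dG j i j i) = - sum2 (\<lambda>i j. dG i j j i)"
      by (subst sum2_swap, subst dG_skew) simp
    moreover have "sum2 (\<lambda>i j. dL j i j i) = - sum2 (\<lambda>i j. dL i j j i)"
      by (subst sum2_swap, subst dL_skew) simp
    ultimately show ?thesis by (simp add: dT_diag)
  qed
  have t: "sum3 (\<lambda>i j m. A j j m * A i i m) = (\<Sum>m\<in>I. \<theta> m * \<theta> m)"
  proof -
    have "sum3 (\<lambda>i j m. A j j m * A i i m) = sum3 (\<lambda>m i j. A j j m * A i i m)"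
      by (rule sum3_rotate)
    then show ?thesis by (simp add: sum3_def \<theta>_eq_trace sum_product mult.commute)
  qed
  have Lt: "sum3 (\<lambda>i j m. L i i m * A j j m) = sum2 (\<lambda>i m. L i i m * \<theta> m)"
    by (subst sum3_swap23) (simp add: sum3_def sum2_def \<theta>_eq_trace sum_distrib_left)
  have Lt': "sum3 (\<lambda>i j m. L j j m * A i i m) = sum2 (\<lambda>i m. L i i m * \<theta> m)"
    by (subst sum3_swap12) (rule Lt)
  have Lt'': "sum3 (\<lambda>i j m. A j j m * L i i m) = sum2 (\<lambda>i m. L i i m * \<theta> m)"
    using Lt by (simp only: mult.commute)
  have q1: "sum3 (\<lambda>i j m. L i j m * A j i m) = sum3 (\<lambda>i j m. L i j m * A m j i)"
  proof (subst sum3_swap23, rule arg_cong[of _ _ sum3], intro ext)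
    fix i j m show "L i m j * A m i j = L i j m * A m j i"
      using L_skew[of i m j] A_skew[of m i j] by simp
  qed
  have q2: "sum3 (\<lambda>i j m. A i j m * L j i m) = sum3 (\<lambda>i j m. L i j m * A m j i)"
    by (subst sum3_swap12) (simp only: q1 mult.commute)
  have q3: "sum3 (\<lambda>i j m. L j i m * A m j i) = - sum3 (\<lambda>i j m. L i j m * A m j i)"
  proof -
    have "sum3 (\<lambda>i j m. L j i m * A m j i) = sum3 (\<lambda>i j m. - (L i j m * A m j i))"
    proof (subst sum3_swap12, rule arg_cong[of _ _ sum3], intro ext)
      fix i j m show "L i j m * A m i j = - (L i j m * A m j i)"
        using A_skew[of m i j] by simp
    qed
    then show ?thesis by simp
  qed
  show ?thesis
    unfolding R_components RD_components div\<theta>_def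
    using d t Lt Lt' Lt'' q1 q2 q3
    by (simp add: G algebra_simps)
qed

text \<open>
  The trace of \<open>\<nabla> \<theta>\<close>, as contraction commutes with \<open>\<nabla>\<close>.  Passing from \<open>\<nabla>\<close> to \<open>D\<close> costs \<open>|\<theta>|\<^sup>2\<close>, because
  \<open>\<theta>\<close> is also the trace of \<open>A\<close>.
\<close>

lemma N_trace: "sum2 (\<lambda>i j. N i i j j) = div\<theta> - (\<Sum>m\<in>I. \<theta> m * \<theta> m)"
proof -
  have "sum3 (\<lambda>i j m. G i j m * T i m j) = sum3 (\<lambda>i j m. - (T i j m * G i j m))"
  proof (subst sum3_swap23, rule arg_cong[of _ _ sum3], intro ext)
    fix i j m show "G i m j * T i j m = - (T i j m * G i j m)" using G_skew[of i m j] by simp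
  qed
  moreover have "sum3 (\<lambda>i j m. G i i m * T m j j) = sum2 (\<lambda>i m. L i i m * \<theta> m) + (\<Sum>m\<in>I. \<theta> m * \<theta> m)"
  proof -
    have "sum3 (\<lambda>i j m. G i i m * T m j j) = sum2 (\<lambda>i m. G i i m * \<theta> m)"
      by (subst sum3_swap23) (simp add: sum3_def sum2_def \<theta>_def sum_distrib_left)
    moreover have "sum2 (\<lambda>i m. A i i m * \<theta> m) = (\<Sum>m\<in>I. \<theta> m * \<theta> m)"
      by (subst sum2_swap) (simp add: sum2_def \<theta>_eq_trace[of] sum_distrib_right)
    moreover have "G i j k = L i j k + A i j k" for i j k by (simp add: A_def)
    ultimately show ?thesis by (simp add: algebra_simps)
  qed
  ultimately show ?thesis by (simp add: N_def div\<theta>_def)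
qed

lemma A_square: "sum3 (\<lambda>i j m. A i j m * A j i m) =
    sum3 (\<lambda>i j k. (T i j k)\<^sup>2) / 4 - sum3 (\<lambda>i j k. T i j k * T k i j) / 2"
proof -
  have e: "A i j m * A j i m = (1/4) * ((T m i j)\<^sup>2 + (T j m i)\<^sup>2 - (T i j m)\<^sup>2) - (1/2) * (T m i j * T j m i)" for i j m
    unfolding A_eq_T using T_skew[of j i m] T_skew[of i m j] T_skew[of m j i]
    by (simp add: power2_eq_square field_simps)
  have 1: "sum3 (\<lambda>i j m. (T m i j)\<^sup>2) = sum3 (\<lambda>i j k. (T i j k)\<^sup>2)"
    by (subst sum3_rotate) (rule refl)
  have 2: "sum3 (\<lambda>i j m. (T j m i)\<^sup>2) = sum3 (\<lambda>i j k. (T i j k)\<^sup>2)"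
    by (subst sum3_rotate, subst sum3_rotate) (rule refl)
  have 3: "sum3 (\<lambda>i j m. T m i j * T j m i) = sum3 (\<lambda>i j k. T i j k * T k i j)"
    by (subst sum3_rotate) (rule refl)
  show ?thesis unfolding e by (simp add: 1 2 3)
qed

lemma antisymmetrization_square:
  "sum3 (\<lambda>i j k. ((T j k i + T i j k + T k i j) / 3)\<^sup>2) =
    sum3 (\<lambda>i j k. (T i j k)\<^sup>2) / 3 + 2 / 3 * sum3 (\<lambda>i j k. T i j k * T k i j)"
proof -
  have e: "((T j k i + T i j k + T k i j) / 3)\<^sup>2 = (1/9) * ((T j k i)\<^sup>2 + (T i j k)\<^sup>2 + (T k i j)\<^sup>2)
     + (2/9) * (T j k i * T i j k + T i j k * T k i j + T k i j * T j k i)" for i j k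
    by (simp add: power2_eq_square field_simps)
  have 1: "sum3 (\<lambda>i j m. (T m i j)\<^sup>2) = sum3 (\<lambda>i j k. (T i j k)\<^sup>2)"
    by (subst sum3_rotate) (rule refl)
  have 2: "sum3 (\<lambda>i j m. (T j m i)\<^sup>2) = sum3 (\<lambda>i j k. (T i j k)\<^sup>2)"
    by (subst sum3_rotate, subst sum3_rotate) (rule refl)
  have 3: "sum3 (\<lambda>i j m. T m i j * T j m i) = sum3 (\<lambda>i j k. T i j k * T k i j)"
    by (subst sum3_rotate) (rule refl)
  have 4: "sum3 (\<lambda>i j m. T j m i * T i j m) = sum3 (\<lambda>i j k. T i j k * T k i j)"
    by (subst sum3_rotate, subst sum3_rotate) (rule refl)
  show ?thesis unfolding e by (simp add: 1 2 3 4)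
qed

end

text \<open>
  A Hermitian frame: \<open>J e\<^sub>i = eps i e\<^bsub>s i\<^esub>\<close> with an involution \<open>s\<close> and signs \<open>eps\<close>.  The assumptions with \<open>J\<close> in their name
  express \<open>\<nabla> J = 0\<close> and \<open>T(JX, Y) = T(X, JY)\<close>, together with their derivatives.
\<close>

locale chern_components = connection_components I G L dG dL R RD
  for I :: "'i set" and G L dG dL R RD +
  fixes s :: "'i \<Rightarrow> 'i" and eps :: "'i \<Rightarrow> real"
  assumes s_mem: "\<And>i. i \<in> I \<Longrightarrow> s i \<in> I" and s_s: "\<And>i. i \<in> I \<Longrightarrow> s (s i) = i"
    and eps_s: "\<And>i. i \<in> I \<Longrightarrow> eps (s i) = - eps i" and eps_square: "\<And>i. eps i * eps i = 1"
    and G_J: "\<And>i j k. eps j * eps k * G i (s j) (s k) = G i j k"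
    and dG_J: "\<And>a i j k. eps j * eps k * dG a i (s j) (s k) = dG a i j k"
    and T_J: "\<And>i j k. eps i * T (s i) j k = eps j * T i (s j) k"
    and dT_J: "\<And>a i j k. eps i * dT a (s i) j k = eps j * dT a i (s j) k"
    and bianchi: "\<And>a b c l. R a b c l + R b c a l + R c a b l =
         dT a b c l - (\<Sum>m\<in>I. T b c m * G a l m) + (\<Sum>m\<in>I. (L b c m - L c b m) * T a m l)
       + (dT b c a l - (\<Sum>m\<in>I. T c a m * G b l m) + (\<Sum>m\<in>I. (L c a m - L a c m) * T b m l))
       + (dT c a b l - (\<Sum>m\<in>I. T a b m * G c l m) + (\<Sum>m\<in>I. (L a b m - L b a m) * T c m l))"
begin

lemma sum_s: "(\<Sum>i\<in>I. f (s i)) = (\<Sum>i\<in>I. f i)"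
  by (rule sum.reindex_bij_witness[of _ s s]) (auto simp: s_mem s_s)

lemma sum2_s1: "sum2 (\<lambda>i j. f (s i) j) = sum2 f"
  unfolding sum2_def by (rule sum_s[of "\<lambda>i. \<Sum>j\<in>I. f i j"])

lemma sum2_s2: "sum2 (\<lambda>i j. f i (s j)) = sum2 f"
  unfolding sum2_def by (rule sum.cong[OF refl sum_s])

lemma sum2_cong: "(\<And>i j. i \<in> I \<Longrightarrow> j \<in> I \<Longrightarrow> f i j = h i j) \<Longrightarrow> sum2 f = sum2 h"
  unfolding sum2_def by (intro sum.cong refl)

lemma R_skew: "R i j k l = - R i j l k"
proof -
  have "(\<Sum>m\<in>I. (L i j m - L j i m) * G m k l) = - (\<Sum>m\<in>I. (L i j m - L j i m) * G m l k)"
    by (subst G_skew) (simp add: sum_negf)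
  then show ?thesis
    unfolding R_components using dG_skew[of i j k l] dG_skew[of j i k l]
    by (simp add: mult.commute)
qed

lemma R_J: "eps k * eps l * R i j (s k) (s l) = R i j k l"
proof -
  have GG: "eps k * eps l * (\<Sum>m\<in>I. G a (s k) m * G b (s l) m) = (\<Sum>m\<in>I. G a k m * G b l m)" for a b
  proof -
    have "(\<Sum>m\<in>I. G a (s k) m * G b (s l) m) = (\<Sum>m\<in>I. G a (s k) (s m) * G b (s l) (s m))"
      by (rule sum_s[symmetric])
    then have "eps k * eps l * (\<Sum>m\<in>I. G a (s k) m * G b (s l) m) =
        (\<Sum>m\<in>I. eps k * eps l * (eps m * eps m) * (G a (s k) (s m) * G b (s l) (s m)))"
      by (simp add: eps_square sum_distrib_left)
    also have "\<dots> = (\<Sum>m\<in>I. G a k m * G b l m)"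
      by (intro sum.cong refl, subst (3) G_J[symmetric], subst (4) G_J[symmetric]) (simp add: mult_ac)
    finally show ?thesis .
  qed
  have CG: "eps k * eps l * (\<Sum>m\<in>I. C m * G m (s k) (s l)) = (\<Sum>m\<in>I. C m * G m k l)" for C
    by (subst (2) G_J[symmetric]) (simp add: sum_distrib_left mult_ac)
  show ?thesis
    unfolding R_components
    by (simp only: distrib_left right_diff_distrib GG CG dG_J)
qed

text \<open>
  The terms that correct the plain derivative of the torsion to its covariant derivative come from the bracket,
  \<open>[X, Y] = \<nabla>\<^sub>X Y - \<nabla>\<^sub>Y X - T(X, Y)\<close>; its last summand leaves the quadratic terms \<open>T(T(X, Y), Z)\<close>.
\<close>

lemma bianchi_N: "R a b c l + R b c a l + R c a b l =
    N a b c l + N b c a l + N c a b l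
    + (\<Sum>m\<in>I. T a b m * T m c l) + (\<Sum>m\<in>I. T b c m * T m a l) + (\<Sum>m\<in>I. T c a m * T m b l)"
proof -
  have C: "(\<Sum>m\<in>I. (L x y m - L y x m) * T z m l) =
      - (\<Sum>m\<in>I. G x y m * T m z l) - (\<Sum>m\<in>I. G y x m * T z m l) + (\<Sum>m\<in>I. T x y m * T m z l)" for x y z
  proof -
    have "(L x y m - L y x m) * T z m l = - (G x y m * T m z l) - G y x m * T z m l + T x y m * T m z l" for m
    proof -
      have "L x y m - L y x m = G x y m - G y x m - T x y m" by (simp add: T_def)
      moreover have "T m z l = - T z m l" by (rule T_skew)
      ultimately show ?thesis by (simp only:) (simp add: algebra_simps)
    qed
    then show ?thesis by (simp add: sum.distrib sum_subtractf sum_negf)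
  qed
  show ?thesis unfolding bianchi C N_def by simp
qed

text \<open>
  The condition \<open>T(JX, Y) = T(X, JY)\<close> passes to \<open>\<nabla> T\<close>, because \<open>J\<close> is parallel.
\<close>

lemma N_J: "eps b * N a (s b) c l = eps c * N a b (s c) l"
proof -
  have GT: "eps x * (\<Sum>m\<in>I. G a (s x) m * T m y l) = eps y * (\<Sum>m\<in>I. G a x m * T m (s y) l)" for x y
  proof -
    have "eps x * (\<Sum>m\<in>I. G a (s x) m * T m y l) = eps x * (\<Sum>m\<in>I. G a (s x) (s m) * T (s m) y l)"
      by (simp only: sum_s[of "\<lambda>m. G a (s x) m * T m y l"])
    also have "\<dots> = (\<Sum>m\<in>I. (eps x * eps m * G a (s x) (s m)) * (eps m * T (s m) y l))"
      unfolding sum_distrib_left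
    proof (intro sum.cong refl)
      fix m
      have "eps x * (G a (s x) (s m) * T (s m) y l) = (eps m * eps m) * (eps x * (G a (s x) (s m) * T (s m) y l))"
        by (simp only: eps_square mult_1)
      then show "eps x * (G a (s x) (s m) * T (s m) y l) =
          eps x * eps m * G a (s x) (s m) * (eps m * T (s m) y l)" by (simp only: mult_ac)
    qed
    also have "\<dots> = eps y * (\<Sum>m\<in>I. G a x m * T m (s y) l)"
      by (simp only: G_J T_J) (simp add: sum_distrib_left mult_ac)
    finally show ?thesis .
  qed
  have 1: "eps b * (\<Sum>m\<in>I. T (s b) c m * G a l m) = eps c * (\<Sum>m\<in>I. T b (s c) m * G a l m)"
    by (simp only: sum_distrib_left mult.assoc[symmetric] T_J)
  have sk: "(\<Sum>m\<in>I. G a x m * T y m l) = - (\<Sum>m\<in>I. G a x m * T m y l)" for x y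
    by (subst T_skew) (simp add: sum_negf)
  show ?thesis
    unfolding N_def sk
    using dT_J[of b a c l] 1 GT[of b c] GT[of c b] by (simp add: algebra_simps)
qed

lemma N_s_zero: "N a b (s b) l = 0"
proof -
  have "eps b * N a (s b) b l = eps b * N a b (s b) l" by (rule N_J)
  then have "eps b * (eps b * N a b (s b) l) = 0" using N_skew[of a "s b" b l] by simp
  then show ?thesis using eps_square[of b] by (simp add: mult.assoc[symmetric])
qed

lemma T_s_zero: "T b (s b) l = 0"
proof -
  have "eps b * T (s b) b l = eps b * T b (s b) l" by (rule T_J)
  then have "eps b * (eps b * T b (s b) l) = 0" using T_skew[of "s b" b l] by simp
  then show ?thesis using eps_square[of b] by (simp add: mult.assoc[symmetric])
qed

text \<open>
  Replace \<open>e\<^sub>i\<close> by \<open>J e\<^sub>i\<close> in the sum over \<open>i\<close>; the sign is that of \<open>J\<^sup>2 = -1\<close>.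
\<close>

lemma sum2_flip_first:
  "sum2 (\<lambda>i j. eps i * eps j * f (s i) i j) = - sum2 (\<lambda>i j. eps i * eps j * f i (s i) j)"
proof -
  have "sum2 (\<lambda>i j. eps i * eps j * f (s i) i j) = sum2 (\<lambda>i j. eps (s i) * eps j * f (s (s i)) (s i) j)"
    by (rule sum2_s1[symmetric])
  also have "\<dots> = sum2 (\<lambda>i j. - (eps i * eps j * f i (s i) j))"
    by (rule sum2_cong) (simp add: eps_s s_s)
  finally show ?thesis by simp
qed

text \<open>
  The Bianchi identity for \<open>e\<^sub>i, J e\<^sub>i, e\<^sub>j\<close>, paired with \<open>J e\<^sub>j\<close> and summed.  Terms with \<open>T(e\<^sub>i, J e\<^sub>i)\<close> vanish, and of the
  surviving ones those with \<open>e\<^sub>i\<close> and \<open>J e\<^sub>i\<close> exchanged have equal sums.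
\<close>

lemma hermitian_scalar_curvature_components:
  "sum2 (\<lambda>i j. eps i * eps j * R i (s i) j (s j)) + 2 * sum2 (\<lambda>i j. R i j j i) =
    2 * sum2 (\<lambda>i j. N i i j j) + 2 * sum3 (\<lambda>i j k. T i j k * T k i j)"
proof -
  have b: "eps i * eps j * R i (s i) j (s j) + eps i * eps j * R (s i) j i (s j) + eps i * eps j * R j i (s i) (s j)
      = eps i * eps j * N i (s i) j (s j) + eps i * eps j * N (s i) j i (s j)
       + eps i * eps j * (\<Sum>m\<in>I. T (s i) j m * T m i (s j)) + eps i * eps j * (\<Sum>m\<in>I. T j i m * T m (s i) (s j))" for i j
  proof -
    have "R i (s i) j (s j) + R (s i) j i (s j) + R j i (s i) (s j) = N i (s i) j (s j) + N (s i) j i (s j)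
        + (\<Sum>m\<in>I. T (s i) j m * T m i (s j)) + (\<Sum>m\<in>I. T j i m * T m (s i) (s j))"
      using bianchi_N[of i "s i" j "s j"] by (simp add: N_s_zero T_s_zero)
    then show ?thesis by (simp only: distrib_left[symmetric])
  qed
  have R1: "sum2 (\<lambda>i j. eps i * eps j * R j i (s i) (s j)) = sum2 (\<lambda>i j. R i j j i)"
    unfolding R_J by (rule sum2_swap)
  have R2: "sum2 (\<lambda>i j. eps i * eps j * R (s i) j i (s j)) = sum2 (\<lambda>i j. R i j j i)"
    unfolding sum2_flip_first[of "\<lambda>x y j. R x j y (s j)"] R_J by (subst R_skew) simp
  have N1: "sum2 (\<lambda>i j. eps i * eps j * N i (s i) j (s j)) = sum2 (\<lambda>i j. N i i j j)"
  proof -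
    have "eps i * eps j * N i (s i) j (s j) = N i i (s j) (s j)" for i j
    proof -
      have "eps i * eps j * N i (s i) j (s j) = eps j * (eps i * N i (s i) j (s j))" by simp
      also have "\<dots> = (eps j * eps j) * N i i (s j) (s j)" by (simp only: N_J mult.assoc)
      finally show ?thesis by (simp add: eps_square)
    qed
    then show ?thesis by (simp add: sum2_s2[of "\<lambda>i j. N i i j j"])
  qed
  have N2: "sum2 (\<lambda>i j. eps i * eps j * N (s i) j i (s j)) = sum2 (\<lambda>i j. N i i j j)"
  proof -
    have "N i j (s i) (s j) = - N i (s i) j (s j)" for i j by (rule N_skew)
    then show ?thesis
      using N1 by (simp add: sum2_flip_first[of "\<lambda>x y j. N x j y (s j)"])
  qed
  have T1: "sum2 (\<lambda>i j. eps i * eps j * (\<Sum>m\<in>I. T (s i) j m * T m i (s j))) = sum3 (\<lambda>i j k. T i j k * T k i j)"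
  proof -
    have "eps i * eps j * (\<Sum>m\<in>I. T (s i) j m * T m i (s j)) = (\<Sum>m\<in>I. T i (s j) m * T m i (s j))" for i j
    proof -
      have "eps i * eps j * (\<Sum>m\<in>I. T (s i) j m * T m i (s j)) = eps j * (\<Sum>m\<in>I. (eps i * T (s i) j m) * T m i (s j))"
        by (simp add: sum_distrib_left mult_ac)
      also have "\<dots> = (eps j * eps j) * (\<Sum>m\<in>I. T i (s j) m * T m i (s j))"
        by (simp only: T_J) (simp add: sum_distrib_left mult_ac)
      finally show ?thesis by (simp add: eps_square)
    qed
    then have "sum2 (\<lambda>i j. eps i * eps j * (\<Sum>m\<in>I. T (s i) j m * T m i (s j))) =
        sum2 (\<lambda>i j. (\<lambda>i j. \<Sum>m\<in>I. T i j m * T m i j) i (s j))" by simp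
    also have "\<dots> = sum2 (\<lambda>i j. \<Sum>m\<in>I. T i j m * T m i j)" by (rule sum2_s2)
    finally show ?thesis by simp
  qed
  have T2: "sum2 (\<lambda>i j. eps i * eps j * (\<Sum>m\<in>I. T j i m * T m (s i) (s j))) = sum3 (\<lambda>i j k. T i j k * T k i j)"
  proof -
    have "(\<Sum>m\<in>I. T j i m * T m (s i) (s j)) = - (\<Sum>m\<in>I. T i j m * T m (s i) (s j))" for i j
      by (subst T_skew) (simp add: sum_negf)
    then show ?thesis
      using T1 by (simp add: sum2_flip_first[of "\<lambda>x y j. \<Sum>m\<in>I. T x j m * T m y (s j)"])
  qed
  have "sum2 (\<lambda>i j. eps i * eps j * R i (s i) j (s j)) + sum2 (\<lambda>i j. eps i * eps j * R (s i) j i (s j))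
      + sum2 (\<lambda>i j. eps i * eps j * R j i (s i) (s j)) =
      sum2 (\<lambda>i j. eps i * eps j * N i (s i) j (s j)) + sum2 (\<lambda>i j. eps i * eps j * N (s i) j i (s j))
      + sum2 (\<lambda>i j. eps i * eps j * (\<Sum>m\<in>I. T (s i) j m * T m i (s j)))
      + sum2 (\<lambda>i j. eps i * eps j * (\<Sum>m\<in>I. T j i m * T m (s i) (s j)))"
    unfolding sum2_simps(1)[symmetric] b ..
  then show ?thesis unfolding R1 R2 N1 N2 T1 T2 by simp
qed

theorem scalar_curvature_identity:
  "- 1/2 * sum2 (\<lambda>i j. eps i * eps j * R i (s i) j (s j)) - sum2 (\<lambda>i j. RD i j j i) =
    div\<theta> - 27/2 * (1/6 * sum3 (\<lambda>i j k. ((T j k i + T i j k + T k i j) / 3)\<^sup>2))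
    + 2 * (1/2 * sum3 (\<lambda>i j k. (T i j k)\<^sup>2))"
  using hermitian_scalar_curvature_components scalar_curvature_difference
  unfolding antisymmetrization_square A_square N_trace by (simp add: field_simps)

end

section \<open>The torsion of the Chern connection and the torsion 1-form\<close>

locale chern_mfd = herm_mfd M g J for M :: "('p, 'e::euclidean_space) manifold" and g J +
  fixes nab D :: "'p conn"
  assumes chern: "chern_connection M J g nab" and levi_civita: "levi_civita_connection M g D"
begin

sublocale ch: metric_conn M g nab
  using chern by unfold_locales (simp add: chern_connection_def)

sublocale lc: metric_conn M g D
  using levi_civita by unfold_locales (simp add: levi_civita_connection_def)

abbreviation tor :: "'p vfield \<Rightarrow> 'p vfield \<Rightarrow> 'p vfield" where
  "tor \<equiv> torsion M nab"

lemma lie_bracket_lc: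
  assumes "open_in U" "q \<in> U" "vf U X" "vf U Y"
  shows "lie X Y q = D X Y q - D Y X q"
proof -
  have "torsion M D X Y q = 0"
    using levi_civita[unfolded levi_civita_connection_def, THEN conjunct2, rule_format, OF assms(1,3,4,2)] .
  then show ?thesis by (simp add: torsion_def)
qed

lemma nab_J:
  assumes "open_in U" "q \<in> U" "vf U X" "vf U Y"
  shows "nab X (fapp J Y) q = fapp J (nab X Y) q"
  using chern[unfolded chern_connection_def, THEN conjunct2, rule_format, OF assms(1,3,4,2)] by (rule conjunct1)

lemma torsion_J:
  assumes "open_in U" "q \<in> U" "vf U X" "vf U Y"
  shows "tor (fapp J X) (fapp J Y) q = - tor X Y q"
  using chern[unfolded chern_connection_def, THEN conjunct2, rule_format, OF assms(1,3,4,2)] by (rule conjunct2)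

lemma J_diff:
  assumes "q \<in> points" "u \<in> TM q" "v \<in> TM q"
  shows "J q (u - v) = J q u - J q v"
proof -
  have "J q (tscale 1 u + tscale (-1) v) = tscale 1 (J q u) + tscale (-1) (J q v)"
    using acs[unfolded almost_complex_structure_def, THEN conjunct1] assms by blast
  moreover have "tscale 1 a + tscale (-1) b = a - b" for a b :: "'p tvec" by (simp add: fun_eq_iff)
  ultimately show ?thesis by simp
qed

text \<open>
  Apply \<open>T(JX, JY) = - T(X, Y)\<close> with \<open>J Y\<close> in place of \<open>Y\<close>.
\<close>

lemma torsion_J_swap:
  assumes U: "open_in U" "q \<in> U" and X: "vf U X" and Y: "vf U Y"
    and W: "vf U W"
  shows "fpair g (tor (fapp J X) Y) W q = fpair g (tor X (fapp J Y)) W q"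
proof -
  note o = U(1)
  note JX = vf_J[OF o X] and JY = vf_J[OF o Y]
  have t: "tensorial U q (\<lambda>Z. fpair g (tor (fapp J X) Z) W q)"
    by (rule ch.torsion_tensorial2[OF U JX W])
  have "fapp J (fapp J Y) r = fscale (\<lambda>_. -1) Y r" if "r \<in> U" for r
    using J_J[OF open_in_topspace[OF o that] vf_tangent[OF Y that]] by (simp add: fapp_def fun_eq_iff)
  from tensorial_cong[OF t vf_J[OF o JY] this]
  have "fpair g (tor (fapp J X) (fapp J (fapp J Y))) W q =
      fpair g (tor (fapp J X) (fscale (\<lambda>_. -1) Y)) W q" .
  also have "\<dots> = - fpair g (tor (fapp J X) Y) W q"
    using tensorial_fscale[OF t smooth_fun_const[OF o, of "-1"] Y] by simp
  finally have "fpair g (tor (fapp J X) (fapp J (fapp J Y))) W q =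
      - fpair g (tor (fapp J X) Y) W q" .
  moreover have "fpair g (tor (fapp J X) (fapp J (fapp J Y))) W q =
      - fpair g (tor X (fapp J Y)) W q"
    unfolding fpair_def torsion_J[OF U X JY]
    by (rule g_uminus[OF open_in_topspace[OF U] vf_tangent[OF ch.torsion_vf[OF o X JY] U(2)] vf_tangent[OF W U(2)]])
  ultimately show ?thesis by simp
qed

lemma torsion_J_self:
  assumes U: "open_in U" "q \<in> U" and X: "vf U X" and W: "vf U W"
  shows "fpair g (tor X (fapp J X)) W q = 0"
  using torsion_J_swap[OF U X X W] ch.torsion_fpair_sym[OF U X vf_J[OF U(1) X] W] by simp

lemma fpair_J_skew:
  assumes U: "open_in U" "q \<in> U" and X: "vf U X" and Y: "vf U Y"
  shows "fpair g (fapp J X) Y q = - fpair g X (fapp J Y) q"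
  unfolding fpair_def fapp_def
  by (rule J_skew[OF open_in_topspace[OF U] vf_tangent[OF X U(2)] vf_tangent[OF Y U(2)]])

lemma fpair_J_J:
  assumes U: "open_in U" "q \<in> U" and X: "vf U X" and Y: "vf U Y"
  shows "fpair g (fapp J X) (fapp J Y) q = fpair g X Y q"
  unfolding fpair_def fapp_def
  by (rule J_orth[OF open_in_topspace[OF U] vf_tangent[OF X U(2)] vf_tangent[OF Y U(2)]])

lemma fpair_fundamental_form: "fpair (fundamental_form J g) X Y = fpair g (fapp J X) Y"
  by (simp add: fpair_def fundamental_form_def fapp_def)

text \<open>
  The fundamental form is parallel, so only the torsion contributes to its exterior derivative.
\<close>

lemma ext_deriv_fundamental_form:
  assumes U: "open_in U" "q \<in> U" and X: "vf U X" and Y: "vf U Y"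
    and Z: "vf U Z"
  shows "ext_deriv2 M (fundamental_form J g) X Y Z q =
     fpair g (fapp J (tor X Y)) Z q - fpair g (fapp J (tor X Z)) Y q
     + fpair g (fapp J (tor Y Z)) X q"
proof -
  note o = U(1) and q = U(2) and t = open_in_topspace[OF U]
  let ?F = "\<lambda>A B. fpair g (fapp J A) B q"
  have skew: "?F A B = - ?F B A" if "vf U A" "vf U B" for A B
    using fpair_J_skew[OF U that] fpair_sym[OF U that(1) vf_J[OF o that(2)]] by simp
  have d: "A q (fpair g (fapp J B) C) = ?F (nab A B) C - ?F (nab A C) B"
    if A: "vf U A" and B: "vf U B" and C: "vf U C" for A B C
    using ch.nab_metric[OF o A vf_J[OF o B] C q] nab_J[OF U A B] skew[OF B ch.nab_vf[OF o A C]]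
    by (simp add: fpair_def)
  \<comment> \<open>Eliminate the brackets in favour of covariant derivatives and torsion.\<close>
  have br: "?F (lie A B) C = ?F (nab A B) C - ?F (nab B A) C - ?F (tor A B) C"
    if A: "vf U A" and B: "vf U B" and C: "vf U C" for A B C
  proof -
    note v = ch.nab_vf[OF o A B] ch.nab_vf[OF o B A] ch.torsion_vf[OF o A B]
    note T = vf_tangent[OF v(1) q] vf_tangent[OF v(2) q] vf_tangent[OF v(3) q] vf_tangent[OF C q]
    have "lie A B q = nab A B q - nab B A q - tor A B q"
      by (simp add: torsion_def)
    then show ?thesis
      by (simp only: fpair_def fapp_def J_diff[OF t tangent_diff_mem[OF t T(1,2)] T(3)] J_diff[OF t T(1,2)]
          g_diff[OF t tangent_diff_mem[OF t J_mem[OF t T(1)] J_mem[OF t T(2)]] J_mem[OF t T(3)] T(4)]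
          g_diff[OF t J_mem[OF t T(1)] J_mem[OF t T(2)] T(4)])
  qed
  show ?thesis
    unfolding ext_deriv2_def fpair_fundamental_form d[OF X Y Z] d[OF Y X Z] d[OF Z X Y]
      br[OF X Y Z] br[OF X Z Y] br[OF Y Z X] by simp
qed

lemma hermitian_frame_orthonormal: "hermitian_frame M J g U h \<Longrightarrow> on_frame U h"
  by (simp add: hermitian_frame_def)

lemma J_orthonormal_frame:
  assumes U: "open_in U" and h: "on_frame U h"
  shows "on_frame U (\<lambda>i. fapp J (h i))"
  unfolding orthonormal_frame_def
proof (intro conjI ballI)
  show "vf U (fapp J (h i))" if "i \<in> {1..DIM('e)}" for i
    by (rule vf_J[OF U frame_vf[OF h that]])
  show "fpair g (fapp J (h i)) (fapp J (h j)) q = (if i = j then 1 else 0)"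
    if "q \<in> U" "i \<in> {1..DIM('e)}" "j \<in> {1..DIM('e)}" for q i j
    using fpair_J_J[OF U that(1) frame_vf[OF h that(2)] frame_vf[OF h that(3)]] frame_fpair[OF h that] by simp
qed

text \<open>
  For each \<open>i\<close>, the sum \<open>dF(e\<^sub>i, J e\<^sub>i, X)\<close> has the term with \<open>T(e\<^sub>i, J e\<^sub>i) = 0\<close> and the two terms
  \<open>g(T(X, e\<^sub>i), e\<^sub>i)\<close> and \<open>g(T(X, J e\<^sub>i), J e\<^sub>i)\<close>.  As the \<open>J e\<^sub>i\<close> form an orthonormal frame too, both sum to the
  trace.  This replaces the frames chosen point by point by one smooth frame, so that \<open>\<theta>\<close> can be
  differentiated.
\<close>

lemma torsion_1form_trace:
  assumes U: "open_in U" "q \<in> U" and e: "on_frame U e" and X: "vf U X"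
  shows "torsion_1form M J g X q = (\<Sum>k=1..DIM('e). fpair g (tor X (e k)) (e k) q)"
proof -
  let ?I = "{1..DIM('e)}"
  define h where "h = hermitian_frame_at M J g q"
  obtain V where V: "open_in V" "q \<in> V" "hermitian_frame M J g V h"
    using hermitian_frame_at[OF open_in_topspace[OF U]] unfolding h_def by blast
  define W where "W = U \<inter> V"
  have W: "open_in W" "q \<in> W" "W \<subseteq> U" "W \<subseteq> V" using U V by (auto simp: W_def)
  note oW = W(1) and qW = W(1,2)
  have eW: "on_frame W e" by (rule orthonormal_frame_subset[OF e W(3)])
  have hW: "on_frame W h"
    by (rule orthonormal_frame_subset[OF hermitian_frame_orthonormal[OF V(3)] W(4)])
  have XW: "vf W X" by (rule vf_subset[OF X W(3)])
  have 1: "ext_deriv2 M (fundamental_form J g) (h i) (fapp J (h i)) X q =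
      fpair g (tor X (fapp J (h i))) (fapp J (h i)) q + fpair g (tor X (h i)) (h i) q"
    if i: "i \<in> ?I" for i
  proof -
    note hi = frame_vf[OF hW i]
    note Jh = vf_J[OF oW hi] and JX = vf_J[OF oW XW]
    have "fpair g (fapp J (tor (h i) (fapp J (h i)))) X q = 0"
      using fpair_J_skew[OF qW ch.torsion_vf[OF oW hi Jh] XW] torsion_J_self[OF qW hi JX] by simp
    moreover have "fpair g (fapp J (tor (h i) X)) (fapp J (h i)) q = - fpair g (tor X (h i)) (h i) q"
      using fpair_J_J[OF qW ch.torsion_vf[OF oW hi XW] hi] ch.torsion_fpair_sym[OF qW XW hi hi] by simp
    moreover have "fpair g (fapp J (tor (fapp J (h i)) X)) (h i) q =
        fpair g (tor X (fapp J (h i))) (fapp J (h i)) q"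
      using fpair_J_skew[OF qW ch.torsion_vf[OF oW Jh XW] hi] ch.torsion_fpair_sym[OF qW XW Jh Jh] by simp
    ultimately show ?thesis
      by (simp add: ext_deriv_fundamental_form[OF qW hi Jh XW])
  qed
  have tr: "(\<Sum>k\<in>?I. fpair g (tor X (e k)) (e k) q) = (\<Sum>k\<in>?I. fpair g (tor X (f k)) (f k) q)"
    if "on_frame W f" for f
    by (rule trace_frame_independent[OF qW eW that ch.torsion_tensorial2[OF qW XW]
          fpair_tensorial2[OF qW ch.torsion_vf[OF oW XW]]])
  have "torsion_1form M J g X q = 1/2 * (\<Sum>i\<in>?I. fpair g (tor X (fapp J (h i))) (fapp J (h i)) q
      + fpair g (tor X (h i)) (h i) q)"
    unfolding torsion_1form_def h_def[symmetric] Let_def using 1 by simp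
  then show ?thesis
    unfolding sum.distrib tr[OF hW, symmetric] tr[OF J_orthonormal_frame[OF oW hW], symmetric] by simp
qed

text \<open>
  The torsion 1-form is also known as the Lee form.
\<close>

abbreviation lee :: "'p vfield \<Rightarrow> 'p \<Rightarrow> real" where
  "lee \<equiv> torsion_1form M J g"

lemma tensorial_sum:
  assumes "\<And>i. i \<in> I \<Longrightarrow> tensorial U q (B i)"
  shows "tensorial U q (\<lambda>X. \<Sum>i\<in>I. B i X)"
proof (rule tensorialI)
  show "(\<Sum>i\<in>I. B i X) = (\<Sum>i\<in>I. B i Y)" if "vf U X" "\<And>r. r \<in> U \<Longrightarrow> X r = Y r" for X Y
    by (intro sum.cong refl tensorial_cong[OF assms] that)
  show "(\<Sum>i\<in>I. B i (X + Y)) = (\<Sum>i\<in>I. B i X) + (\<Sum>i\<in>I. B i Y)"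
    if "vf U X" "vf U Y" for X Y
    unfolding sum.distrib[symmetric] by (intro sum.cong refl tensorial_add[OF assms] that)
  show "(\<Sum>i\<in>I. B i (fscale f X)) = f q * (\<Sum>i\<in>I. B i X)"
    if "smooth U f" "vf U X" for f X
    unfolding sum_distrib_left by (intro sum.cong refl tensorial_fscale[OF assms] that)
qed

lemma torsion_1form_tensorial:
  assumes U: "open_in U" "q \<in> U" and e: "on_frame U e"
  shows "tensorial U q (\<lambda>X. lee X q)"
  by (rule ch.tensorial_eqI[OF tensorial_sum[OF ch.torsion_tensorial[OF U frame_vf[OF e] frame_vf[OF e]]]
        torsion_1form_trace[OF U e] U(1)])

lemma torsion_1form_smooth:
  assumes U: "open_in U" and e: "on_frame U e" and X: "vf U X"
  shows "smooth U (lee X)"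
proof -
  have "smooth U (\<lambda>q. \<Sum>k=1..DIM('e). fpair g (tor X (e k)) (e k) q)"
    by (intro smooth_fun_sum[OF U] smooth_fpair[OF U] ch.torsion_vf[OF U X] frame_vf[OF e])
  moreover have "lee X q = (\<Sum>k=1..DIM('e). fpair g (tor X (e k)) (e k) q)"
    if "q \<in> U" for q
    by (rule torsion_1form_trace[OF U that e X])
  ultimately show ?thesis
    by (subst smooth_fun_cong[OF U, of _ "\<lambda>q. \<Sum>k=1..DIM('e). fpair g (tor X (e k)) (e k) q"])
qed

text \<open>
  The codifferential of \<open>\<theta>\<close> is minus the trace of the bilinear form \<open>(D\<^sub>X \<theta>)(Y) = X(\<theta>(Y)) - \<theta>(D\<^sub>X Y)\<close>.  It is tensorial
  in \<open>X\<close>, and also in \<open>Y\<close>, where the two terms with \<open>X f\<close> cancel.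
\<close>

lemma nabla_torsion_1form_tensorial1:
  assumes U: "open_in U" "q \<in> U" and e: "on_frame U e" and Y: "vf U Y"
  shows "tensorial U q (\<lambda>X. X q (lee Y) - lee (D X Y) q)"
proof (rule tensorialI)
  note o = U(1) and q = U(2)
  note t = torsion_1form_tensorial[OF U e]
  fix X Z assume X: "vf U X" and Z: "vf U Z"
  have "lee (D (X + Z) Y) q = lee (D X Y + D Z Y) q"
    by (rule tensorial_cong[OF t lc.nab_vf[OF o vf_add[OF o X Z] Y]]) (simp add: lc.nab_add1[OF o X Y Z])
  then show "(X + Z) q (lee Y) - lee (D (X + Z) Y) q =
     X q (lee Y) - lee (D X Y) q +
     (Z q (lee Y) - lee (D Z Y) q)"
    by (simp add: tensorial_add[OF t lc.nab_vf[OF o X Y] lc.nab_vf[OF o Z Y]])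
next
  note o = U(1) and q = U(2)
  note t = torsion_1form_tensorial[OF U e]
  fix f X assume f: "smooth U f" and X: "vf U X"
  have "lee (D (fscale f X) Y) q = lee (fscale f (D X Y)) q"
    by (rule tensorial_cong[OF t lc.nab_vf[OF o vf_fscale[OF o f X] Y]]) (simp add: lc.nab_fscale1[OF o X Y f])
  then show "fscale f X q (lee Y) - lee (D (fscale f X) Y) q =
     f q * (X q (lee Y) - lee (D X Y) q)"
    by (simp add: tensorial_fscale[OF t f lc.nab_vf[OF o X Y]] algebra_simps)
next
  note o = U(1) and q = U(2)
  fix X Z assume X: "vf U X" and eq: "\<And>r. r \<in> U \<Longrightarrow> X r = Z r"
  have "lee (D X Y) q = lee (D Z Y) q"
    by (rule tensorial_cong[OF torsion_1form_tensorial[OF U e] lc.nab_vf[OF o X Y]])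
       (rule lc.nab_cong[OF o X Y _ eq[symmetric] refl, symmetric])
  then show "X q (lee Y) - lee (D X Y) q =
      Z q (lee Y) - lee (D Z Y) q"
    using eq[OF q] by simp
qed

lemma nabla_torsion_1form_tensorial2:
  assumes U: "open_in U" "q \<in> U" and e: "on_frame U e" and X: "vf U X"
  shows "tensorial U q (\<lambda>Y. X q (lee Y) - lee (D X Y) q)"
proof (rule tensorialI)
  note o = U(1) and q = U(2)
  note t = torsion_1form_tensorial[OF o _ e] and Xq = vf_tangent[OF X q]
  have sm: "smooth_at M q (lee A)" if "vf U A" for A
    by (rule smooth_atI[OF U torsion_1form_smooth[OF o e that]])
  fix Y Z assume Y: "vf U Y" and Z: "vf U Z"
  have "lee (D X (Y + Z)) q = lee (D X Y + D X Z) q"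
    by (rule tensorial_cong[OF t[OF q] lc.nab_vf[OF o X vf_add[OF o Y Z]]]) (simp add: lc.nab_add2[OF o X Y Z])
  moreover have "X q (lee (Y + Z)) = X q (\<lambda>r. lee Y r + lee Z r)"
    by (rule tangent_cong[OF Xq U]) (rule tensorial_add[OF t Y Z])
  ultimately show "X q (lee (Y + Z)) - lee (D X (Y + Z)) q =
     X q (lee Y) - lee (D X Y) q +
     (X q (lee Z) - lee (D X Z) q)"
    by (simp add: tensorial_add[OF t[OF q] lc.nab_vf[OF o X Y] lc.nab_vf[OF o X Z]]
        tangent_add[OF Xq sm[OF Y] sm[OF Z]])
next
  note o = U(1) and q = U(2)
  note t = torsion_1form_tensorial[OF o _ e] and Xq = vf_tangent[OF X q]
  fix f Y assume f: "smooth U f" and Y: "vf U Y"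
  have sm: "smooth_at M q (lee Y)"
    by (rule smooth_atI[OF U torsion_1form_smooth[OF o e Y]])
  have Xf: "smooth U (\<lambda>r. X r f)" by (rule vf_smooth_self[OF o X f])
  note XY = lc.nab_vf[OF o X Y]
  have "lee (D X (fscale f Y)) q =
      lee (fscale (\<lambda>r. X r f) Y + fscale f (D X Y)) q"
    by (rule tensorial_cong[OF t[OF q] lc.nab_vf[OF o X vf_fscale[OF o f Y]]]) (simp add: lc.nab_fscale2[OF o X Y f])
  then have "lee (D X (fscale f Y)) q = X q f * lee Y q + f q * lee (D X Y) q"
    by (simp add: tensorial_add[OF t[OF q] vf_fscale[OF o Xf Y] vf_fscale[OF o f XY]]
        tensorial_fscale[OF t[OF q] Xf Y] tensorial_fscale[OF t[OF q] f XY])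
  moreover have "X q (lee (fscale f Y)) = X q (\<lambda>r. f r * lee Y r)"
    by (rule tangent_cong[OF Xq U]) (rule tensorial_fscale[OF t f Y])
  ultimately show "X q (lee (fscale f Y)) - lee (D X (fscale f Y)) q =
     f q * (X q (lee Y) - lee (D X Y) q)"
    by (simp add: tangent_mult[OF Xq smooth_atI[OF U f] sm] algebra_simps)
next
  note o = U(1) and q = U(2)
  note t = torsion_1form_tensorial[OF o _ e] and Xq = vf_tangent[OF X q]
  fix Y Z assume Y: "vf U Y" and eq: "\<And>r. r \<in> U \<Longrightarrow> Y r = Z r"
  have "lee (D X Y) q = lee (D X Z) q"
    by (rule tensorial_cong[OF t[OF q] lc.nab_vf[OF o X Y]])
       (rule lc.nab_cong[OF o X Y _ refl eq[symmetric], symmetric])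
  moreover have "X q (lee Y) = X q (lee Z)"
    by (rule tangent_cong[OF Xq U]) (rule tensorial_cong[OF t Y eq])
  ultimately show "X q (lee Y) - lee (D X Y) q =
      X q (lee Z) - lee (D X Z) q" by simp
qed

section \<open>Independence of the invariants from the frame\<close>

lemma on_frame_at_common:
  assumes U: "open_in U" "p \<in> U" and f: "on_frame U f"
  obtains W where "open_in W" "p \<in> W" "on_frame W (on_frame_at M g p)"
    "on_frame W f"
proof -
  obtain V where V: "open_in V" "p \<in> V" "on_frame V (on_frame_at M g p)"
    using on_frame_at[OF open_in_topspace[OF U]] by blast
  show thesis
    by (rule that[of "U \<inter> V"])
       (use U V f in \<open>auto intro: orthonormal_frame_subset\<close>)
qed

lemma scalar_curvature_frame:
  assumes U: "open_in U" "p \<in> U" and f: "on_frame U f"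
  shows "scalar_curvature M g D p =
    (\<Sum>i=1..DIM('e). \<Sum>j=1..DIM('e). fpair g (curvature M D (f i) (f j) (f j)) (f i) p)"
proof -
  let ?I = "{1..DIM('e)}"
  define e where "e = on_frame_at M g p"
  obtain W where W: "open_in W" "p \<in> W"
    and e: "on_frame W e" and f: "on_frame W f"
    using on_frame_at_common[OF U f] unfolding e_def by metis
  note oW = W(1) and qW = W
  note ve = frame_vf[OF e] and vf = frame_vf[OF f]
  have "(\<Sum>i\<in>?I. \<Sum>j\<in>?I. fpair g (curvature M D (e i) (e j) (e j)) (e i) p) =
      (\<Sum>i\<in>?I. \<Sum>j\<in>?I. fpair g (curvature M D (e i) (f j) (f j)) (e i) p)"
    by (intro sum.cong refl trace_frame_independent[OF qW e f lc.curvature_tensorial2[OF qW ve _ ve]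
          lc.curvature_tensorial3[OF qW ve _ ve]])
  also have "\<dots> = (\<Sum>j\<in>?I. \<Sum>i\<in>?I. fpair g (curvature M D (e i) (f j) (f j)) (e i) p)"
    by (rule sum.swap)
  also have "\<dots> = (\<Sum>j\<in>?I. \<Sum>i\<in>?I. fpair g (curvature M D (f i) (f j) (f j)) (f i) p)"
    by (intro sum.cong refl trace_frame_independent[OF qW e f lc.curvature_tensorial[OF qW vf vf]
          fpair_tensorial2[OF qW lc.curvature_vf[OF oW _ vf vf]]])
  also have "\<dots> = (\<Sum>i\<in>?I. \<Sum>j\<in>?I. fpair g (curvature M D (f i) (f j) (f j)) (f i) p)"
    by (rule sum.swap)
  finally show ?thesis by (simp only: scalar_curvature_def Let_def e_def)
qed

lemma codifferential_frame:
  assumes U: "open_in U" "p \<in> U" and f: "on_frame U f"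
  shows "codifferential M g D lee p =
    - (\<Sum>i=1..DIM('e). f i p (lee (f i)) - lee (D (f i) (f i)) p)"
proof -
  define e where "e = on_frame_at M g p"
  obtain W where W: "open_in W" "p \<in> W"
    and e: "on_frame W e" and f: "on_frame W f"
    using on_frame_at_common[OF U f] unfolding e_def by metis
  note qW = W(1,2)
  have "(\<Sum>i=1..DIM('e). e i p (lee (e i)) - lee (D (e i) (e i)) p) =
      (\<Sum>i=1..DIM('e). f i p (lee (f i)) - lee (D (f i) (f i)) p)"
    by (rule trace_frame_independent[OF qW e f nabla_torsion_1form_tensorial1[OF qW e]
          nabla_torsion_1form_tensorial2[OF qW e]])
  then show ?thesis by (simp only: codifferential_def Let_def e_def)
qed

lemma torsion_norm_frame:
  assumes U: "open_in U" "p \<in> U" and f: "on_frame U f"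
  shows "norm2_vector_2form M g (tor) p = 1/2 * (\<Sum>i=1..DIM('e). \<Sum>j=1..DIM('e). \<Sum>k=1..DIM('e).
    (fpair g (tor (f i) (f j)) (f k) p)\<^sup>2)"
proof -
  let ?I = "{1..DIM('e)}"
  define e where "e = on_frame_at M g p"
  obtain W where W: "open_in W" "p \<in> W"
    and e: "on_frame W e" and f: "on_frame W f"
    using on_frame_at_common[OF U f] unfolding e_def by metis
  note oW = W(1) and qW = W(1,2)
  have "(\<Sum>i\<in>?I. \<Sum>j\<in>?I. fpair g (tor (e i) (e j)) (tor (e i) (e j)) p) =
      (\<Sum>i\<in>?I. \<Sum>j\<in>?I. \<Sum>k\<in>?I. (fpair g (tor (e i) (e j)) (e k) p)\<^sup>2)"
    unfolding power2_eq_square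
    by (intro sum.cong refl parseval[OF qW e] ch.torsion_vf[OF oW] frame_vf[OF e])
  also have "\<dots> = (\<Sum>i\<in>?I. \<Sum>j\<in>?I. \<Sum>k\<in>?I. (fpair g (tor (f i) (f j)) (f k) p)\<^sup>2)"
    by (rule square_norm_frame_independent[OF qW e f ch.torsion_tensorial[OF qW] ch.torsion_tensorial2[OF qW]
          fpair_tensorial2[OF qW ch.torsion_vf[OF oW]]])
  finally show ?thesis by (simp only: norm2_vector_2form_def Let_def e_def)
qed

lemma torsion_3form_rotate: "torsion_3form M g nab X Y Z p = torsion_3form M g nab Y Z X p"
  by (simp add: torsion_3form_def Let_def)

text \<open>
  The other two slots follow because the form is invariant under cyclic permutations.
\<close>

lemma torsion_3form_tensorial:
  assumes U: "open_in U" "q \<in> U" and Y: "vf U Y" and Z: "vf U Z"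
  shows "tensorial U q (\<lambda>X. torsion_3form M g nab X Y Z q)"
proof -
  have t1: "tensorial U q (\<lambda>X. fpair g X (tor Y Z) q)"
    by (rule fpair_tensorial[OF U ch.torsion_vf[OF U(1) Y Z]])
  have t2: "tensorial U q (\<lambda>X. fpair g Z (tor X Y) q)"
    by (rule ch.tensorial_eqI[OF ch.torsion_tensorial[OF U Y Z] fpair_sym[OF U Z ch.torsion_vf[OF U(1) _ Y]] U(1)])
  have t3: "tensorial U q (\<lambda>X. fpair g Y (tor Z X) q)"
    by (rule ch.tensorial_eqI[OF ch.torsion_tensorial2[OF U Z Y] fpair_sym[OF U Y ch.torsion_vf[OF U(1) Z]] U(1)])
  from tensorial_lincomb[OF tensorial_lincomb[OF t1 t2, of 1 1] t3, of "1/3" "1/3"]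
  show ?thesis by (simp add: torsion_3form_def Let_def algebra_simps)
qed

lemma torsion_3form_norm_frame:
  assumes U: "open_in U" "p \<in> U" and f: "on_frame U f"
  shows "norm2_3form M g (torsion_3form M g nab) p = 1/6 * (\<Sum>i=1..DIM('e). \<Sum>j=1..DIM('e). \<Sum>k=1..DIM('e).
    (torsion_3form M g nab (f i) (f j) (f k) p)\<^sup>2)"
proof -
  let ?t = "\<lambda>X Y Z. torsion_3form M g nab X Y Z p"
  define e where "e = on_frame_at M g p"
  obtain W where W: "open_in W" "p \<in> W"
    and e: "on_frame W e" and f: "on_frame W f"
    using on_frame_at_common[OF U f] unfolding e_def by metis
  note qW = W(1,2)
  note t1 = torsion_3form_tensorial[OF qW]
  have t2: "tensorial W p (\<lambda>Y. ?t X Y Z)" if "vf W X" "vf W Z" for X Z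
    unfolding torsion_3form_rotate[of X] by (rule t1[OF that(2,1)])
  have t3: "tensorial W p (\<lambda>Z. ?t X Y Z)" if "vf W X" "vf W Y" for X Y
    unfolding torsion_3form_rotate[of _ X Y, symmetric] by (rule t1[OF that])
  from square_norm_frame_independent[OF qW e f t1 t2 t3]
  show ?thesis by (simp only: norm2_3form_def Let_def e_def)
qed

end

declare One_nat_def [simp del]

context metric_conn
begin

text \<open>
  Applies to two members of a frame: the connection coefficients of a metric connection are skew.
\<close>

lemma connection_skew:
  assumes U: "open_in U" "q \<in> U" and X: "vf U X" and Y: "vf U Y"
    and Z: "vf U Z" and const: "\<And>r. r \<in> U \<Longrightarrow> fpair g Y Z r = c"
  shows "fpair g (nab X Y) Z q = - fpair g (nab X Z) Y q"
proof -
  have "X q (fpair g Y Z) = X q (\<lambda>r. c)"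
    by (rule tangent_cong[OF vf_tangent[OF X U(2)] U const])
  also have "\<dots> = 0" by (rule tangent_const[OF vf_tangent[OF X U(2)] open_in_topspace[OF U]])
  finally show ?thesis
    using nab_metric[OF U(1) X Y Z U(2)] fpair_sym[OF U Y nab_vf[OF U(1) X Z]] by simp
qed

lemma curvature_components:
  assumes U: "open_in U" "q \<in> U" and e: "on_frame U e"
    and X: "vf U X" and Y: "vf U Y" and Z: "vf U Z" and W: "vf U W"
  shows "fpair g (curvature M nab X Y Z) W q =
     X q (fpair g (nab Y Z) W) - Y q (fpair g (nab X Z) W)
     - (\<Sum>m=1..DIM('e). fpair g (nab Y Z) (e m) q * fpair g (nab X W) (e m) q)
     + (\<Sum>m=1..DIM('e). fpair g (nab X Z) (e m) q * fpair g (nab Y W) (e m) q)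
     - (\<Sum>m=1..DIM('e). fpair g (lie X Y) (e m) q * fpair g (nab (e m) Z) W q)"
  using curvature_fpair[OF U X Y Z W]
    parseval[OF U e nab_vf[OF U(1) Y Z] nab_vf[OF U(1) X W]]
    parseval[OF U e nab_vf[OF U(1) X Z] nab_vf[OF U(1) Y W]]
    tensorial_expansion[OF U e vf_lie_bracket[OF U(1) X Y] nab_tensorial[OF U Z W]]
  by simp

end

section \<open>Evaluation in a Hermitian frame\<close>

text \<open>
  The frame is extended by zero to all indices, so that the component identities hold without side
  conditions on the indices.
\<close>

locale chern_frame = chern_mfd M g J nab D
  for M :: "('p, 'e::euclidean_space) manifold" and g J nab D +
  fixes U :: "'p set" and p :: 'p and h :: "nat \<Rightarrow> 'p vfield"
  assumes open_U: "open_in U" and p_in_U: "p \<in> U"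
    and frame: "hermitian_frame M J g U h"
    and frame_outside: "\<And>i. i \<notin> {1..DIM('e)} \<Longrightarrow> h i = 0"
begin

lemmas Up = open_U p_in_U

lemma h_on_frame: "on_frame U h"
  by (rule hermitian_frame_orthonormal[OF frame])

lemma h_vf: "vf U (h i)"
proof (cases "i \<in> {1..DIM('e)}")
  case True
  then show ?thesis by (rule frame_vf[OF h_on_frame])
next
  case False
  show ?thesis unfolding frame_outside[OF False] by (rule vf_zero[OF open_U])
qed

lemma h_p: "h i p \<in> TM p"
  by (rule vf_tangent[OF h_vf p_in_U])

text \<open>
  Frame fields have constant pairings, whose derivative vanishes; this is what makes \<open>G\<close> and \<open>L\<close> skew.
\<close>

lemma fpair_h_const: "\<exists>c. \<forall>r\<in>U. fpair g (h i) (h j) r = c"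
proof (cases "i \<in> {1..DIM('e)} \<and> j \<in> {1..DIM('e)}")
  case True
  then show ?thesis using frame_fpair[OF h_on_frame] by blast
next
  case False
  have "fpair g (h i) (h j) r = 0" if r: "r \<in> U" for r
  proof -
    have z: "fpair g 0 (h k) r = 0" for k
      using g_zero[OF open_in_topspace[OF open_U r] vf_tangent[OF h_vf r]] by (simp add: fpair_def)
    show ?thesis
      using False frame_outside z fpair_sym[OF open_U r h_vf h_vf, of i j] by metis
  qed
  then show ?thesis by blast
qed

text \<open>
  \<open>J\<close> exchanges \<open>h (2 \<alpha> - 1)\<close> and \<open>h (2 \<alpha>)\<close> up to sign.
\<close>

definition s :: "nat \<Rightarrow> nat" where
  "s i = (if odd i then i + 1 else i - 1)"

definition eps :: "nat \<Rightarrow> real" where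
  "eps i = (if odd i then 1 else - 1)"

lemma s_mem: "i \<in> {1..DIM('e)} \<Longrightarrow> s i \<in> {1..DIM('e)}"
proof -
  assume i: "i \<in> {1..DIM('e)}"
  show "s i \<in> {1..DIM('e)}"
  proof (cases "odd i")
    case True
    then have "i \<noteq> DIM('e)" using even_dim by metis
    then show ?thesis using i True by (auto simp: s_def)
  next
    case False
    then show ?thesis using i unfolding s_def atLeastAtMost_iff by presburger
  qed
qed

lemma s_s: "i \<in> {1..DIM('e)} \<Longrightarrow> s (s i) = i"
  by (auto simp: s_def)

lemma s_outside: "i \<notin> {1..DIM('e)} \<Longrightarrow> s i \<notin> {1..DIM('e)}"
proof -
  assume i: "i \<notin> {1..DIM('e)}"
  then consider "i = 0" | "i > DIM('e)" by force
  then show "s i \<notin> {1..DIM('e)}"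
  proof cases
    case 2
    then show ?thesis using even_dim by (cases "i = DIM('e) + 1") (auto simp: s_def)
  qed (simp add: s_def)
qed

lemma J_frame: "q \<in> U \<Longrightarrow> fapp J (h i) q = fscale (\<lambda>_. eps i) (h (s i)) q"
proof -
  assume q: "q \<in> U"
  note t = open_in_topspace[OF open_U q]
  have Jh: "h (2 * \<alpha>) q = J q (h (2 * \<alpha> - 1) q)" if "\<alpha> \<in> {1..DIM('e) div 2}" for \<alpha>
    using frame q that unfolding hermitian_frame_def fapp_def by blast
  have Jz: "J q 0 = 0"
    using J_diff[OF t tangent_zero_mem[OF t] tangent_zero_mem[OF t]] by simp
  show ?thesis
  proof (cases "i \<in> {1..DIM('e)}")
    case False
    then show ?thesis
      using Jz by (simp add: frame_outside[OF False] frame_outside[OF s_outside[OF False]] fapp_def fun_eq_iff)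
  next
    case i: True
    show ?thesis
    proof (cases "odd i")
      case True
      then obtain a where a: "i = 2 * a + 1" by (elim oddE)
      have "i \<noteq> DIM('e)" using even_dim True by metis
      then have "a + 1 \<in> {1..DIM('e) div 2}" using i a even_dim by auto
      moreover have "2 * (a + 1) = i + 1" "i + 1 - 1 = i" using a by simp_all
      ultimately have "h (i + 1) q = J q (h i q)" using Jh[of "a + 1"] by metis
      then show ?thesis using True by (simp add: s_def eps_def fapp_def fun_eq_iff)
    next
      case False
      then obtain a where a: "i = 2 * a" by auto
      have "a \<in> {1..DIM('e) div 2}" using i a by auto
      from Jh[OF this] have "h i q = J q (h (i - 1) q)" by (simp only: a)
      then have "J q (h i q) = - h (i - 1) q"
        by (simp only: J_J[OF t vf_tangent[OF h_vf q]])
      then show ?thesis using False by (simp add: s_def eps_def fapp_def fun_eq_iff)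
    qed
  qed
qed

lemma tensorial_J_frame:
  assumes "q \<in> U" "tensorial U q B"
  shows "B (fapp J (h i)) = eps i * B (h (s i))"
proof -
  have "B (fapp J (h i)) = B (fscale (\<lambda>_. eps i) (h (s i)))"
    by (rule tensorial_cong[OF assms(2) vf_J[OF open_U h_vf] J_frame])
  also have "\<dots> = eps i * B (h (s i))"
    by (rule tensorial_fscale[OF assms(2) smooth_fun_const[OF open_U] h_vf])
  finally show ?thesis .
qed

definition G :: "nat \<Rightarrow> nat \<Rightarrow> nat \<Rightarrow> 'p \<Rightarrow> real" where
  "G i j k = fpair g (nab (h i) (h j)) (h k)"

definition L :: "nat \<Rightarrow> nat \<Rightarrow> nat \<Rightarrow> 'p \<Rightarrow> real" where
  "L i j k = fpair g (D (h i) (h j)) (h k)"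

definition Tor :: "nat \<Rightarrow> nat \<Rightarrow> nat \<Rightarrow> 'p \<Rightarrow> real" where
  "Tor i j k = fpair g (tor (h i) (h j)) (h k)"

lemma G_at: "smooth_at M p (G i j k)" and L_at: "smooth_at M p (L i j k)"
  unfolding G_def L_def
  by (rule smooth_atI[OF Up smooth_fpair[OF open_U ch.nab_vf[OF open_U h_vf h_vf] h_vf]],
      rule smooth_atI[OF Up smooth_fpair[OF open_U lc.nab_vf[OF open_U h_vf h_vf] h_vf]])

lemma Tor_at: "smooth_at M p (Tor i j k)"
  unfolding Tor_def by (rule smooth_atI[OF Up smooth_fpair[OF open_U ch.torsion_vf[OF open_U h_vf h_vf] h_vf]])

text \<open>
  Component identities that hold on all of \<open>U\<close> can be differentiated at \<open>p\<close>.
\<close>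

lemma derivative_eq:
  assumes "\<And>q. q \<in> U \<Longrightarrow> a * f1 q = b * f2 q" "smooth_at M p f1" "smooth_at M p f2"
  shows "a * h i p f1 = b * h i p f2"
  using tangent_cong[OF h_p Up, of "\<lambda>q. a * f1 q" "\<lambda>q. b * f2 q" i] assms
  by (simp add: tangent_scale[OF h_p])

lemma G_skew: "q \<in> U \<Longrightarrow> G i j k q = - G i k j q"
  unfolding G_def using ch.connection_skew[OF open_U _ h_vf h_vf h_vf] fpair_h_const by metis

lemma L_skew: "q \<in> U \<Longrightarrow> L i j k q = - L i k j q"
  unfolding L_def using lc.connection_skew[OF open_U _ h_vf h_vf h_vf] fpair_h_const by metis

lemma bracket_components:
  assumes q: "q \<in> U"
  shows "fpair g (lie (h i) (h j)) (h k) q = L i j k q - L j i k q"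
  unfolding L_def fpair_def lie_bracket_lc[OF open_U q h_vf h_vf]
  by (rule g_diff[OF open_in_topspace[OF open_U q] vf_tangent[OF _ q] vf_tangent[OF _ q] vf_tangent[OF _ q]])
     (intro lc.nab_vf open_U h_vf)+

lemma Tor_components:
  assumes q: "q \<in> U"
  shows "Tor i j k q = G i j k q - G j i k q - (L i j k q - L j i k q)"
proof -
  note t = open_in_topspace[OF open_U q]
  have v: "nab (h i) (h j) q \<in> TM q" for i j
    by (rule vf_tangent[OF ch.nab_vf[OF open_U h_vf h_vf] q])
  have b: "lie (h i) (h j) q \<in> TM q"
    by (rule vf_tangent[OF vf_lie_bracket[OF open_U h_vf h_vf] q])
  note w = vf_tangent[OF h_vf q]
  show ?thesis
    unfolding bracket_components[OF q, symmetric] Tor_def G_def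
    by (simp only: fpair_def ch.torsion_apply g_diff[OF t tangent_diff_mem[OF t v v] b w] g_diff[OF t v v w])
qed

lemma G_J: assumes q: "q \<in> U" shows "eps j * eps k * G i (s j) (s k) q = G i j k q"
proof -
  have v: "nab (h i) (h j) q \<in> TM q" for i j
    by (rule vf_tangent[OF ch.nab_vf[OF open_U h_vf h_vf] q])
  have "fapp J (nab (h i) (h j)) q = nab (h i) (fapp J (h j)) q"
    by (rule nab_J[OF open_U q h_vf h_vf, symmetric])
  also have "\<dots> = nab (h i) (fscale (\<lambda>_. eps j) (h (s j))) q"
    by (rule ch.nab_cong[OF open_U h_vf vf_fscale[OF open_U smooth_fun_const[OF open_U] h_vf] q refl J_frame])
  also have "\<dots> = tscale (eps j) (nab (h i) (h (s j)) q)"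
    by (rule ch.nab_cscale2[OF open_U h_vf h_vf q])
  finally have J: "fapp J (nab (h i) (h j)) q = tscale (eps j) (nab (h i) (h (s j)) q)" .
  have "G i j k q = fpair g (fapp J (nab (h i) (h j))) (fapp J (h k)) q"
    unfolding G_def by (rule fpair_J_J[OF open_U q ch.nab_vf[OF open_U h_vf h_vf] h_vf, symmetric])
  also have "\<dots> = eps k * fpair g (fapp J (nab (h i) (h j))) (h (s k)) q"
    by (rule tensorial_J_frame[OF q fpair_tensorial2[OF open_U q vf_J[OF open_U ch.nab_vf[OF open_U h_vf h_vf]]]])
  also have "fpair g (fapp J (nab (h i) (h j))) (h (s k)) q = eps j * G i (s j) (s k) q"
    unfolding G_def fpair_def J by (rule g_scale[OF open_in_topspace[OF open_U q] v vf_tangent[OF h_vf q]])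
  finally show ?thesis by simp
qed

lemma Tor_J: assumes q: "q \<in> U" shows "eps i * Tor (s i) j k q = eps j * Tor i (s j) k q"
  using torsion_J_swap[OF open_U q h_vf h_vf h_vf, of i j k]
  unfolding Tor_def
  by (simp only: tensorial_J_frame[OF q ch.torsion_tensorial[OF open_U q h_vf h_vf]]
      tensorial_J_frame[OF q ch.torsion_tensorial2[OF open_U q h_vf h_vf]])

definition R :: "nat \<Rightarrow> nat \<Rightarrow> nat \<Rightarrow> nat \<Rightarrow> real" where
  "R i j k l = fpair g (curvature M nab (h i) (h j) (h k)) (h l) p"

definition RD :: "nat \<Rightarrow> nat \<Rightarrow> nat \<Rightarrow> nat \<Rightarrow> real" where
  "RD i j k l = fpair g (curvature M D (h i) (h j) (h k)) (h l) p"

lemma derivative_Tor: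
  "h a p (Tor i j k) = h a p (G i j k) - h a p (G j i k) - (h a p (L i j k) - h a p (L j i k))"
proof -
  have "h a p (Tor i j k) = h a p (\<lambda>q. (G i j k q + -1 * G j i k q) + (-1 * L i j k q + L j i k q))"
    by (rule tangent_cong[OF h_p Up]) (simp add: Tor_components)
  also have "\<dots> = h a p (G i j k) + -1 * h a p (G j i k) + (-1 * h a p (L i j k) + h a p (L j i k))"
    by (simp only: tangent_add[OF h_p] tangent_scale[OF h_p] smooth_at_add smooth_at_scale G_at L_at)
  finally show ?thesis by simp
qed

text \<open>
  Pair the Bianchi identity for frame fields with \<open>h l\<close>: metric compatibility turns the pairing of \<open>\<nabla>\<^sub>a T(h\<^sub>b, h\<^sub>c)\<close> into a derivative
  of components, and the brackets are expanded in the frame.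
\<close>

lemma bianchi_components:
  "R a b c l + R b c a l + R c a b l =
     h a p (Tor b c l) - (\<Sum>m=1..DIM('e). Tor b c m p * G a l m p)
       + (\<Sum>m=1..DIM('e). (L b c m p - L c b m p) * Tor a m l p)
     + (h b p (Tor c a l) - (\<Sum>m=1..DIM('e). Tor c a m p * G b l m p)
       + (\<Sum>m=1..DIM('e). (L c a m p - L a c m p) * Tor b m l p))
     + (h c p (Tor a b l) - (\<Sum>m=1..DIM('e). Tor a b m p * G c l m p)
       + (\<Sum>m=1..DIM('e). (L a b m p - L b a m p) * Tor c m l p))"
proof -
  note o = open_U and t = open_in_topspace[OF Up]
  have v1: "nab (h x) (tor (h y) (h z)) p \<in> TM p" for x y z
    by (rule vf_tangent[OF ch.nab_vf[OF o h_vf ch.torsion_vf[OF o h_vf h_vf]] p_in_U])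
  have v2: "tor (h x) (lie (h y) (h z)) p \<in> TM p" for x y z
    by (rule vf_tangent[OF ch.torsion_vf[OF o h_vf vf_lie_bracket[OF o h_vf h_vf]] p_in_U])
  have v3: "curvature M nab (h x) (h y) (h z) p \<in> TM p" for x y z
    by (rule vf_tangent[OF ch.curvature_vf[OF o h_vf h_vf h_vf] p_in_U])
  have e1: "fpair g (nab (h x) (tor (h y) (h z))) (h l) p =
      h x p (Tor y z l) - (\<Sum>m=1..DIM('e). Tor y z m p * G x l m p)" for x y z
    using ch.nab_metric[OF o h_vf ch.torsion_vf[OF o h_vf h_vf] h_vf p_in_U, of x y z l]
      parseval[OF Up h_on_frame ch.torsion_vf[OF o h_vf h_vf] ch.nab_vf[OF o h_vf h_vf], of y z x l]
    by (simp add: Tor_def G_def)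
  have e2: "fpair g (tor (h x) (lie (h y) (h z))) (h l) p =
      (\<Sum>m=1..DIM('e). (L y z m p - L z y m p) * Tor x m l p)" for x y z
    using tensorial_expansion[OF Up h_on_frame vf_lie_bracket[OF o h_vf h_vf] ch.torsion_tensorial2[OF Up h_vf h_vf],
        of x y z l]
    by (simp add: Tor_def bracket_components[OF p_in_U])
  have "R a b c l + R b c a l + R c a b l =
    g p (curvature M nab (h a) (h b) (h c) p + curvature M nab (h b) (h c) (h a) p + curvature M nab (h c) (h a) (h b) p) (h l p)"
    by (simp add: R_def fpair_def g_add[OF t] tangent_add_mem[OF t] v3 h_p)
  then show ?thesis
    unfolding ch.first_bianchi_identity[OF Up h_vf h_vf h_vf] e1[symmetric] e2[symmetric]
    by (simp add: fpair_def g_add[OF t] tangent_add_mem[OF t] v1 v2 h_p)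
qed

sublocale chern_components "{1..DIM('e)}" "\<lambda>i j k. G i j k p" "\<lambda>i j k. L i j k p"
    "\<lambda>a i j k. h a p (G i j k)" "\<lambda>a i j k. h a p (L i j k)" R RD s eps
  rewrites "connection_components.T (\<lambda>i j k. G i j k p) (\<lambda>i j k. L i j k p) = (\<lambda>i j k. Tor i j k p)"
    and "connection_components.dT (\<lambda>a i j k. h a p (G i j k)) (\<lambda>a i j k. h a p (L i j k)) =
      (\<lambda>a i j k. h a p (Tor i j k))"
proof -
  have cc: "connection_components {1..DIM('e)} (\<lambda>i j k. G i j k p) (\<lambda>i j k. L i j k p)
    (\<lambda>a i j k. h a p (G i j k)) (\<lambda>a i j k. h a p (L i j k)) R RD"
  proof
    show "G i j k p = - G i k j p" "L i j k p = - L i k j p" for i j k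
      by (rule G_skew[OF p_in_U], rule L_skew[OF p_in_U])
    show "h a p (G i j k) = - h a p (G i k j)" for a i j k
      using derivative_eq[of 1 "G i j k" "-1" "G i k j" a] G_skew[of _ i j k] G_at by simp
    show "h a p (L i j k) = - h a p (L i k j)" for a i j k
      using derivative_eq[of 1 "L i j k" "-1" "L i k j" a] L_skew[of _ i j k] L_at by simp
    show "R i j k l = h i p (G j k l) - h j p (G i k l)
          - (\<Sum>m=1..DIM('e). G j k m p * G i l m p) + (\<Sum>m=1..DIM('e). G i k m p * G j l m p)
          - (\<Sum>m=1..DIM('e). (L i j m p - L j i m p) * G m k l p)" for i j k l
      unfolding R_def ch.curvature_components[OF Up h_on_frame h_vf h_vf h_vf h_vf]
      by (simp add: G_def bracket_components[OF p_in_U])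
    show "RD i j k l = h i p (L j k l) - h j p (L i k l)
          - (\<Sum>m=1..DIM('e). L j k m p * L i l m p) + (\<Sum>m=1..DIM('e). L i k m p * L j l m p)
          - (\<Sum>m=1..DIM('e). (L i j m p - L j i m p) * L m k l p)" for i j k l
      unfolding RD_def lc.curvature_components[OF Up h_on_frame h_vf h_vf h_vf h_vf] bracket_components[OF p_in_U]
      by (simp add: L_def)
  qed
  interpret cc: connection_components "{1..DIM('e)}" "\<lambda>i j k. G i j k p" "\<lambda>i j k. L i j k p"
    "\<lambda>a i j k. h a p (G i j k)" "\<lambda>a i j k. h a p (L i j k)" R RD by (rule cc)
  show T: "cc.T = (\<lambda>i j k. Tor i j k p)"
    by (intro ext) (simp add: cc.T_def Tor_components[OF p_in_U])
  show dT: "cc.dT = (\<lambda>a i j k. h a p (Tor i j k))"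
    by (intro ext) (simp add: cc.dT_def derivative_Tor)
  show "chern_components {1..DIM('e)} (\<lambda>i j k. G i j k p) (\<lambda>i j k. L i j k p)
    (\<lambda>a i j k. h a p (G i j k)) (\<lambda>a i j k. h a p (L i j k)) R RD s eps"
  proof (unfold_locales, unfold T dT)
    show "i \<in> {1..DIM('e)} \<Longrightarrow> s i \<in> {1..DIM('e)}" for i by (rule s_mem)
    show "i \<in> {1..DIM('e)} \<Longrightarrow> s (s i) = i" for i by (rule s_s)
    show "i \<in> {1..DIM('e)} \<Longrightarrow> eps (s i) = - eps i" for i by (auto simp: s_def eps_def)
    show "eps i * eps i = 1" for i by (simp add: eps_def)
    show "eps j * eps k * G i (s j) (s k) p = G i j k p" for i j k by (rule G_J[OF p_in_U])
    show "eps j * eps k * h a p (G i (s j) (s k)) = h a p (G i j k)" for a i j k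
      using derivative_eq[of "eps j * eps k" "G i (s j) (s k)" 1 "G i j k" a] G_J G_at by simp
    show "eps i * Tor (s i) j k p = eps j * Tor i (s j) k p" for i j k by (rule Tor_J[OF p_in_U])
    show "eps i * h a p (Tor (s i) j k) = eps j * h a p (Tor i (s j) k)" for a i j k
      by (rule derivative_eq[OF Tor_J Tor_at Tor_at])
  qed (rule bianchi_components)
qed

lemma torsion_1form_components: "q \<in> U \<Longrightarrow> lee (h i) q = (\<Sum>k=1..DIM('e). Tor i k k q)"
  unfolding Tor_def by (rule torsion_1form_trace[OF open_U _ h_on_frame h_vf])

lemma codifferential_components: "- codifferential M g D lee p = div\<theta>"
proof -
  have d: "h i p (lee (h i)) = (\<Sum>k=1..DIM('e). h i p (Tor i k k))" for i
  proof -
    have "h i p (lee (h i)) = h i p (\<lambda>q. \<Sum>k=1..DIM('e). Tor i k k q)"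
      by (rule tangent_cong[OF h_p Up torsion_1form_components])
    then show ?thesis by (simp only: tangent_sum[OF h_p open_in_topspace[OF Up] Tor_at])
  qed
  have l: "lee (D (h i) (h i)) p = (\<Sum>m=1..DIM('e). L i i m p * \<theta> m)" for i
    using tensorial_expansion[OF Up h_on_frame lc.nab_vf[OF open_U h_vf h_vf] torsion_1form_tensorial[OF Up h_on_frame]]
    unfolding \<theta>_def by (simp add: L_def torsion_1form_components[OF p_in_U])
  show ?thesis
    unfolding codifferential_frame[OF Up h_on_frame] d l div\<theta>_def sum2_def
    by (simp add: sum_subtractf)
qed

lemma chern_scalar_components:
  "(\<Sum>i=1..DIM('e). \<Sum>j=1..DIM('e).
      fpair g (curvature M nab (h i) (fapp J (h i)) (h j)) (fapp J (h j)) p) =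
    sum2 (\<lambda>i j. eps i * eps j * R i (s i) j (s j))"
  unfolding sum2_def
proof (intro sum.cong refl)
  fix i j
  have "fpair g (curvature M nab (h i) (fapp J (h i)) (h j)) (fapp J (h j)) p =
      eps i * fpair g (curvature M nab (h i) (h (s i)) (h j)) (fapp J (h j)) p"
    by (rule tensorial_J_frame[OF p_in_U ch.curvature_tensorial2[OF Up h_vf h_vf vf_J[OF open_U h_vf]]])
  also have "fpair g (curvature M nab (h i) (h (s i)) (h j)) (fapp J (h j)) p = eps j * R i (s i) j (s j)"
    unfolding R_def
    by (rule tensorial_J_frame[OF p_in_U fpair_tensorial2[OF Up ch.curvature_vf[OF open_U h_vf h_vf h_vf]]])
  finally show "fpair g (curvature M nab (h i) (fapp J (h i)) (h j)) (fapp J (h j)) p =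
      eps i * eps j * R i (s i) j (s j)" by simp
qed

lemma torsion_3form_components:
  "torsion_3form M g nab (h i) (h j) (h k) p = (Tor j k i p + Tor i j k p + Tor k i j p) / 3"
  unfolding torsion_3form_def Let_def Tor_def
  using fpair_sym[OF Up h_vf ch.torsion_vf[OF open_U h_vf h_vf]] by simp

lemma frame_identity:
  "- 1/2 * (\<Sum>i=1..DIM('e). \<Sum>j=1..DIM('e).
      fpair g (curvature M nab (h i) (fapp J (h i)) (h j)) (fapp J (h j)) p) - scalar_curvature M g D p =
   - codifferential M g D lee p
   - 27/2 * norm2_3form M g (torsion_3form M g nab) p
   + 2 * norm2_vector_2form M g (tor) p"
  using scalar_curvature_identity
  unfolding chern_scalar_components codifferential_components
    scalar_curvature_frame[OF Up h_on_frame] torsion_norm_frame[OF Up h_on_frame]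
    torsion_3form_norm_frame[OF Up h_on_frame] torsion_3form_components sum3_def
  by (simp only: sum2_def RD_def Tor_def)

end

theorem corollary2p3:
  fixes M :: "('p, 'e::euclidean_space) manifold"
    and J :: "'p endo_field"
    and g :: "'p bilin_field"
    and nab D :: "'p conn"
    and p :: 'p
  assumes "almost_hermitian M J g"
    and "chern_connection M J g nab"
    and "levi_civita_connection M g D"
    and "p \<in> topspace (mtop M)"
  shows "hermitian_scalar_curvature M J g nab p - scalar_curvature M g D p =
           - codifferential M g D (torsion_1form M J g) p
           - 27/2 * norm2_3form M g (torsion_3form M g nab) p
           + 2 * norm2_vector_2form M g (torsion M nab) p"
proof -
  interpret chern_mfd M g J nab D
    using assms(1-3) by unfold_locales (simp_all add: almost_hermitian_def)
  define e where "e = hermitian_frame_at M J g p"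
  obtain U where U: "openin (mtop M) U" "p \<in> U" "hermitian_frame M J g U e"
    using hermitian_frame_at[OF assms(4)] unfolding e_def by blast
  define h where "h i = (if i \<in> {1..DIM('e)} then e i else 0)" for i
  have h: "h i = e i" if "i \<in> {1..DIM('e)}" for i using that by (simp add: h_def)
  interpret chern_frame M g J nab D U p h
  proof
    show "hermitian_frame M J g U h"
      unfolding hermitian_frame_def orthonormal_frame_def
    proof (intro conjI ballI)
      fix q \<alpha> assume q: "q \<in> U" and \<alpha>: "\<alpha> \<in> {1..DIM('e) div 2}"
      then have "2 * \<alpha> \<in> {1..DIM('e)}" "2 * \<alpha> - 1 \<in> {1..DIM('e)}" by auto
      then show "h (2 * \<alpha>) q = fapp J (h (2 * \<alpha> - 1)) q"
        using U(3) q \<alpha> by (simp add: h hermitian_frame_def)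
    qed (use U(3) in \<open>simp_all add: h hermitian_frame_def orthonormal_frame_def\<close>)
    show "h i = 0" if "i \<notin> {1..DIM('e)}" for i
      using that by (simp only: h_def if_False)
  qed (use U in simp_all)
  have "(\<Sum>i=1..DIM('e). \<Sum>j=1..DIM('e). fpair g (curvature M nab (e i) (fapp J (e i)) (e j)) (fapp J (e j)) p) =
      (\<Sum>i=1..DIM('e). \<Sum>j=1..DIM('e). fpair g (curvature M nab (h i) (fapp J (h i)) (h j)) (fapp J (h j)) p)"
    by (intro sum.cong refl) (simp only: h)
  then have "hermitian_scalar_curvature M J g nab p = - 1/2 * (\<Sum>i=1..DIM('e). \<Sum>j=1..DIM('e).
      fpair g (curvature M nab (h i) (fapp J (h i)) (h j)) (fapp J (h j)) p)"
    unfolding hermitian_scalar_curvature_def chern_scalar_curvature_def Let_def e_def[symmetric]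
    by simp
  then show ?thesis using frame_identity by simp
qed

end
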